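(* Let $d\ge 3$, $1 \le p \le \frac{4}{3}$ and $f \in L^p(\mathbb{R}^d)$. Then $\sigma$-almost every point of the unit sphere $\mathbb{S}^{d-1}$ is a Lebesgue point of $\widehat{f}$, and for $\sigma$-almost every $x \in \mathbb{S}^{d-1}$ the regularised value of $\widehat{f}$ at $x$ coincides with $\mathcal{R}f(x)$.
   Context: $\sigma$ denotes the standard surface measure on $\mathbb{S}^{d-1}$. For $f\in L^p(\mathbb{R}^d)$ with $1\le p\le 2$, $\widehat f$ is the Fourier transform, a locally integrable function (in $L^{p'}$ by Hausdorff–Young). A point $x$ is a Lebesgue point of $\widehat f$ if there is a number $c$ (the regularised value of $\widehat f$ at $x$) with $\lim_{r\to 0}\frac{1}{|B(x,r)|}\int_{B(x,r)}|\widehat f(y)-c|\,\mathrm{d}y=0$. The restriction operator $\mathcal{R}$ is the unique bounded linear operator from $L^p(\mathbb{R}^d)$ to $L^1(\mathbb{S}^{d-1},\sigma)$ which agrees with $f\mapsto\widehat f|_{\mathbb{S}^{d-1}}$ on Schwartz functions. *)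

theory Defs
  imports "HOL-Analysis.Analysis"
begin

definition Lp_fun :: "real \<Rightarrow> ('a::euclidean_space \<Rightarrow> complex) \<Rightarrow> bool" where
  "Lp_fun p f \<longleftrightarrow> f \<in> borel_measurable lebesgue \<and>
     integrable lebesgue (\<lambda>x. norm (f x) powr p)"

definition Lp_norm :: "real \<Rightarrow> ('a::euclidean_space \<Rightarrow> complex) \<Rightarrow> real" where
  "Lp_norm p f = (LINT x|lebesgue. norm (f x) powr p) powr (1 / p)"

definition fourier_L1 :: "('a::euclidean_space \<Rightarrow> complex) \<Rightarrow> 'a \<Rightarrow> complex" where
  "fourier_L1 f \<xi> = (LINT x|lebesgue. f x * cis (- 2 * pi * (x \<bullet> \<xi>)))"

text \<open>g is (a representative of) the Fourier transform of f in L^p, 1 <= p <= 2: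
  g is locally integrable and satisfies the multiplication formula
  int g phi = int f (phi^) for all bounded measurable phi of bounded support.
  This determines g uniquely almost everywhere.\<close>
definition is_fourier_transform ::
  "('a::euclidean_space \<Rightarrow> complex) \<Rightarrow> ('a \<Rightarrow> complex) \<Rightarrow> bool" where
  "is_fourier_transform f g \<longleftrightarrow>
     (\<forall>K. compact K \<longrightarrow> set_integrable lebesgue K g) \<and>
     (\<forall>\<phi>::'a \<Rightarrow> complex. \<phi> \<in> borel_measurable lebesgue \<longrightarrow> bounded (range \<phi>) \<longrightarrow>
        bounded {x. \<phi> x \<noteq> 0} \<longrightarrow>
        (LINT \<xi>|lebesgue. g \<xi> * \<phi> \<xi>) = (LINT x|lebesgue. f x * fourier_L1 \<phi> x))"

fun iter_deriv :: "('a::euclidean_space \<Rightarrow> complex) \<Rightarrow> 'a list \<Rightarrow> 'a \<Rightarrow> complex" where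
  "iter_deriv f [] = f"
| "iter_deriv f (v # vs) = iter_deriv (\<lambda>x. frechet_derivative f (at x) v) vs"

definition schwartz :: "('a::euclidean_space \<Rightarrow> complex) \<Rightarrow> bool" where
  "schwartz f \<longleftrightarrow>
     (\<forall>vs x. iter_deriv f vs differentiable (at x)) \<and>
     (\<forall>vs (k::nat). bounded (range (\<lambda>x. (1 + norm x) ^ k * norm (iter_deriv f vs x))))"

definition sphere_measure :: "'a::euclidean_space measure" where
  "sphere_measure = measure_of (sphere 0 1) (sets (restrict_space lborel (sphere 0 1)))
     (\<lambda>A. of_nat DIM('a) * emeasure lborel {r *\<^sub>R x | r x. x \<in> A \<and> 0 < r \<and> r \<le> 1})"

definition lebesgue_point_val :: "('a::euclidean_space \<Rightarrow> complex) \<Rightarrow> 'a \<Rightarrow> complex \<Rightarrow> bool" where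
  "lebesgue_point_val g x c \<longleftrightarrow>
     ((\<lambda>r. (LINT y:ball x r|lebesgue. norm (g y - c)) / measure lebesgue (ball x r))
        \<longlongrightarrow> 0) (at_right 0)"

definition is_restriction_operator ::
  "real \<Rightarrow> (('a::euclidean_space \<Rightarrow> complex) \<Rightarrow> ('a \<Rightarrow> complex)) \<Rightarrow> bool" where
  "is_restriction_operator p R \<longleftrightarrow>
     (\<forall>f. Lp_fun p f \<longrightarrow> integrable sphere_measure (R f)) \<and>
     (\<forall>f g a b. Lp_fun p f \<longrightarrow> Lp_fun p g \<longrightarrow>
        (AE x in sphere_measure. R (\<lambda>y. a * f y + b * g y) x = a * R f x + b * R g x)) \<and>
     (\<exists>C. \<forall>f. Lp_fun p f \<longrightarrow>
        (LINT x|sphere_measure. norm (R f x)) \<le> C * Lp_norm p f) \<and>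
     (\<forall>f. schwartz f \<longrightarrow> (AE x in sphere_measure. R f x = fourier_L1 f x))"

end

theory Submission
  imports Defs "HOL-Probability.Probability"
begin

text \<open>
  By density of Schwartz functions, it is enough to bound the measure of the set \<open>E\<close> of points \<open>x\<close> in a
  small cap \<open>\<Omega>\<close> of the sphere for which some average of \<open>\<bar>\<hat>f\<bar>\<close> over a ball \<open>B(x, r(x))\<close>
  exceeds \<open>\<alpha>\<close>. Let \<open>W\<close> be the superposition of these normalised ball indicators over \<open>x \<in> E\<close>. Then
  \<open>\<alpha> \<sigma>(E) \<le> \<integral> \<bar>\<hat>f\<bar> W = \<integral> f \<hat>\<psi>\<close> with \<open>\<bar>\<psi>\<bar> \<le> W\<close>, so everything reduces to
  bounding \<open>\<parallel>\<hat>\<psi>\<parallel>\<^sub>4\<^sup>4 \<le> \<parallel>W * W\<parallel>\<^sub>2\<^sup>2\<close> by a multiple of \<open>\<sigma>(E)\<^sup>2\<close>. Expanding the square gives an integral over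
  \<open>E\<^sup>4\<close> of four convolved ball kernels at \<open>x\<^sub>1 + x\<^sub>2 - x\<^sub>3 - x\<^sub>4\<close>. The largest of the four radii absorbs the
  others, and integrating out the pair that does not carry it costs only a constant, because
  \<open>\<sigma>\<^sub>\<Omega> * \<sigma>\<^sub>\<Omega>\<close> has a bounded density when \<open>d \<ge> 3\<close>.
\<close>

section \<open>Averages over balls\<close>

text \<open>The exponent 4/3 enters as the dual of 4: an L^4 norm of a Fourier transform is an L^2
  norm of a convolution square, and there absolute values may be put inside. Smaller p is not
  interpolated: one pointwise inequality of Young type covers 1 \<le> p \<le> 4/3, its free
  parameter t being chosen so large that the term quadratic in \<sigma>(E) is absorbed on the left.

  Two geometric obstacles shape the estimate. The density of \<sigma> * \<sigma> blows up like 1/|w|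
  at w = 0, through antipodal pairs; a cap of radius 1/2 contains no such pair. For d = 2 it is also
  unbounded near |w| = 2. For d \<ge> 3 it is not, because two coordinates remain free beside the
  direction of w and |z|^2 has constant density in the plane.

  The multiplication formula is given for bounded test functions of bounded support. The radii are
  therefore dyadic and at first bounded below, which makes W bounded; the final bound does not see
  this truncation.\<close>

lemma nn_integral_lborel_translate:
  fixes F :: "'a::euclidean_space \<Rightarrow> ennreal"
  assumes [measurable]: "F \<in> borel_measurable borel"
  shows "(\<integral>\<^sup>+v. F (c + v) \<partial>lborel) = (\<integral>\<^sup>+v. F v \<partial>lborel)"
  by (subst (2) lborel_distr_plus[of c, symmetric]) (simp add: nn_integral_distr)

lemma nn_integral_lborel_reflect:
  fixes F :: "'a::euclidean_space \<Rightarrow> ennreal"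
  assumes [measurable]: "F \<in> borel_measurable borel"
  shows "(\<integral>\<^sup>+v. F (- v) \<partial>lborel) = (\<integral>\<^sup>+v. F v \<partial>lborel)"
  by (subst (2) lborel_affine[of "-1" 0])
     (simp_all add: nn_integral_distr nn_integral_density one_ennreal_def[symmetric])

text \<open>The ball stays centred at 0 and F is shifted instead. Translating F then only moves the
  centre, and an average of an average is a double integral over two fixed balls.\<close>

definition ball_avg :: "real \<Rightarrow> ('a::euclidean_space \<Rightarrow> ennreal) \<Rightarrow> 'a \<Rightarrow> ennreal" where
  "ball_avg r F c = ennreal (1 / (unit_ball_vol (real DIM('a)) * r ^ DIM('a))) *
     (\<integral>\<^sup>+v. F (c + v) * indicator (ball 0 r) v \<partial>lborel)"

lemma indicator_ball_measurable [measurable (raw)]: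
  fixes f :: "'b \<Rightarrow> real" and g :: "'b \<Rightarrow> 'a::euclidean_space"
  assumes [measurable]: "f \<in> borel_measurable M" "g \<in> borel_measurable M"
  shows "(\<lambda>x. indicator (ball 0 (f x)) (g x) :: ennreal) \<in> borel_measurable M"
proof -
  have "(\<lambda>x. indicator (ball 0 (f x)) (g x) :: ennreal) = (\<lambda>x. indicator {x. norm (g x) < f x} x)"
    by (auto simp: indicator_def)
  moreover have "(\<lambda>x. indicator {x. norm (g x) < f x} x :: ennreal) \<in> borel_measurable M"
    by measurable
  ultimately show ?thesis by simp
qed

lemma ball_avg_measurable [measurable (raw)]:
  fixes F :: "'b \<Rightarrow> 'a::euclidean_space \<Rightarrow> ennreal"
  assumes [measurable]: "(\<lambda>(x, y). F x y) \<in> borel_measurable (M \<Otimes>\<^sub>M borel)"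
    and [measurable]: "r \<in> borel_measurable M" "c \<in> borel_measurable M"
  shows "(\<lambda>x. ball_avg (r x) (F x) (c x)) \<in> borel_measurable M"
proof -
  have [measurable]: "(\<lambda>z. F (fst z) (c (fst z) + snd z)) \<in> borel_measurable (M \<Otimes>\<^sub>M borel)"
  proof -
    have "(\<lambda>z. (fst z, c (fst z) + snd z)) \<in> M \<Otimes>\<^sub>M borel \<rightarrow>\<^sub>M M \<Otimes>\<^sub>M borel"
      by measurable
    from measurable_compose[OF this assms(1)] show ?thesis by simp
  qed
  show ?thesis
    unfolding ball_avg_def by measurable
qed

lemma ball_avg_mono: "(\<And>x. F x \<le> G x) \<Longrightarrow> ball_avg r F c \<le> ball_avg r G c"
  unfolding ball_avg_def by (intro mult_left_mono nn_integral_mono mult_right_mono) auto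

lemma ball_avg_cmult:
  fixes F :: "'a::euclidean_space \<Rightarrow> ennreal"
  assumes [measurable]: "F \<in> borel_measurable borel"
  shows "ball_avg r (\<lambda>x. k * F x) c = k * ball_avg r F c"
  unfolding ball_avg_def by (simp add: nn_integral_cmult mult.assoc mult.left_commute)

lemma ball_avg_nn_integral:
  fixes F :: "'b \<Rightarrow> 'a::euclidean_space \<Rightarrow> ennreal"
  assumes [measurable]: "(\<lambda>(x, y). F x y) \<in> borel_measurable (M \<Otimes>\<^sub>M borel)" and M: "sigma_finite_measure M"
  shows "ball_avg r (\<lambda>y. \<integral>\<^sup>+x. F x y \<partial>M) c = (\<integral>\<^sup>+x. ball_avg r (F x) c \<partial>M)"
proof -
  interpret pair_sigma_finite M lborel using M by (simp add: pair_sigma_finite_def lborel.sigma_finite_measure_axioms)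
  have [measurable]: "(\<lambda>z. F (fst z) (c + snd z)) \<in> borel_measurable (M \<Otimes>\<^sub>M borel)"
  proof -
    have "(\<lambda>z. (fst z, c + snd z)) \<in> M \<Otimes>\<^sub>M borel \<rightarrow>\<^sub>M M \<Otimes>\<^sub>M borel"
      by measurable
    from measurable_compose[OF this assms(1)] show ?thesis by simp
  qed
  have [measurable]: "x \<in> space M \<Longrightarrow> F x \<in> borel_measurable borel" for x
    using measurable_compose[OF measurable_Pair1' assms(1)] by simp
  have 1: "(\<lambda>x. F x (c + v)) \<in> borel_measurable M" for v
    using measurable_compose[OF measurable_Pair2'[of v borel M] \<open>(\<lambda>z. F (fst z) (c + snd z)) \<in> borel_measurable (M \<Otimes>\<^sub>M borel)\<close>] by simp
  have "ball_avg r (\<lambda>y. \<integral>\<^sup>+x. F x y \<partial>M) c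
    = ennreal (1 / (unit_ball_vol (real DIM('a)) * r ^ DIM('a))) *
     (\<integral>\<^sup>+v. (\<integral>\<^sup>+x. F x (c + v) * indicator (ball 0 r) v \<partial>M) \<partial>lborel)"
    unfolding ball_avg_def by (simp add: nn_integral_multc 1)
  also have "(\<integral>\<^sup>+v. (\<integral>\<^sup>+x. F x (c + v) * indicator (ball 0 r) v \<partial>M) \<partial>lborel)
     = (\<integral>\<^sup>+x. (\<integral>\<^sup>+v. F x (c + v) * indicator (ball 0 r) v \<partial>lborel) \<partial>M)"
    by (rule Fubini') (simp add: split_beta')
  also have "ennreal (1 / (unit_ball_vol (real DIM('a)) * r ^ DIM('a))) * \<dots> = (\<integral>\<^sup>+x. ball_avg r (F x) c \<partial>M)"
    unfolding ball_avg_def by (subst nn_integral_cmult) (auto simp: split_beta')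
  finally show ?thesis .
qed

lemma ball_avg_translate: "ball_avg r (\<lambda>y. F (a + y)) c = ball_avg r F (a + c)"
  by (simp add: ball_avg_def add.assoc)

lemma ball_avg_const_le:
  assumes "r > 0"
  shows "ball_avg r (\<lambda>_. k) (c :: 'a::euclidean_space) \<le> k"
proof -
  have "ball_avg r (\<lambda>_. k) c = ennreal (1 / (unit_ball_vol (real DIM('a)) * r ^ DIM('a))) * (k * emeasure lborel (ball (0::'a) r))"
    unfolding ball_avg_def by (simp add: nn_integral_cmult)
  also have "\<dots> = k * (ennreal (1 / (unit_ball_vol (real DIM('a)) * r ^ DIM('a))) * ennreal (unit_ball_vol (real DIM('a)) * r ^ DIM('a)))"
    using assms by (simp add: emeasure_ball mult_ac)
  also have "\<dots> = k"
    using assms unit_ball_vol_pos[of "real DIM('a)"]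
    by (subst ennreal_mult[symmetric]) (auto simp: order_less_imp_not_eq2)
  finally show ?thesis by simp
qed

text \<open>Both orders convolve F with the same two kernels, so Tonelli exchanges them. This lets
  the larger of two radii be treated as the inner one.\<close>

lemma ball_avg_commute:
  fixes F :: "'a::euclidean_space \<Rightarrow> ennreal"
  assumes [measurable]: "F \<in> borel_measurable borel"
  shows "ball_avg r (ball_avg t F) c = ball_avg t (ball_avg r F) c"
proof -
  let ?k = "\<lambda>r. ennreal (1 / (unit_ball_vol (real DIM('a)) * r ^ DIM('a)))"
  have "ball_avg r (ball_avg t F) c = ball_avg r (\<lambda>y. ?k t * (\<integral>\<^sup>+v. indicator (ball 0 t) v * F (v + y) \<partial>lborel)) c"
    unfolding ball_avg_def[of t] by (simp add: mult_ac add_ac)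
  also have "\<dots> = ?k t * (\<integral>\<^sup>+v. ball_avg r (\<lambda>y. indicator (ball 0 t) v * F (v + y)) c \<partial>lborel)"
    by (simp add: ball_avg_cmult ball_avg_nn_integral lborel.sigma_finite_measure_axioms)
  also have "\<dots> = ball_avg t (ball_avg r F) c"
    unfolding ball_avg_def[of t]
    by (simp add: ball_avg_cmult ball_avg_translate) (simp add: mult.commute add.commute)
  finally show ?thesis .
qed

text \<open>For t \<le> r and |v| < t the ball B(c + v, r) lies in B(c, 2r), and 2^d is the ratio of
  their volumes. The other order of radii reduces to this one by commutation. In this form the
  larger of two radii absorbs the smaller.\<close>

lemma ball_avg_ball_avg_le:
  fixes F :: "'a::euclidean_space \<Rightarrow> ennreal"
  assumes [measurable]: "F \<in> borel_measurable borel" and r: "r > 0" "t > 0"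
  shows "ball_avg t (ball_avg r F) c \<le> 2 ^ DIM('a) * ball_avg (2 * max r t) F c"
proof -
  let ?k = "\<lambda>r. ennreal (1 / (unit_ball_vol (real DIM('a)) * r ^ DIM('a)))"
  have *: "ball_avg t (ball_avg r F) c \<le> 2 ^ DIM('a) * ball_avg (2 * r) F c" if "0 < t" "t \<le> r" for r t
  proof -
    have "ball_avg r F (c + v) * indicator (ball 0 t) v \<le> 2 ^ DIM('a) * ball_avg (2 * r) F c * indicator (ball 0 t) v" for v
    proof (cases "v \<in> ball 0 t")
      case True
      have "(\<integral>\<^sup>+w. F (c + v + w) * indicator (ball 0 r) w \<partial>lborel)
        = (\<integral>\<^sup>+w. F (c + (v + w)) * indicator (ball 0 r) ((v + w) - v) \<partial>lborel)"
        by (simp add: add.assoc)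
      also have "\<dots> = (\<integral>\<^sup>+w. F (c + w) * indicator (ball 0 r) (w - v) \<partial>lborel)"
        by (rule nn_integral_lborel_translate) measurable
      also have "\<dots> \<le> (\<integral>\<^sup>+w. F (c + w) * indicator (ball 0 (2 * r)) w \<partial>lborel)"
      proof (intro nn_integral_mono mult_left_mono)
        fix w
        show "indicator (ball 0 r) (w - v) \<le> (indicator (ball 0 (2 * r)) w :: ennreal)"
          using True that norm_triangle_sub[of w v] by (auto simp: indicator_def)
      qed auto
      also have "?k r * \<dots> = 2 ^ DIM('a) * ball_avg (2 * r) F c"
      proof -
        have "?k r = ennreal (2 ^ DIM('a) * (1 / (unit_ball_vol (real DIM('a)) * (2 * r) ^ DIM('a))))"
          by (simp add: power_mult_distrib field_simps)
        also have "\<dots> = 2 ^ DIM('a) * ?k (2 * r)"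
          using that by (subst ennreal_mult) (auto simp: ennreal_power[symmetric] )
        finally show ?thesis unfolding ball_avg_def by (simp add: mult.assoc)
      qed
      finally show ?thesis using True
        unfolding ball_avg_def[of r] by (simp add: mult_left_mono)
    qed simp
    then have "ball_avg t (ball_avg r F) c \<le> ball_avg t (\<lambda>_. 2 ^ DIM('a) * ball_avg (2 * r) F c) c"
      unfolding ball_avg_def[of t] by (intro mult_left_mono nn_integral_mono) auto
    also have "\<dots> \<le> 2 ^ DIM('a) * ball_avg (2 * r) F c"
      by (rule ball_avg_const_le) (use that in auto)
    finally show ?thesis .
  qed
  show ?thesis
  proof (cases "t \<le> r")
    case True then show ?thesis using *[of t r] r by (simp add: max_def)
  next
    case False
    then show ?thesis using *[of r t] r ball_avg_commute[of F t r c] by (simp add: max_def)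
  qed
qed

text \<open>A maximum of radii depends on both points at once. In the sum each term depends on one
  point only, which leaves the other variables free for integration.\<close>

lemma ball_avg_max_le:
  "ball_avg (k * max r t) F c \<le> ball_avg (k * r) F c + ball_avg (k * t) F c"
  by (auto simp: max_def add_increasing add_increasing2)

section \<open>Superpositions of ball averages of variable radius\<close>

text \<open>To be applied with the cap measure restricted to the exceptional set as \<mu>, and with
  r x the radius at which the average at x is large. The radius is measurable and positive on the
  whole space, so that no integral has to be restricted to the set.\<close>

locale radius_field = finite_measure \<mu> for \<mu> :: "'a::euclidean_space measure" +
  fixes r :: "'a \<Rightarrow> real"
  assumes sets_mu [measurable_cong]: "sets \<mu> = sets borel"
    and radius_measurable [measurable]: "r \<in> borel_measurable borel"
    and radius_pos: "r x > 0"
begin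

sublocale mu_lborel: pair_sigma_finite \<mu> lborel ..
sublocale mu_mu: pair_sigma_finite \<mu> \<mu> ..

text \<open>For s = -1 this is the convolution of F with \<open>smear_weight\<close>, for s = 1 the
  correlation (see \<open>nn_integral_smear_weight\<close>). The sign is a parameter because two of
  the four points enter \<open>x1 + x2 - x3 - x4\<close> with a plus and two with a minus.\<close>

definition smear :: "real \<Rightarrow> ('a \<Rightarrow> ennreal) \<Rightarrow> 'a \<Rightarrow> ennreal" where
  "smear s F c = (\<integral>\<^sup>+x. ball_avg (r x) F (c + s *\<^sub>R x) \<partial>\<mu>)"

text \<open>What is left of two successive smears after one radius has absorbed the other: two
  points and a single kernel, whose radius can by symmetry be taken at the first point.\<close>

definition smear2 :: "real \<Rightarrow> ('a \<Rightarrow> ennreal) \<Rightarrow> 'a \<Rightarrow> ennreal" where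
  "smear2 s F c = (\<integral>\<^sup>+x. \<integral>\<^sup>+x'. ball_avg (2 * r x) F (c + s *\<^sub>R x + s *\<^sub>R x') \<partial>\<mu> \<partial>\<mu>)"

lemma smear_measurable [measurable]:
  assumes [measurable]: "F \<in> borel_measurable borel"
  shows "smear s F \<in> borel_measurable borel"
  unfolding smear_def by measurable

lemma smear2_measurable [measurable]:
  assumes [measurable]: "F \<in> borel_measurable borel"
  shows "smear2 s F \<in> borel_measurable borel"
  unfolding smear2_def by measurable

lemma smear_mono: "(\<And>x. F x \<le> G x) \<Longrightarrow> smear s F c \<le> smear s G c"
  unfolding smear_def by (intro nn_integral_mono ball_avg_mono)

lemma smear_cmult:
  assumes [measurable]: "F \<in> borel_measurable borel"
  shows "smear s (\<lambda>x. k * F x) = (\<lambda>c. k * smear s F c)"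
  unfolding smear_def by (simp add: ball_avg_cmult nn_integral_cmult)

text \<open>The factor 2^(d+1) is 2^d from merging two averages, times 2 because either point may
  carry the larger radius. Tonelli identifies the second case with the first.\<close>

lemma smear_smear_le:
  assumes [measurable]: "F \<in> borel_measurable borel"
  shows "smear s (smear s F) c \<le> 2 ^ (DIM('a) + 1) * smear2 s F c"
proof -
  have "smear s (smear s F) c = (\<integral>\<^sup>+x. \<integral>\<^sup>+x'. ball_avg (r x) (\<lambda>y. ball_avg (r x') F (s *\<^sub>R x' + y)) (c + s *\<^sub>R x) \<partial>\<mu> \<partial>\<mu>)"
    unfolding smear_def by (simp add: ball_avg_nn_integral sigma_finite_measure_axioms add.commute)
  also have "\<dots> = (\<integral>\<^sup>+x. \<integral>\<^sup>+x'. ball_avg (r x) (ball_avg (r x') F) (c + s *\<^sub>R x + s *\<^sub>R x') \<partial>\<mu> \<partial>\<mu>)"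
    by (subst ball_avg_translate) (simp add: add_ac)
  also have "\<dots> \<le> (\<integral>\<^sup>+x. \<integral>\<^sup>+x'. 2 ^ DIM('a) * (ball_avg (2 * r x) F (c + s *\<^sub>R x + s *\<^sub>R x') +
      ball_avg (2 * r x') F (c + s *\<^sub>R x' + s *\<^sub>R x)) \<partial>\<mu> \<partial>\<mu>)"
  proof (intro nn_integral_mono)
    fix x x'
    have "ball_avg (r x) (ball_avg (r x') F) (c + s *\<^sub>R x + s *\<^sub>R x')
       \<le> 2 ^ DIM('a) * ball_avg (2 * max (r x') (r x)) F (c + s *\<^sub>R x + s *\<^sub>R x')"
      by (rule ball_avg_ball_avg_le) (auto simp: radius_pos)
    also have "\<dots> \<le> 2 ^ DIM('a) * (ball_avg (2 * r x') F (c + s *\<^sub>R x + s *\<^sub>R x') + ball_avg (2 * r x) F (c + s *\<^sub>R x + s *\<^sub>R x'))"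
      by (intro mult_left_mono ball_avg_max_le) auto
    finally show "ball_avg (r x) (ball_avg (r x') F) (c + s *\<^sub>R x + s *\<^sub>R x') \<le>
       2 ^ DIM('a) * (ball_avg (2 * r x) F (c + s *\<^sub>R x + s *\<^sub>R x') +
      ball_avg (2 * r x') F (c + s *\<^sub>R x' + s *\<^sub>R x))"
      by (simp add: add_ac)
  qed
  also have "\<dots> = 2 ^ DIM('a) * (smear2 s F c + (\<integral>\<^sup>+x. \<integral>\<^sup>+x'. ball_avg (2 * r x') F (c + s *\<^sub>R x' + s *\<^sub>R x) \<partial>\<mu> \<partial>\<mu>))"
    unfolding smear2_def by (simp add: nn_integral_cmult nn_integral_add)
  also have "(\<integral>\<^sup>+x. \<integral>\<^sup>+x'. ball_avg (2 * r x') F (c + s *\<^sub>R x' + s *\<^sub>R x) \<partial>\<mu> \<partial>\<mu>) = smear2 s F c"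
    unfolding smear2_def by (rule mu_mu.Fubini') measurable
  finally show ?thesis by (simp add: mult_ac mult_2[symmetric])
qed

text \<open>This is W of the overview, written as a density with respect to Lebesgue
  measure.\<close>

definition smear_weight :: "'a \<Rightarrow> ennreal" where
  "smear_weight y = (\<integral>\<^sup>+x. ennreal (1 / (unit_ball_vol (real DIM('a)) * r x ^ DIM('a))) * indicator (ball 0 (r x)) (y - x) \<partial>\<mu>)"

lemma smear_weight_measurable [measurable]: "smear_weight \<in> borel_measurable borel"
  unfolding smear_weight_def by measurable

text \<open>Tonelli and the substitution y = x + v reduce the claim to a single x. For s = -1 the
  averaged points are c - x - v, and the symmetry of the ball turns -v into v.\<close>

lemma nn_integral_smear_weight:
  assumes [measurable]: "F \<in> borel_measurable borel" and s: "s = 1 \<or> s = -1"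
  shows "(\<integral>\<^sup>+y. smear_weight y * F (c + s *\<^sub>R y) \<partial>lborel) = smear s F c"
proof -
  let ?k = "\<lambda>x. ennreal (1 / (unit_ball_vol (real DIM('a)) * r x ^ DIM('a)))"
  have "(\<integral>\<^sup>+y. smear_weight y * F (c + s *\<^sub>R y) \<partial>lborel)
     = (\<integral>\<^sup>+y. \<integral>\<^sup>+x. ?k x * indicator (ball 0 (r x)) (y - x) * F (c + s *\<^sub>R y) \<partial>\<mu> \<partial>lborel)"
    unfolding smear_weight_def by (simp add: nn_integral_multc)
  also have "\<dots> = (\<integral>\<^sup>+x. \<integral>\<^sup>+y. ?k x * indicator (ball 0 (r x)) (y - x) * F (c + s *\<^sub>R y) \<partial>lborel \<partial>\<mu>)"
    by (rule mu_lborel.Fubini') measurable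
  also have "\<dots> = (\<integral>\<^sup>+x. ball_avg (r x) F (c + s *\<^sub>R x) \<partial>\<mu>)"
  proof (intro nn_integral_cong)
    fix x
    have "(\<integral>\<^sup>+y. ?k x * indicator (ball 0 (r x)) (y - x) * F (c + s *\<^sub>R y) \<partial>lborel)
      = (\<integral>\<^sup>+y. ?k x * indicator (ball 0 (r x)) ((x + y) - x) * F (c + s *\<^sub>R (x + y)) \<partial>lborel)"
      by (rule nn_integral_lborel_translate[symmetric]) measurable
    also have "\<dots> = (\<integral>\<^sup>+y. ?k x * indicator (ball 0 (r x)) y * F (c + s *\<^sub>R (x + y)) \<partial>lborel)"
      by simp
    also have "\<dots> = (\<integral>\<^sup>+y. ?k x * indicator (ball 0 (r x)) y * F (c + s *\<^sub>R x + y) \<partial>lborel)"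
    proof -
      have "(\<integral>\<^sup>+y. ?k x * indicator (ball 0 (r x)) (- y) * F (c - x + (- y)) \<partial>lborel)
        = (\<integral>\<^sup>+y. ?k x * indicator (ball 0 (r x)) y * F (c - x + y) \<partial>lborel)"
        by (rule nn_integral_lborel_reflect) measurable
      moreover have "indicator (ball 0 (r x)) (- y) = (indicator (ball 0 (r x)) y :: ennreal)" for y :: 'a
        by (simp add: indicator_def)
      ultimately show ?thesis using s by (auto simp: algebra_simps)
    qed
    also have "\<dots> = ball_avg (r x) F (c + s *\<^sub>R x)"
      unfolding ball_avg_def by (simp add: nn_integral_cmult[symmetric] mult_ac)
    finally show "(\<integral>\<^sup>+y. ?k x * indicator (ball 0 (r x)) (y - x) * F (c + s *\<^sub>R y) \<partial>lborel) = ball_avg (r x) F (c + s *\<^sub>R x)" .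
  qed
  finally show ?thesis unfolding smear_def .
qed

text \<open>The hypothesis \<open>K\<close> says that the convolution of \<mu> with itself has
  bounded density, in a form that mentions only balls. Moving the integral over w outside leaves the
  mass of a ball of radius \<rho> under this convolution; it is of order \<rho>^d and cancels the
  normalisation of the average. The bound is uniform in \<rho> and c.\<close>

lemma nn_integral_ball_avg_sum_le:
  assumes K: "\<And>w \<rho>. \<rho> > 0 \<Longrightarrow> (\<integral>\<^sup>+x. \<integral>\<^sup>+x'. indicator (ball w \<rho>) (x + x') \<partial>\<mu> \<partial>\<mu>) \<le> ennreal (C * \<rho> ^ DIM('a))"
    and [measurable]: "u \<in> borel_measurable borel" and s: "s = 1 \<or> s = -1" and \<rho>: "\<rho> > 0" and C: "C \<ge> 0"
  shows "(\<integral>\<^sup>+x. \<integral>\<^sup>+x'. ball_avg \<rho> u (c + s *\<^sub>R x + s *\<^sub>R x') \<partial>\<mu> \<partial>\<mu>)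
    \<le> ennreal (C / unit_ball_vol (real DIM('a))) * (\<integral>\<^sup>+w. u w \<partial>lborel)"
proof -
  let ?k = "ennreal (1 / (unit_ball_vol (real DIM('a)) * \<rho> ^ DIM('a)))"
  have 1: "ball_avg \<rho> u (c + s *\<^sub>R x + s *\<^sub>R x') = ?k * (\<integral>\<^sup>+w. u w * indicator (ball (s *\<^sub>R (w - c)) \<rho>) (x + x') \<partial>lborel)" for x x'
  proof -
    let ?a = "c + s *\<^sub>R x + s *\<^sub>R x'"
    have "(\<integral>\<^sup>+v. u (?a + v) * indicator (ball 0 \<rho>) v \<partial>lborel) = (\<integral>\<^sup>+v. u (?a + v) * indicator (ball 0 \<rho>) ((?a + v) - ?a) \<partial>lborel)"
      by simp
    also have "\<dots> = (\<integral>\<^sup>+w. u w * indicator (ball 0 \<rho>) (w - ?a) \<partial>lborel)"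
      by (rule nn_integral_lborel_translate) measurable
    \<comment> \<open>Since s is 1 or -1, closeness of w to c + s(x + x') places x + x' in a ball of
      the same radius around s(w - c).\<close>
    also have "\<dots> = (\<integral>\<^sup>+w. u w * indicator (ball (s *\<^sub>R (w - c)) \<rho>) (x + x') \<partial>lborel)"
    proof (intro nn_integral_cong arg_cong2[where f="(*)"] refl)
      fix w
      have "norm (w - ?a) = dist (s *\<^sub>R (w - c)) (x + x')"
        using s norm_minus_commute[of "w - c" "- (x + x')"]
        by (auto simp: dist_norm algebra_simps)
      then show "(indicator (ball 0 \<rho>) (w - ?a) :: ennreal) = indicator (ball (s *\<^sub>R (w - c)) \<rho>) (x + x')"
        by (simp add: indicator_def)
    qed
    finally show ?thesis unfolding ball_avg_def by simp
  qed
  have eqi: "(indicator (ball (s *\<^sub>R (w - c)) \<rho>) (x + x') :: ennreal) = indicator (ball 0 \<rho>) (s *\<^sub>R (w - c) - (x + x'))" for w x x'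
    by (simp add: indicator_def dist_norm norm_minus_commute)
  have "(\<integral>\<^sup>+x. \<integral>\<^sup>+x'. ball_avg \<rho> u (c + s *\<^sub>R x + s *\<^sub>R x') \<partial>\<mu> \<partial>\<mu>)
    = ?k * (\<integral>\<^sup>+x. \<integral>\<^sup>+x'. \<integral>\<^sup>+w. u w * indicator (ball (s *\<^sub>R (w - c)) \<rho>) (x + x') \<partial>lborel \<partial>\<mu> \<partial>\<mu>)"
    unfolding 1 eqi by (simp add: nn_integral_cmult)
  also have "(\<integral>\<^sup>+x. \<integral>\<^sup>+x'. \<integral>\<^sup>+w. u w * indicator (ball (s *\<^sub>R (w - c)) \<rho>) (x + x') \<partial>lborel \<partial>\<mu> \<partial>\<mu>)
    = (\<integral>\<^sup>+x. \<integral>\<^sup>+w. \<integral>\<^sup>+x'. u w * indicator (ball (s *\<^sub>R (w - c)) \<rho>) (x + x') \<partial>\<mu> \<partial>lborel \<partial>\<mu>)"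
    unfolding eqi by (intro nn_integral_cong mu_lborel.Fubini'[symmetric]) measurable
  also have "\<dots> = (\<integral>\<^sup>+w. \<integral>\<^sup>+x. \<integral>\<^sup>+x'. u w * indicator (ball (s *\<^sub>R (w - c)) \<rho>) (x + x') \<partial>\<mu> \<partial>\<mu> \<partial>lborel)"
    unfolding eqi by (rule mu_lborel.Fubini'[symmetric]) measurable
  also have "\<dots> = (\<integral>\<^sup>+w. u w * (\<integral>\<^sup>+x. \<integral>\<^sup>+x'. indicator (ball (s *\<^sub>R (w - c)) \<rho>) (x + x') \<partial>\<mu> \<partial>\<mu>) \<partial>lborel)"
    unfolding eqi by (simp add: nn_integral_cmult)
  also have "\<dots> \<le> (\<integral>\<^sup>+w. u w * ennreal (C * \<rho> ^ DIM('a)) \<partial>lborel)"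
    using \<rho> by (intro nn_integral_mono mult_left_mono K) auto
  also have "\<dots> = (\<integral>\<^sup>+w. u w \<partial>lborel) * ennreal (C * \<rho> ^ DIM('a))"
    by (simp add: nn_integral_multc)
  also have "?k * \<dots> = (?k * ennreal (C * \<rho> ^ DIM('a))) * (\<integral>\<^sup>+w. u w \<partial>lborel)"
    by (simp add: mult_ac)
  also have "?k * ennreal (C * \<rho> ^ DIM('a)) = ennreal (C / unit_ball_vol (real DIM('a)))"
    using \<rho> C by (subst ennreal_mult[symmetric]) auto
  finally show ?thesis by (simp add: mult_left_mono)
qed

text \<open>Two kernels remain, with radii at x1 and at x3. The larger absorbs the other. The pair
  of points that does not carry it is integrated by \<open>nn_integral_ball_avg_sum_le\<close>,
  uniformly in the rest, and the pair that does carry it contributes its mass squared.\<close>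

lemma smear2_smear2_le:
  assumes K: "\<And>w \<rho>. \<rho> > 0 \<Longrightarrow> (\<integral>\<^sup>+x. \<integral>\<^sup>+x'. indicator (ball w \<rho>) (x + x') \<partial>\<mu> \<partial>\<mu>) \<le> ennreal (C * \<rho> ^ DIM('a))"
    and C: "C \<ge> 0" and [measurable]: "u \<in> borel_measurable borel"
  shows "smear2 1 (smear2 (-1) u) 0 \<le> 2 ^ (DIM('a) + 1) * ennreal (C / unit_ball_vol (real DIM('a))) *
     emeasure \<mu> (space \<mu>) ^ 2 * (\<integral>\<^sup>+w. u w \<partial>lborel)"
proof -
  let ?B = "ennreal (C / unit_ball_vol (real DIM('a))) * (\<integral>\<^sup>+w. u w \<partial>lborel)"
  let ?m = "emeasure \<mu> (space \<mu>)"
  let ?s = "\<lambda>x1 x2 x3 x4. x1 + x2 - x3 - x4 :: 'a"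
  have mm: "(\<integral>\<^sup>+x. \<integral>\<^sup>+y. ?B \<partial>\<mu> \<partial>\<mu>) = ?m ^ 2 * ?B"
    by (simp add: power2_eq_square mult_ac)
  \<comment> \<open>Moves the outermost variable innermost. Two such rotations carry the pair x1, x2
    past x3, x4.\<close>
  have rotate: "(\<integral>\<^sup>+x. \<integral>\<^sup>+y. \<integral>\<^sup>+z. f x y z \<partial>\<mu> \<partial>\<mu> \<partial>\<mu>) = (\<integral>\<^sup>+y. \<integral>\<^sup>+z. \<integral>\<^sup>+x. f x y z \<partial>\<mu> \<partial>\<mu> \<partial>\<mu>)"
    if [measurable]: "(\<lambda>(x, y, z). f x y z) \<in> borel_measurable (borel \<Otimes>\<^sub>M borel \<Otimes>\<^sub>M borel)"
    for f :: "'a \<Rightarrow> 'a \<Rightarrow> 'a \<Rightarrow> ennreal"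
  proof -
    have [measurable]: "(\<lambda>z. f (a z) (b z) (c z)) \<in> borel_measurable M"
      if [measurable]: "a \<in> borel_measurable M" "b \<in> borel_measurable M" "c \<in> borel_measurable M" for a b c and M :: "'b measure"
    proof -
      have "(\<lambda>z. (a z, b z, c z)) \<in> M \<rightarrow>\<^sub>M borel \<Otimes>\<^sub>M borel \<Otimes>\<^sub>M borel" by measurable
      from measurable_compose[OF this \<open>(\<lambda>(x, y, z). f x y z) \<in> _\<close>] show ?thesis by simp
    qed
    have "(\<integral>\<^sup>+x. \<integral>\<^sup>+y. \<integral>\<^sup>+z. f x y z \<partial>\<mu> \<partial>\<mu> \<partial>\<mu>) = (\<integral>\<^sup>+y. \<integral>\<^sup>+x. \<integral>\<^sup>+z. f x y z \<partial>\<mu> \<partial>\<mu> \<partial>\<mu>)"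
      by (rule mu_mu.Fubini') measurable
    also have "\<dots> = (\<integral>\<^sup>+y. \<integral>\<^sup>+z. \<integral>\<^sup>+x. f x y z \<partial>\<mu> \<partial>\<mu> \<partial>\<mu>)"
      by (intro nn_integral_cong mu_mu.Fubini') measurable
    finally show ?thesis .
  qed
  have "smear2 1 (smear2 (-1) u) 0 = (\<integral>\<^sup>+x1. \<integral>\<^sup>+x2. \<integral>\<^sup>+x3. \<integral>\<^sup>+x4.
     ball_avg (2 * r x1) (\<lambda>y. ball_avg (2 * r x3) u (- x3 - x4 + y)) (x1 + x2) \<partial>\<mu> \<partial>\<mu> \<partial>\<mu> \<partial>\<mu>)"
    unfolding smear2_def by (simp add: ball_avg_nn_integral sigma_finite_measure_axioms algebra_simps)
  also have "\<dots> = (\<integral>\<^sup>+x1. \<integral>\<^sup>+x2. \<integral>\<^sup>+x3. \<integral>\<^sup>+x4. ball_avg (2 * r x1) (ball_avg (2 * r x3) u) (?s x1 x2 x3 x4) \<partial>\<mu> \<partial>\<mu> \<partial>\<mu> \<partial>\<mu>)"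
    by (subst ball_avg_translate) (simp add: algebra_simps)
  also have "\<dots> \<le> (\<integral>\<^sup>+x1. \<integral>\<^sup>+x2. \<integral>\<^sup>+x3. \<integral>\<^sup>+x4. 2 ^ DIM('a) * (ball_avg (4 * r x1) u (?s x1 x2 x3 x4)
       + ball_avg (4 * r x3) u (?s x1 x2 x3 x4)) \<partial>\<mu> \<partial>\<mu> \<partial>\<mu> \<partial>\<mu>)"
  proof (intro nn_integral_mono)
    fix x1 x2 x3 x4 :: 'a
    have "ball_avg (2 * r x1) (ball_avg (2 * r x3) u) (?s x1 x2 x3 x4)
       \<le> 2 ^ DIM('a) * ball_avg (2 * max (2 * r x3) (2 * r x1)) u (?s x1 x2 x3 x4)"
      by (rule ball_avg_ball_avg_le) (auto simp: radius_pos)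
    also have "\<dots> \<le> 2 ^ DIM('a) * (ball_avg (2 * (2 * r x3)) u (?s x1 x2 x3 x4) + ball_avg (2 * (2 * r x1)) u (?s x1 x2 x3 x4))"
      by (intro mult_left_mono ball_avg_max_le) auto
    finally show "ball_avg (2 * r x1) (ball_avg (2 * r x3) u) (?s x1 x2 x3 x4) \<le> 2 ^ DIM('a) *
       (ball_avg (4 * r x1) u (?s x1 x2 x3 x4) + ball_avg (4 * r x3) u (?s x1 x2 x3 x4))"
      by (simp add: add_ac)
  qed
  also have "\<dots> = 2 ^ DIM('a) * ((\<integral>\<^sup>+x1. \<integral>\<^sup>+x2. \<integral>\<^sup>+x3. \<integral>\<^sup>+x4. ball_avg (4 * r x1) u (?s x1 x2 x3 x4) \<partial>\<mu> \<partial>\<mu> \<partial>\<mu> \<partial>\<mu>)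
      + (\<integral>\<^sup>+x1. \<integral>\<^sup>+x2. \<integral>\<^sup>+x3. \<integral>\<^sup>+x4. ball_avg (4 * r x3) u (?s x1 x2 x3 x4) \<partial>\<mu> \<partial>\<mu> \<partial>\<mu> \<partial>\<mu>))"
    by (simp add: nn_integral_cmult nn_integral_add)
  also have "\<dots> \<le> 2 ^ DIM('a) * (?m ^ 2 * ?B + ?m ^ 2 * ?B)"
  proof (intro mult_left_mono add_mono)
    have "(\<integral>\<^sup>+x1. \<integral>\<^sup>+x2. \<integral>\<^sup>+x3. \<integral>\<^sup>+x4. ball_avg (4 * r x1) u (?s x1 x2 x3 x4) \<partial>\<mu> \<partial>\<mu> \<partial>\<mu> \<partial>\<mu>)
      \<le> (\<integral>\<^sup>+x1. \<integral>\<^sup>+x2. ?B \<partial>\<mu> \<partial>\<mu>)"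
    proof (intro nn_integral_mono)
      fix x1 x2
      show "(\<integral>\<^sup>+x3. \<integral>\<^sup>+x4. ball_avg (4 * r x1) u (?s x1 x2 x3 x4) \<partial>\<mu> \<partial>\<mu>) \<le> ?B"
        using nn_integral_ball_avg_sum_le[OF K, of u "-1" "4 * r x1" "x1 + x2"] C radius_pos[of x1] by simp
    qed
    then show "(\<integral>\<^sup>+x1. \<integral>\<^sup>+x2. \<integral>\<^sup>+x3. \<integral>\<^sup>+x4. ball_avg (4 * r x1) u (?s x1 x2 x3 x4) \<partial>\<mu> \<partial>\<mu> \<partial>\<mu> \<partial>\<mu>) \<le> ?m ^ 2 * ?B"
      unfolding mm .
    \<comment> \<open>Here the radius belongs to x3, so x1 and x2 have to become the inner
      variables.\<close>
    have "(\<integral>\<^sup>+x1. \<integral>\<^sup>+x2. \<integral>\<^sup>+x3. \<integral>\<^sup>+x4. ball_avg (4 * r x3) u (?s x1 x2 x3 x4) \<partial>\<mu> \<partial>\<mu> \<partial>\<mu> \<partial>\<mu>)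
      = (\<integral>\<^sup>+x1. \<integral>\<^sup>+x3. \<integral>\<^sup>+x4. \<integral>\<^sup>+x2. ball_avg (4 * r x3) u (?s x1 x2 x3 x4) \<partial>\<mu> \<partial>\<mu> \<partial>\<mu> \<partial>\<mu>)"
      by (intro nn_integral_cong rotate) measurable
    also have "\<dots> = (\<integral>\<^sup>+x3. \<integral>\<^sup>+x4. \<integral>\<^sup>+x1. \<integral>\<^sup>+x2. ball_avg (4 * r x3) u (?s x1 x2 x3 x4) \<partial>\<mu> \<partial>\<mu> \<partial>\<mu> \<partial>\<mu>)"
      by (rule rotate) measurable
    also have "\<dots> \<le> (\<integral>\<^sup>+x1. \<integral>\<^sup>+x2. ?B \<partial>\<mu> \<partial>\<mu>)"
    proof (intro nn_integral_mono)
      fix x3 x4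
      show "(\<integral>\<^sup>+x1. \<integral>\<^sup>+x2. ball_avg (4 * r x3) u (?s x1 x2 x3 x4) \<partial>\<mu> \<partial>\<mu>) \<le> ?B"
        using nn_integral_ball_avg_sum_le[OF K, of u "1" "4 * r x3" "- x3 - x4"] C radius_pos[of x3]
        by (simp add: algebra_simps)
    qed
    finally show "(\<integral>\<^sup>+x1. \<integral>\<^sup>+x2. \<integral>\<^sup>+x3. \<integral>\<^sup>+x4. ball_avg (4 * r x3) u (?s x1 x2 x3 x4) \<partial>\<mu> \<partial>\<mu> \<partial>\<mu> \<partial>\<mu>) \<le> ?m ^ 2 * ?B"
      unfolding mm .
  qed auto
  finally show ?thesis by (simp add: mult_ac mult_2[symmetric])
qed

text \<open>Four kernels are merged into one by three absorptions, each costing 2^(d+1). When u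
  approaches a point mass at 0, the left side becomes the squared L^2 norm of W * W.\<close>

lemma quadrilinear_smear_weight_le:
  assumes K: "\<And>w \<rho>. \<rho> > 0 \<Longrightarrow> (\<integral>\<^sup>+x. \<integral>\<^sup>+x'. indicator (ball w \<rho>) (x + x') \<partial>\<mu> \<partial>\<mu>) \<le> ennreal (C * \<rho> ^ DIM('a))"
    and C: "C \<ge> 0" and [measurable]: "u \<in> borel_measurable borel"
  shows "(\<integral>\<^sup>+y1. smear_weight y1 * (\<integral>\<^sup>+y2. smear_weight y2 * (\<integral>\<^sup>+y3. smear_weight y3 *
       (\<integral>\<^sup>+y4. smear_weight y4 * u (y1 + y2 - y3 - y4) \<partial>lborel) \<partial>lborel) \<partial>lborel) \<partial>lborel)
    \<le> 2 ^ (3 * (DIM('a) + 1)) * ennreal (C / unit_ball_vol (real DIM('a))) *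
     emeasure \<mu> (space \<mu>) ^ 2 * (\<integral>\<^sup>+w. u w \<partial>lborel)"
proof -
  have m: "(\<integral>\<^sup>+y. smear_weight y * F (c - y) \<partial>lborel) = smear (-1) F c"
    and p: "(\<integral>\<^sup>+y. smear_weight y * F (c + y) \<partial>lborel) = smear 1 F c"
    and p0: "(\<integral>\<^sup>+y. smear_weight y * F y \<partial>lborel) = smear 1 F 0"
    if [measurable]: "F \<in> borel_measurable borel" for F c
    using nn_integral_smear_weight[of F 1 c] nn_integral_smear_weight[of F "-1" c]
      nn_integral_smear_weight[of F 1 0] by simp_all
  have "(\<integral>\<^sup>+y1. smear_weight y1 * (\<integral>\<^sup>+y2. smear_weight y2 * (\<integral>\<^sup>+y3. smear_weight y3 *
       (\<integral>\<^sup>+y4. smear_weight y4 * u (y1 + y2 - y3 - y4) \<partial>lborel) \<partial>lborel) \<partial>lborel) \<partial>lborel)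
     = smear 1 (smear 1 (smear (-1) (smear (-1) u))) 0"
    by (simp add: m p p0)
  also have "\<dots> \<le> smear 1 (smear 1 (\<lambda>c. 2 ^ (DIM('a) + 1) * smear2 (-1) u c)) 0"
    by (intro smear_mono smear_smear_le) measurable
  also have "\<dots> = 2 ^ (DIM('a) + 1) * smear 1 (smear 1 (smear2 (-1) u)) 0"
    by (simp add: smear_cmult del: power_Suc)
  also have "\<dots> \<le> 2 ^ (DIM('a) + 1) * (2 ^ (DIM('a) + 1) * smear2 1 (smear2 (-1) u) 0)"
    by (intro mult_left_mono smear_smear_le) auto
  also have "\<dots> \<le> 2 ^ (DIM('a) + 1) * (2 ^ (DIM('a) + 1) * (2 ^ (DIM('a) + 1) * ennreal (C / unit_ball_vol (real DIM('a))) *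
     emeasure \<mu> (space \<mu>) ^ 2 * (\<integral>\<^sup>+w. u w \<partial>lborel)))"
    by (intro mult_left_mono smear2_smear2_le K C) auto
  also have "\<dots> = (2 ^ (DIM('a) + 1) * 2 ^ (DIM('a) + 1) * 2 ^ (DIM('a) + 1)) * ennreal (C / unit_ball_vol (real DIM('a))) *
     emeasure \<mu> (space \<mu>) ^ 2 * (\<integral>\<^sup>+w. u w \<partial>lborel)"
    by (simp add: mult_ac)
  also have "2 ^ (DIM('a) + 1) * 2 ^ (DIM('a) + 1) * 2 ^ (DIM('a) + 1) = (2 ^ (3 * (DIM('a) + 1)) :: ennreal)"
    by (simp only: power_add[symmetric]) (rule arg_cong[where f="(^) 2"], simp)
  finally show ?thesis .
qed

end

section \<open>Fourth powers of Fourier transforms\<close>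

lemma cis_measurable [measurable (raw)]:
  "f \<in> borel_measurable M \<Longrightarrow> (\<lambda>x. cis (f x)) \<in> borel_measurable M"
  by (rule borel_measurable_continuous_on[of cis]) (auto intro: continuous_on_cis)

lemma borel_measurable_fst_snd [measurable (raw)]:
  fixes f :: "'c \<Rightarrow> 'a::second_countable_topology \<times> 'b::second_countable_topology"
  assumes "f \<in> borel_measurable M"
  shows "(\<lambda>x. fst (f x)) \<in> borel_measurable M" "(\<lambda>x. snd (f x)) \<in> borel_measurable M"
  using assms by (auto intro!: borel_measurable_continuous_on[of _ f M] continuous_intros)

lemma nn_integral_lborel_pair:
  fixes f :: "'a::euclidean_space \<times> 'b::euclidean_space \<Rightarrow> ennreal"
  assumes "f \<in> borel_measurable borel"
  shows "(\<integral>\<^sup>+z. f z \<partial>lborel) = (\<integral>\<^sup>+x. \<integral>\<^sup>+y. f (x, y) \<partial>lborel \<partial>lborel)"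
  using lborel.nn_integral_fst[of f "lborel :: 'a measure"] assms by (simp add: lborel_prod)

section \<open>Gaussians and their Fourier transforms\<close>

lemma
  fixes f :: "'a::euclidean_space \<Rightarrow> real \<Rightarrow> complex"
  assumes f: "\<And>b. b \<in> Basis \<Longrightarrow> integrable lborel (f b)"
  shows integrable_lborel_prod_Basis: "integrable lborel (\<lambda>x::'a. \<Prod>b\<in>Basis. f b (x \<bullet> b))"
    and integral_lborel_prod_Basis: "(LINT x|lborel. (\<Prod>b\<in>Basis. f b (x \<bullet> b))) = (\<Prod>b\<in>Basis. LINT t|lborel. f b t)"
proof -
  interpret product_sigma_finite "\<lambda>_::'a. lborel :: real measure" by standard
  have [measurable]: "b \<in> Basis \<Longrightarrow> f b \<in> borel_measurable borel" for b
    using f[of b] by (simp add: borel_measurable_integrable)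
  have eq: "(\<Prod>b\<in>Basis. f b ((\<Sum>c\<in>Basis. x c *\<^sub>R c) \<bullet> b)) = (\<Prod>b\<in>Basis. f b (x b))" for x :: "'a \<Rightarrow> real"
    by (intro prod.cong refl) (simp add: inner_sum_left_Basis)
  have m: "(\<lambda>f. \<Sum>b\<in>Basis. f b *\<^sub>R b :: 'a) \<in> (\<Pi>\<^sub>M b\<in>Basis. lborel) \<rightarrow>\<^sub>M borel"
    by measurable
  show "integrable lborel (\<lambda>x::'a. \<Prod>b\<in>Basis. f b (x \<bullet> b))"
    apply (subst lborel_eq)
    apply (subst integrable_distr_eq[OF m])
     apply measurable
    unfolding eq by (intro product_integrable_prod f) auto
  show "(LINT x|lborel. (\<Prod>b\<in>Basis. f b (x \<bullet> b))) = (\<Prod>b\<in>Basis. LINT t|lborel. f b t)"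
    apply (subst lborel_eq)
    apply (subst integral_distr[OF m])
     apply measurable
    unfolding eq by (intro product_integral_prod f) auto
qed

text \<open>Up to the factor sqrt(2 pi), the integrand is a rescaled standard normal density times a
  character, so the value comes from the characteristic function of the normal distribution.\<close>

lemma
  fixes a e :: real
  assumes e: "e > 0"
  shows integrable_gaussian_cis: "integrable lborel (\<lambda>t. exp (- ((e * t)\<^sup>2) / 2) * cis (- (2 * pi * (t * a))))"
    and integral_gaussian_cis: "(LINT t|lborel. exp (- ((e * t)\<^sup>2) / 2) * cis (- (2 * pi * (t * a)))) =
      complex_of_real (sqrt (2 * pi) / e * exp (- ((2 * pi * a / e)\<^sup>2) / 2))"
proof -
  have base: "integrable lborel (\<lambda>t. std_normal_density t *\<^sub>R iexp (\<tau> * t))"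
    "(LINT t|lborel. std_normal_density t *\<^sub>R iexp (\<tau> * t)) = exp (- (\<tau>\<^sup>2) / 2)" for \<tau> :: real
  proof -
    show "integrable lborel (\<lambda>t. std_normal_density t *\<^sub>R iexp (\<tau> * t))"
      by (rule Bochner_Integration.integrable_bound[where f=std_normal_density]) auto
    have "char std_normal_distribution \<tau> = (LINT t|lborel. std_normal_density t *\<^sub>R iexp (\<tau> * t))"
      unfolding char_def by (subst integral_density) auto
    then show "(LINT t|lborel. std_normal_density t *\<^sub>R iexp (\<tau> * t)) = exp (- (\<tau>\<^sup>2) / 2)"
      by (simp add: char_std_normal_distribution)
  qed
  \<comment> \<open>After t is replaced by e * t the frequency 2 pi a becomes 2 pi a / e. The
    \<open>0 +\<close> below fits the affine form of the change of variables.\<close>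
  let ?\<tau> = "- (2 * pi * a / e)"
  have eq: "exp (- ((e * t)\<^sup>2) / 2) * cis (- (2 * pi * (t * a))) =
     complex_of_real (sqrt (2 * pi)) * (std_normal_density (0 + e * t) *\<^sub>R iexp (?\<tau> * (0 + e * t)))" for t
    using e by (simp add: std_normal_density_def cis_conv_exp scaleR_conv_of_real mult_ac)
  show "integrable lborel (\<lambda>t. exp (- ((e * t)\<^sup>2) / 2) * cis (- (2 * pi * (t * a))))"
    unfolding eq using e by (intro integrable_mult_right lborel_integrable_real_affine base) auto
  have "(LINT t|lborel. std_normal_density t *\<^sub>R iexp (?\<tau> * t)) =
     \<bar>e\<bar> *\<^sub>R (LINT t|lborel. std_normal_density (0 + e * t) *\<^sub>R iexp (?\<tau> * (0 + e * t)))"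
    by (rule lborel_integral_real_affine) (use e in auto)
  then have "(LINT t|lborel. std_normal_density (0 + e * t) *\<^sub>R iexp (?\<tau> * (0 + e * t))) = exp (- (?\<tau>\<^sup>2) / 2) / e"
    unfolding base using e by (simp add: scaleR_conv_of_real field_simps)
  then show "(LINT t|lborel. exp (- ((e * t)\<^sup>2) / 2) * cis (- (2 * pi * (t * a)))) =
      complex_of_real (sqrt (2 * pi) / e * exp (- ((2 * pi * a / e)\<^sup>2) / 2))"
    unfolding eq by (subst integral_mult_right_zero) simp
qed

text \<open>The regulariser exp(-e^2 |\<xi>|^2 / 2), tending to 1 as e tends to 0. The product form
  reduces its transform to one dimension.\<close>

definition gauss :: "real \<Rightarrow> 'a::euclidean_space \<Rightarrow> real" where
  "gauss e \<xi> = (\<Prod>b\<in>Basis. exp (- ((e * (\<xi> \<bullet> b))\<^sup>2) / 2))"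

text \<open>The Fourier transform of \<open>gauss e\<close>: a normal density centred at 0 with
  standard deviation e / (2 pi) in each coordinate.\<close>

definition gauss_hat :: "real \<Rightarrow> 'a::euclidean_space \<Rightarrow> real" where
  "gauss_hat e y = (\<Prod>b\<in>Basis. sqrt (2 * pi) / e * exp (- ((2 * pi * (y \<bullet> b) / e)\<^sup>2) / 2))"

lemma gauss_measurable [measurable]: "gauss e \<in> borel_measurable borel"
  unfolding gauss_def by measurable

lemma gauss_hat_measurable [measurable]: "gauss_hat e \<in> borel_measurable borel"
  unfolding gauss_hat_def by measurable

lemma gauss_nonneg: "0 \<le> gauss e \<xi>"
  unfolding gauss_def by (intro prod_nonneg) auto

lemma gauss_hat_nonneg: "e > 0 \<Longrightarrow> 0 \<le> gauss_hat e \<xi>"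
  unfolding gauss_hat_def by (intro prod_nonneg) auto

lemma cis_sum: "finite A \<Longrightarrow> cis (\<Sum>x\<in>A. f x) = (\<Prod>x\<in>A. cis (f x))"
  by (induction A rule: finite_induct) (auto simp: cis_mult[symmetric])

lemma gauss_cis:
  fixes y :: "'a::euclidean_space"
  assumes e: "e > 0"
  shows "integrable lborel (\<lambda>\<xi>. gauss e \<xi> * cis (- (2 * pi * (\<xi> \<bullet> y))))"
    and "(LINT \<xi>|lborel. gauss e \<xi> * cis (- (2 * pi * (\<xi> \<bullet> y)))) = gauss_hat e y"
proof -
  have eq: "gauss e \<xi> * cis (- (2 * pi * (\<xi> \<bullet> y))) =
     (\<Prod>b\<in>Basis. exp (- ((e * (\<xi> \<bullet> b))\<^sup>2) / 2) * cis (- (2 * pi * ((\<xi> \<bullet> b) * (y \<bullet> b)))))" for \<xi> :: 'a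
  proof -
    have "- (2 * pi * (\<xi> \<bullet> y)) = (\<Sum>b\<in>Basis. - (2 * pi * ((\<xi> \<bullet> b) * (y \<bullet> b))))"
      by (subst euclidean_inner) (simp add: sum_negf sum_distrib_left)
    then show ?thesis unfolding gauss_def
      by (simp add: cis_sum prod.distrib)
  qed
  show "integrable lborel (\<lambda>\<xi>. gauss e \<xi> * cis (- (2 * pi * (\<xi> \<bullet> y))))"
    unfolding eq by (intro integrable_lborel_prod_Basis[where f="\<lambda>b t. exp (- ((e * t)\<^sup>2) / 2) * cis (- (2 * pi * (t * (y \<bullet> b))))"]
       integrable_gaussian_cis e)
  show "(LINT \<xi>|lborel. gauss e \<xi> * cis (- (2 * pi * (\<xi> \<bullet> y)))) = gauss_hat e y"
    unfolding eq gauss_hat_def of_real_prod integral_gaussian_cis[OF e, symmetric]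
    by (rule integral_lborel_prod_Basis[where f="\<lambda>b t. exp (- ((e * t)\<^sup>2) / 2) * cis (- (2 * pi * (t * (y \<bullet> b))))"])
       (rule integrable_gaussian_cis[OF e])
qed

lemma integrable_gauss: "e > 0 \<Longrightarrow> integrable lborel (gauss e :: 'a::euclidean_space \<Rightarrow> real)"
proof -
  assume e: "e > 0"
  have "integrable lborel (\<lambda>\<xi>::'a. complex_of_real (gauss e \<xi>))"
    using gauss_cis(1)[OF e, of 0] by simp
  then show ?thesis by (rule iffD1[OF complex_of_real_integrable_eq])
qed

text \<open>Each factor is again a Gaussian, so the one-dimensional formula applies at frequency 0
  with parameter 2 pi / e.\<close>

lemma nn_integral_gauss_hat:
  assumes e: "e > 0"
  shows "(\<integral>\<^sup>+y. gauss_hat e (y::'a::euclidean_space) \<partial>lborel) = 1"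
proof -
  let ?f = "\<lambda>(b::'a) t. complex_of_real (sqrt (2 * pi) / e * exp (- ((2 * pi * t / e)\<^sup>2) / 2))"
  have eq: "?f b t = complex_of_real (sqrt (2 * pi) / e) * (exp (- ((2 * pi / e * t)\<^sup>2) / 2) * cis (- (2 * pi * (t * 0))))" for b t
    by simp
  have e': "2 * pi / e > 0" using e by simp
  have i: "integrable lborel (?f b)" for b
    unfolding eq by (intro integrable_mult_right integrable_gaussian_cis e')
  have v: "(LINT t|lborel. ?f b t) = 1" for b
    unfolding eq
    apply (subst integral_mult_right_zero)
    apply (subst integral_gaussian_cis[OF e'])
    using e by (simp only: of_real_mult[symmetric] of_real_eq_1_iff) (simp add: field_simps)
  have h: "complex_of_real (gauss_hat e y) = (\<Prod>b\<in>Basis. ?f b (y \<bullet> b))" for y :: 'a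
    by (simp add: gauss_hat_def)
  have "integrable lborel (\<lambda>y::'a. complex_of_real (gauss_hat e y))"
    unfolding h by (rule integrable_lborel_prod_Basis[of ?f, OF i])
  then have int: "integrable lborel (gauss_hat e :: 'a \<Rightarrow> real)"
    by (rule iffD1[OF complex_of_real_integrable_eq])
  have "(LINT y|lborel. complex_of_real (gauss_hat e (y::'a))) = 1"
    unfolding h by (subst integral_lborel_prod_Basis[of ?f, OF i]) (simp only: v prod.neutral_const)
  then have "(LINT y|lborel. gauss_hat e (y::'a)) = 1"
    by (simp only: integral_complex_of_real of_real_eq_1_iff)
  then show ?thesis
    using int e by (subst nn_integral_eq_integral) (auto simp: gauss_hat_nonneg)
qed

section \<open>Fourth powers as four-fold integrals\<close>

lemma
  fixes f :: "'a::euclidean_space \<Rightarrow> complex" and g :: "'b::euclidean_space \<Rightarrow> complex"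
  assumes f: "integrable lborel f" and g: "integrable lborel g"
  shows integrable_lborel_tensor: "integrable lborel (\<lambda>z. f (fst z) * g (snd z))"
    and integral_lborel_tensor: "(LINT z|lborel. f (fst z) * g (snd z)) = (LINT x|lborel. f x) * (LINT y|lborel. g y)"
proof -
  have [measurable]: "f \<in> borel_measurable borel" "g \<in> borel_measurable borel"
    using f g by (simp_all add: borel_measurable_integrable)
  have *: "integrable (lborel \<Otimes>\<^sub>M lborel) (\<lambda>z. f (fst z) * g (snd z))"
    by (rule lborel_pair.Fubini_integrable) (auto simp: norm_mult f g intro!: integrable_mult_left integrable_norm)
  then show "integrable lborel (\<lambda>z. f (fst z) * g (snd z))" by (simp add: lborel_prod)
  show "(LINT z|lborel. f (fst z) * g (snd z)) = (LINT x|lborel. f x) * (LINT y|lborel. g y)"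
    using lborel_pair.integral_fst'[OF *] by (simp add: lborel_prod)
qed


lemma fourier_L1_lborel:
  fixes \<psi> :: "'a::euclidean_space \<Rightarrow> complex"
  assumes [measurable]: "\<psi> \<in> borel_measurable borel"
  shows "fourier_L1 \<psi> \<xi> = (LINT x|lborel. \<psi> x * cis (- (2 * pi * (x \<bullet> \<xi>))))"
  unfolding fourier_L1_def by (subst integral_completion) auto

lemma integrable_times_cis:
  fixes \<psi> :: "'a::euclidean_space \<Rightarrow> complex"
  assumes "integrable lborel \<psi>" and [measurable]: "\<theta> \<in> borel_measurable borel"
  shows "integrable lborel (\<lambda>x. \<psi> x * cis (\<theta> x))"
proof (rule Bochner_Integration.integrable_bound[OF assms(1)])
  have [measurable]: "\<psi> \<in> borel_measurable borel"
    using assms(1) by (simp add: borel_measurable_integrable)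
  show "(\<lambda>x. \<psi> x * cis (\<theta> x)) \<in> borel_measurable lborel"
    by measurable
qed (simp add: norm_mult)

text \<open>Writing |z|^4 as z z conj(z) conj(z) expands the fourth power into an integral over four
  points; the conjugates reverse the phase at the last two, hence the signs in \<open>Y\<close>.
  Integrating the Gaussian first leaves \<open>gauss_hat e (Y z)\<close>. This takes the place of
  Plancherel for \<psi> * \<psi>.\<close>

lemma gauss_fourth_power_eq:
  fixes \<psi> :: "'a::euclidean_space \<Rightarrow> complex"
    and k :: "'a \<times> 'a \<times> 'a \<times> 'a \<Rightarrow> complex" and Y :: "'a \<times> 'a \<times> 'a \<times> 'a \<Rightarrow> 'a"
  assumes int: "integrable lborel \<psi>" and e: "e > 0"
  defines "k \<equiv> \<lambda>z. \<psi> (fst z) * (\<psi> (fst (snd z)) * (cnj (\<psi> (fst (snd (snd z)))) * cnj (\<psi> (snd (snd (snd z))))))"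
    and "Y \<equiv> \<lambda>z. fst z + fst (snd z) - fst (snd (snd z)) - snd (snd (snd z))"
  shows "integrable lborel k"
    and "integrable lborel (\<lambda>\<xi>. gauss e \<xi> * norm (fourier_L1 \<psi> \<xi>) ^ 4)"
    and "(LINT \<xi>|lborel. gauss e \<xi> * norm (fourier_L1 \<psi> \<xi>) ^ 4) = (LINT z|lborel. k z * gauss_hat e (Y z))"
proof -
  have [measurable]: "\<psi> \<in> borel_measurable borel"
    using int by (simp add: borel_measurable_integrable)
  have cnj: "integrable lborel (\<lambda>x. cnj (\<psi> x))" using int by simp
  show k: "integrable lborel k" unfolding k_def
    by (intro integrable_lborel_tensor[where f=\<psi>] integrable_lborel_tensor[where f="\<lambda>x. cnj (\<psi> x)"] int cnj)
  have [measurable]: "k \<in> borel_measurable borel"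
    using k by (simp add: borel_measurable_integrable)
  have [measurable]: "Y \<in> borel_measurable borel"
    unfolding Y_def by (intro borel_measurable_continuous_onI continuous_intros)
  have pw: "(LINT z|lborel. k z * cis (- (2 * pi * (\<xi> \<bullet> Y z)))) = norm (fourier_L1 \<psi> \<xi>) ^ 4" for \<xi>
  proof -
    let ?p = "\<lambda>x. \<psi> x * cis (- (2 * pi * (x \<bullet> \<xi>)))"
    have i: "integrable lborel ?p"
      by (intro integrable_times_cis int) measurable
    have ci: "integrable lborel (\<lambda>x. cnj (?p x))" using i by (simp only: integrable_cnj)
    have "k z * cis (- (2 * pi * (\<xi> \<bullet> Y z))) = ?p (fst z) * (?p (fst (snd z)) * (cnj (?p (fst (snd (snd z)))) * cnj (?p (snd (snd (snd z))))))" for z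
    proof -
      have "cis (- (2 * pi * (\<xi> \<bullet> Y z))) = cis (- (2 * pi * (fst z \<bullet> \<xi>))) * (cis (- (2 * pi * (fst (snd z) \<bullet> \<xi>)))
        * (cis (2 * pi * (fst (snd (snd z)) \<bullet> \<xi>)) * cis (2 * pi * (snd (snd (snd z)) \<bullet> \<xi>))))"
        unfolding cis_mult Y_def by (rule arg_cong[where f=cis]) (simp add: inner_simps inner_commute algebra_simps)
      then show ?thesis unfolding k_def by (simp add: cis_cnj)
    qed
    then have "(LINT z|lborel. k z * cis (- (2 * pi * (\<xi> \<bullet> Y z)))) =
       integral\<^sup>L lborel ?p * (integral\<^sup>L lborel ?p * (integral\<^sup>L lborel (\<lambda>x. cnj (?p x)) * integral\<^sup>L lborel (\<lambda>x. cnj (?p x))))"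
      apply (simp only:)
      apply (subst integral_lborel_tensor[where f="?p"])
        apply (rule i)
       apply (intro integrable_lborel_tensor[where f="?p"] integrable_lborel_tensor[where f="\<lambda>x. cnj (?p x)"] i ci)
      apply (subst integral_lborel_tensor[where f="?p"])
        apply (rule i)
       apply (intro integrable_lborel_tensor[where f="\<lambda>x. cnj (?p x)"] i ci)
      apply (subst integral_lborel_tensor[where f="\<lambda>x. cnj (?p x)"])
      apply (rule ci refl)+
      done
    also have "integral\<^sup>L lborel (\<lambda>x. cnj (?p x)) = cnj (integral\<^sup>L lborel ?p)"
      by (rule Bochner_Integration.integral_cnj)
    also have "integral\<^sup>L lborel ?p = fourier_L1 \<psi> \<xi>"
      by (simp add: fourier_L1_lborel)
    also have "fourier_L1 \<psi> \<xi> * (fourier_L1 \<psi> \<xi> * (cnj (fourier_L1 \<psi> \<xi>) * cnj (fourier_L1 \<psi> \<xi>)))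
       = (fourier_L1 \<psi> \<xi> * cnj (fourier_L1 \<psi> \<xi>))\<^sup>2"
      by (simp add: power2_eq_square mult_ac)
    also have "\<dots> = norm (fourier_L1 \<psi> \<xi>) ^ 4"
      by (simp add: complex_norm_square[symmetric] flip: of_real_power power_mult)
    finally show ?thesis .
  qed
  let ?F = "\<lambda>w. complex_of_real (gauss e (fst w)) * k (snd w)"
  let ?G = "\<lambda>w. ?F w * cis (- (2 * pi * (fst w \<bullet> Y (snd w))))"
  have g: "integrable lborel (\<lambda>\<xi>::'a. complex_of_real (gauss e \<xi>))"
    using integrable_gauss[OF e, where 'a='a] by (rule iffD2[OF complex_of_real_integrable_eq])
  have "integrable lborel ?G"
    by (intro integrable_times_cis integrable_lborel_tensor[OF g k]) measurable
  then have G: "integrable (lborel \<Otimes>\<^sub>M lborel) ?G" by (simp add: lborel_prod)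
  have 1: "(LINT z|lborel. ?G (\<xi>, z)) = gauss e \<xi> * norm (fourier_L1 \<psi> \<xi>) ^ 4" for \<xi>
    using pw[of \<xi>] by (simp add: mult.assoc)
  have 2: "(LINT \<xi>|lborel. ?G (\<xi>, z)) = k z * gauss_hat e (Y z)" for z
  proof -
    have "?G (\<xi>, z) = k z * (gauss e \<xi> * cis (- (2 * pi * (\<xi> \<bullet> Y z))))" for \<xi>
      by (simp add: mult_ac)
    then have "(LINT \<xi>|lborel. ?G (\<xi>, z)) = (LINT \<xi>|lborel. k z * (gauss e \<xi> * cis (- (2 * pi * (\<xi> \<bullet> Y z)))))"
      by (intro Bochner_Integration.integral_cong refl)
    also have "\<dots> = k z * gauss_hat e (Y z)"
      by (subst integral_mult_right_zero) (simp only: gauss_cis(2)[OF e])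
    finally show ?thesis .
  qed
  have "integrable lborel (\<lambda>\<xi>. complex_of_real (gauss e \<xi> * norm (fourier_L1 \<psi> \<xi>) ^ 4))"
    using lborel_pair.integrable_fst'[OF G] unfolding 1 .
  then show "integrable lborel (\<lambda>\<xi>. gauss e \<xi> * norm (fourier_L1 \<psi> \<xi>) ^ 4)"
    by (simp only: complex_of_real_integrable_eq)
  have "(LINT \<xi>|lborel. complex_of_real (gauss e \<xi> * norm (fourier_L1 \<psi> \<xi>) ^ 4)) = (LINT z|lborel. k z * gauss_hat e (Y z))"
    using lborel_pair.Fubini_integral[of "\<lambda>\<xi> z. ?G (\<xi>, z)"] G unfolding 1 2 by (simp add: split_beta')
  then show "(LINT \<xi>|lborel. gauss e \<xi> * norm (fourier_L1 \<psi> \<xi>) ^ 4) = (LINT z|lborel. k z * gauss_hat e (Y z))"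
    by (simp only: integral_complex_of_real)
qed

lemma fourier_L1_measurable [measurable]:
  fixes \<psi> :: "'a::euclidean_space \<Rightarrow> complex"
  assumes [measurable]: "\<psi> \<in> borel_measurable borel"
  shows "fourier_L1 \<psi> \<in> borel_measurable borel"
proof -
  have "(\<lambda>\<xi>. LINT x|lborel. \<psi> x * cis (- (2 * pi * (x \<bullet> \<xi>)))) \<in> borel_measurable borel"
    by measurable
  then show ?thesis by (simp add: fourier_L1_lborel cong: measurable_cong)
qed

text \<open>The Gaussian weight makes the expansion legitimate; absolute values then enter and
  \<psi> is replaced by its majorant. Since the hypothesis bounds the quadrilinear form for every u
  of integral 1, the estimate is uniform in e, and Fatou removes the weight.\<close>

lemma nn_integral_fourier_fourth_power_le:
  fixes \<psi> :: "'a::euclidean_space \<Rightarrow> complex" and W :: "'a \<Rightarrow> ennreal"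
  assumes int: "integrable lborel \<psi>"
    and [measurable]: "W \<in> borel_measurable borel" and W: "\<And>y. ennreal (norm (\<psi> y)) \<le> W y"
    and B: "\<And>u. u \<in> borel_measurable borel \<Longrightarrow> (\<integral>\<^sup>+w. u w \<partial>lborel) = 1 \<Longrightarrow>
      (\<integral>\<^sup>+y1. W y1 * (\<integral>\<^sup>+y2. W y2 * (\<integral>\<^sup>+y3. W y3 *
       (\<integral>\<^sup>+y4. W y4 * u (y1 + y2 - y3 - y4) \<partial>lborel) \<partial>lborel) \<partial>lborel) \<partial>lborel) \<le> B"
  shows "(\<integral>\<^sup>+\<xi>. ennreal (norm (fourier_L1 \<psi> \<xi>) ^ 4) \<partial>lborel) \<le> B"
proof -
  have [measurable]: "\<psi> \<in> borel_measurable borel"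
    using int by (simp add: borel_measurable_integrable)
  have bound: "(\<integral>\<^sup>+\<xi>. ennreal (gauss e \<xi> * norm (fourier_L1 \<psi> \<xi>) ^ 4) \<partial>lborel) \<le> B" if e: "e > 0" for e
  proof -
    let ?k = "\<lambda>z. \<psi> (fst z) * (\<psi> (fst (snd z)) * (cnj (\<psi> (fst (snd (snd z)))) * cnj (\<psi> (snd (snd (snd z))))))"
    let ?Y = "\<lambda>z. fst z + fst (snd z) - fst (snd (snd z)) - snd (snd (snd z)) :: 'a"
    let ?u = "\<lambda>y. ennreal (gauss_hat e (y :: 'a))"
    note eq = gauss_fourth_power_eq[OF int e]
    have "(\<integral>\<^sup>+\<xi>. ennreal (gauss e \<xi> * norm (fourier_L1 \<psi> \<xi>) ^ 4) \<partial>lborel)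
      = ennreal (LINT \<xi>|lborel. gauss e \<xi> * norm (fourier_L1 \<psi> \<xi>) ^ 4)"
      by (intro nn_integral_eq_integral eq(2)) (auto simp: gauss_nonneg)
    also have "\<dots> = ennreal (norm (complex_of_real (LINT \<xi>|lborel. gauss e \<xi> * norm (fourier_L1 \<psi> \<xi>) ^ 4)))"
      by (simp add: gauss_nonneg)
    also have "\<dots> = ennreal (norm (LINT z|lborel. ?k z * gauss_hat e (?Y z)))"
      by (simp only: eq(3))
    also have "\<dots> \<le> (\<integral>\<^sup>+z. ennreal (norm (?k z * gauss_hat e (?Y z))) \<partial>lborel)"
    proof (cases "integrable lborel (\<lambda>z. ?k z * gauss_hat e (?Y z))")
      case True
      then show ?thesis by (rule integral_norm_bound_ennreal)
    next
      \<comment> \<open>A non-integrable integrand has integral 0 by convention, so the bound is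
        trivial.\<close>
      case False
      then show ?thesis by (simp add: not_integrable_integral_eq)
    qed
    also have "\<dots> \<le> (\<integral>\<^sup>+z. W (fst z) * (W (fst (snd z)) * (W (fst (snd (snd z))) * (W (snd (snd (snd z))) * ?u (?Y z)))) \<partial>lborel)"
    proof (intro nn_integral_mono)
      fix z :: "'a \<times> 'a \<times> 'a \<times> 'a"
      have "ennreal (norm (?k z * gauss_hat e (?Y z))) = ennreal (norm (\<psi> (fst z))) * (ennreal (norm (\<psi> (fst (snd z))))
         * (ennreal (norm (\<psi> (fst (snd (snd z))))) * (ennreal (norm (\<psi> (snd (snd (snd z))))) * ?u (?Y z))))"
        using e by (simp add: norm_mult ennreal_mult'[symmetric] gauss_hat_nonneg mult.assoc)
      also have "\<dots> \<le> W (fst z) * (W (fst (snd z)) * (W (fst (snd (snd z))) * (W (snd (snd (snd z))) * ?u (?Y z))))"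
        by (intro mult_mono W) auto
      finally show "ennreal (norm (?k z * gauss_hat e (?Y z))) \<le> \<dots>" .
    qed
    also have "\<dots> = (\<integral>\<^sup>+y1. (\<integral>\<^sup>+y2. (\<integral>\<^sup>+y3. (\<integral>\<^sup>+y4. W y1 * (W y2 * (W y3 * (W y4 * ?u (y1 + y2 - y3 - y4))))
        \<partial>lborel) \<partial>lborel) \<partial>lborel) \<partial>lborel)"
      by (simp add: nn_integral_lborel_pair)
    also have "\<dots> = (\<integral>\<^sup>+y1. W y1 * (\<integral>\<^sup>+y2. W y2 * (\<integral>\<^sup>+y3. W y3 *
       (\<integral>\<^sup>+y4. W y4 * ?u (y1 + y2 - y3 - y4) \<partial>lborel) \<partial>lborel) \<partial>lborel) \<partial>lborel)"
      by (simp add: nn_integral_cmult)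
    also have "\<dots> \<le> B"
      by (rule B) (auto simp: nn_integral_gauss_hat[OF e])
    finally show ?thesis .
  qed
  have lim: "(\<lambda>n. ennreal (gauss (1 / real (Suc n)) \<xi> * norm (fourier_L1 \<psi> \<xi>) ^ 4)) \<longlonglongrightarrow> ennreal (norm (fourier_L1 \<psi> \<xi>) ^ 4)" for \<xi>
  proof -
    have "(\<lambda>n. gauss (1 / real (Suc n)) \<xi>) \<longlonglongrightarrow> (\<Prod>b\<in>Basis. exp (- ((0 * (\<xi> \<bullet> b))\<^sup>2) / 2))"
      unfolding gauss_def
      by (intro tendsto_intros LIMSEQ_Suc[OF lim_1_over_n]) auto
    then have "(\<lambda>n. gauss (1 / real (Suc n)) \<xi> * norm (fourier_L1 \<psi> \<xi>) ^ 4) \<longlonglongrightarrow> 1 * norm (fourier_L1 \<psi> \<xi>) ^ 4"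
      by (intro tendsto_intros) simp
    then show ?thesis by (intro tendsto_ennrealI) simp
  qed
  have "(\<integral>\<^sup>+\<xi>. ennreal (norm (fourier_L1 \<psi> \<xi>) ^ 4) \<partial>lborel)
     = (\<integral>\<^sup>+\<xi>. liminf (\<lambda>n. ennreal (gauss (1 / real (Suc n)) \<xi> * norm (fourier_L1 \<psi> \<xi>) ^ 4)) \<partial>lborel)"
    by (intro nn_integral_cong lim_imp_Liminf[symmetric] lim) auto
  also have "\<dots> \<le> liminf (\<lambda>n. \<integral>\<^sup>+\<xi>. ennreal (gauss (1 / real (Suc n)) \<xi> * norm (fourier_L1 \<psi> \<xi>) ^ 4) \<partial>lborel)"
    by (rule nn_integral_liminf) measurable
  also have "\<dots> \<le> liminf (\<lambda>n::nat. B)"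
    by (intro Liminf_mono always_eventually allI bound) auto
  also have "\<dots> = B" by (simp add: Liminf_const)
  finally show ?thesis .
qed

section \<open>Convolution of the surface measure of a cap\<close>

text \<open>With \<open>\<nu>\<close> the image of Lebesgue measure \<open>\<lambda>\<close>, Tonelli and translation invariance give
  \<open>\<nu>(A) \<lambda>(B) = \<lambda>(A) \<nu>(B)\<close>; take \<open>B\<close> to be a ball.\<close>
lemma lborel_distr_isometry:
  fixes T :: "'a::euclidean_space \<Rightarrow> 'a"
  assumes lin: "linear T" and nrm: "\<And>x. norm (T x) = norm x"
  shows "distr lborel borel T = lborel"
proof (rule measure_eqI)
  have [measurable]: "T \<in> borel_measurable borel"
    using lin by (intro borel_measurable_continuous_onI linear_continuous_on) (simp add: linear_conv_bounded_linear)
  have "inj T"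
    using lin nrm by (metis linear_injective_0 norm_eq_zero)
  then have surj: "surj T" using lin linear_injective_imp_surjective by blast
  \<comment> \<open>Invariance of the image measure under translations: y has a preimage under T,
    and the translation is carried out there.\<close>
  have tr: "(\<integral>\<^sup>+x. indicator A (T x - y) \<partial>lborel) = emeasure (distr lborel borel T) A" if [measurable]: "A \<in> sets borel" for A y
  proof -
    obtain z where z: "y = T z" using surj by auto
    have "(\<integral>\<^sup>+x. indicator A (T x - y) \<partial>lborel) = (\<integral>\<^sup>+x. (\<lambda>x. indicator A (T x)) (- z + x) \<partial>lborel :: ennreal)"
      using z lin by (simp add: linear_diff[OF lin, symmetric])
    also have "\<dots> = (\<integral>\<^sup>+x. indicator A (T x) \<partial>lborel)"
      by (rule nn_integral_lborel_translate) measurable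
    also have "\<dots> = (\<integral>\<^sup>+x. indicator A x \<partial>distr lborel borel T)"
      by (subst nn_integral_distr) auto
    finally show ?thesis by simp
  qed
  \<comment> \<open>Substituting c - y for y exchanges the roles of the two sets.\<close>
  have fl: "(\<integral>\<^sup>+y. indicator B y * indicator A (c - y) \<partial>lborel) = (\<integral>\<^sup>+y. indicator B (c - y) * indicator A y \<partial>lborel :: ennreal)"
    if [measurable]: "A \<in> sets borel" "B \<in> sets borel" for A B :: "'a set" and c :: 'a
  proof -
    have "(\<integral>\<^sup>+y. indicator B y * indicator A (c - y) \<partial>lborel) = (\<integral>\<^sup>+y. indicator B (- y) * indicator A (c - - y) \<partial>lborel :: ennreal)"
      by (rule nn_integral_lborel_reflect[symmetric]) measurable
    also have "\<dots> = (\<integral>\<^sup>+y. indicator B (- (- c + y)) * indicator A (c - - (- c + y)) \<partial>lborel)"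
      by (rule nn_integral_lborel_translate[symmetric]) measurable
    finally show ?thesis by (simp add: algebra_simps)
  qed
  fix A assume "A \<in> sets (distr lborel borel T)"
  then have [measurable]: "A \<in> sets borel" by simp
  let ?B = "ball (0::'a) 1" and ?\<nu> = "distr lborel borel T"
  have "emeasure ?\<nu> A * emeasure lborel ?B = (\<integral>\<^sup>+y. indicator ?B y * (\<integral>\<^sup>+x. indicator A (T x - y) \<partial>lborel) \<partial>lborel)"
    by (simp add: tr nn_integral_multc mult.commute)
  also have "\<dots> = (\<integral>\<^sup>+y. (\<integral>\<^sup>+x. indicator ?B y * indicator A (T x - y) \<partial>lborel) \<partial>lborel)"
    by (simp add: nn_integral_cmult)
  also have "\<dots> = (\<integral>\<^sup>+x. (\<integral>\<^sup>+y. indicator ?B y * indicator A (T x - y) \<partial>lborel) \<partial>lborel)"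
    by (rule lborel_pair.Fubini') measurable
  also have "\<dots> = (\<integral>\<^sup>+x. (\<integral>\<^sup>+y. indicator ?B (T x - y) * indicator A y \<partial>lborel) \<partial>lborel)"
    by (simp add: fl)
  also have "\<dots> = (\<integral>\<^sup>+y. (\<integral>\<^sup>+x. indicator ?B (T x - y) * indicator A y \<partial>lborel) \<partial>lborel)"
    by (rule lborel_pair.Fubini') measurable
  also have "\<dots> = (\<integral>\<^sup>+y. (\<integral>\<^sup>+x. indicator ?B (T x - y) \<partial>lborel) * indicator A y \<partial>lborel)"
    by (simp add: nn_integral_multc)
  also have "\<dots> = emeasure lborel A * emeasure ?\<nu> ?B"
    by (simp only: tr borel_open open_ball) (subst nn_integral_cmult, auto simp: mult.commute)
  \<comment> \<open>The ball is its own preimage, which fixes the constant of proportionality as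
    1.\<close>
  also have "emeasure ?\<nu> ?B = emeasure lborel ?B"
  proof -
    have "T -` ?B = ?B" using nrm by auto
    then show ?thesis by (simp add: emeasure_distr)
  qed
  finally have "emeasure ?\<nu> A * emeasure lborel ?B = emeasure lborel A * emeasure lborel ?B" .
  moreover have "emeasure lborel ?B \<noteq> 0" "emeasure lborel ?B \<noteq> \<top>"
    using less_imp_neq[OF unit_ball_vol_pos[of "real DIM('a)"]] by (auto simp: emeasure_ball)
  ultimately show "emeasure ?\<nu> A = emeasure lborel A"
    by (metis ennreal_mult_cancel_left mult.commute)
qed simp

text \<open>Householder reflection: T reflects in the hyperplane orthogonal to e - b. It is
  symmetric and exchanges e and b, so T x \<bullet> b = x \<bullet> T b = x \<bullet> e.\<close>

lemma exists_isometry_inner: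
  fixes e b :: "'a::euclidean_space"
  assumes e: "norm e = 1" and b: "norm b = 1"
  obtains T :: "'a \<Rightarrow> 'a" where "linear T" "\<And>x. norm (T x) = norm x" "\<And>x. T x \<bullet> b = x \<bullet> e"
proof (cases "e = b")
  case True
  then show ?thesis by (intro that[of "\<lambda>x. x"]) (auto intro: linear_ident)
next
  case False
  define w where "w = e - b"
  define T where "T x = x - (2 * (x \<bullet> w) / (w \<bullet> w)) *\<^sub>R w" for x
  have ww: "w \<bullet> w > 0" using False by (simp add: w_def)
  have ee: "e \<bullet> e = 1" and bb: "b \<bullet> b = 1"
    using e b by (simp_all add: norm_eq_sqrt_inner)
  have ww2: "w \<bullet> w = 2 - 2 * (e \<bullet> b)"
    using ee bb by (simp add: w_def inner_simps inner_commute)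
  have wb: "w \<bullet> b = - (w \<bullet> w) / 2"
    unfolding ww2 using ee bb by (simp add: w_def inner_simps)
  have "linear T"
    unfolding T_def by (intro linearI) (auto simp: inner_simps algebra_simps add_divide_distrib)
  moreover have "norm (T x) = norm x" for x
  proof -
    have "T x \<bullet> T x = x \<bullet> x"
      unfolding T_def using ww by (simp add: inner_simps field_simps power2_eq_square inner_commute)
    then show ?thesis by (simp add: norm_eq_sqrt_inner)
  qed
  moreover have "T x \<bullet> b = x \<bullet> e" for x
  proof -
    have "T x \<bullet> b = x \<bullet> b - (2 * (x \<bullet> w) / (w \<bullet> w)) * (w \<bullet> b)"
      unfolding T_def by (simp add: inner_simps)
    also have "\<dots> = x \<bullet> b + x \<bullet> w" unfolding wb using ww by (simp add: field_simps)
    finally show ?thesis by (simp add: w_def inner_simps)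
  qed
  ultimately show ?thesis by (rule that)
qed

text \<open>The area of a disc is linear in its squared radius, so the area of an annulus depends on
  the increment \<delta> of the squared radius and not on q. Negative q has to be allowed, since q
  will be a difference; the annulus is then a disc or empty.\<close>

lemma nn_integral_annulus_le:
  assumes \<delta>: "\<delta> \<ge> 0"
  shows "(\<integral>\<^sup>+y. \<integral>\<^sup>+x. indicator {q..q+\<delta>} (x\<^sup>2 + y\<^sup>2) \<partial>lborel \<partial>lborel) \<le> ennreal (pi * \<delta>)"
proof -
  have cb: "emeasure lborel (cball (0::real\<times>real) s) = ennreal (pi * s\<^sup>2)"
    and ob: "emeasure lborel (ball (0::real\<times>real) s) = ennreal (pi * s\<^sup>2)" if "s \<ge> 0" for s
    using emeasure_cball[OF that, of "0::real\<times>real"] emeasure_ball[OF that, of "0::real\<times>real"]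
    by (simp_all add: unit_ball_vol_2 power2_eq_square)
  let ?A = "{z::real\<times>real. q \<le> (norm z)\<^sup>2 \<and> (norm z)\<^sup>2 \<le> q + \<delta>}"
  have nz: "(norm z)\<^sup>2 = (snd z)\<^sup>2 + (fst z)\<^sup>2" for z :: "real \<times> real"
    by (cases z) (simp add: norm_Pair)
  have [measurable]: "?A \<in> sets borel" by measurable
  have "(\<integral>\<^sup>+y. \<integral>\<^sup>+x. indicator {q..q+\<delta>} (x\<^sup>2 + y\<^sup>2) \<partial>lborel \<partial>lborel) = (\<integral>\<^sup>+z. indicator ?A z \<partial>lborel)"
    by (subst nn_integral_lborel_pair) (auto intro!: nn_integral_cong simp: nz indicator_def)
  also have "\<dots> = emeasure lborel ?A" by simp
  also have "\<dots> \<le> ennreal (pi * \<delta>)"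
  proof (cases "q + \<delta> < 0")
    case True
    have "z \<notin> ?A" for z
    proof
      assume "z \<in> ?A"
      then have "(norm z)\<^sup>2 \<le> q + \<delta>" by simp
      also note True
      finally show False by simp
    qed
    then have A: "?A = {}" by blast
    show ?thesis unfolding A by simp
  next
    case False
    show ?thesis
    proof (cases "q < 0")
      case True
      have "?A \<subseteq> cball 0 (sqrt \<delta>)"
        using True False by (auto intro!: real_le_rsqrt)
      then have "emeasure lborel ?A \<le> emeasure lborel (cball (0::real\<times>real) (sqrt \<delta>))"
        by (rule emeasure_mono) simp
      then show ?thesis using \<delta> by (simp add: cb)
    next
      case q: False
      have "?A \<subseteq> cball 0 (sqrt (q + \<delta>)) - ball 0 (sqrt q)"
      proof
        fix z assume z: "z \<in> ?A"
        then have "sqrt q \<le> norm z" "norm z \<le> sqrt (q + \<delta>)"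
          using q by (auto intro: real_le_rsqrt real_le_lsqrt)
        then show "z \<in> cball 0 (sqrt (q + \<delta>)) - ball 0 (sqrt q)" by simp
      qed
      then have "emeasure lborel ?A \<le> emeasure lborel (cball (0::real\<times>real) (sqrt (q + \<delta>)) - ball 0 (sqrt q))"
        by (rule emeasure_mono) simp
      also have "\<dots> = emeasure lborel (cball (0::real\<times>real) (sqrt (q + \<delta>))) - emeasure lborel (ball (0::real\<times>real) (sqrt q))"
      proof (intro emeasure_Diff)
        have sq: "sqrt q \<le> sqrt (q + \<delta>)" using \<delta> by simp
        show "ball (0::real\<times>real) (sqrt q) \<subseteq> cball 0 (sqrt (q + \<delta>))"
          using sq unfolding subset_iff mem_ball mem_cball by (intro allI impI) linarith
      qed (use q in \<open>auto simp: ob\<close>)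
      also have "\<dots> = ennreal (pi * (q + \<delta>)) - ennreal (pi * q)"
        using q \<delta> by (simp add: cb ob)
      also have "\<dots> = ennreal (pi * \<delta>)"
        using q by (subst ennreal_minus) (auto simp: algebra_simps)
      finally show ?thesis .
    qed
  qed
  finally show ?thesis .
qed

text \<open>Because d \<ge> 3 there are two coordinates besides b0. With all others frozen, the
  shell condition confines these two to a planar annulus of area at most pi * \<delta>. The slab
  leaves a length 2a for the coordinate b0 and the unit ball a length 2 for each remaining
  one.\<close>

lemma emeasure_slab_annulus_Basis_le:
  fixes b0 :: "'a::euclidean_space"
  assumes d: "DIM('a) \<ge> 3" and b0: "b0 \<in> Basis" and a: "a \<ge> 0" and \<delta>: "\<delta> \<ge> 0"
  shows "emeasure lborel {y::'a. \<bar>y \<bullet> b0 - t\<bar> \<le> a \<and> q \<le> (norm y)\<^sup>2 \<and> (norm y)\<^sup>2 \<le> q + \<delta> \<and> norm y \<le> 1}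
    \<le> ennreal (2 ^ DIM('a) * pi * a * \<delta>)"
proof -
  interpret product_sigma_finite "\<lambda>_::'a. lborel :: real measure" by standard
  have "card (Basis - {b0}) \<ge> 2" using d b0 by simp
  then have "Basis - {b0} \<noteq> {}" by (metis card.empty not_numeral_le_zero)
  then obtain b1 where b1: "b1 \<in> Basis - {b0}" by blast
  have "card (Basis - {b0} - {b1}) \<ge> 1" using d b0 b1 by simp
  then have "Basis - {b0} - {b1} \<noteq> {}" by (metis card.empty not_one_le_zero)
  then obtain b2 where b2: "b2 \<in> Basis - {b0} - {b1}" by blast
  have b12: "b1 \<in> Basis - {b0}" "b2 \<in> Basis - {b0}" "b1 \<noteq> b2" using b1 b2 by auto
  define I where "I = Basis - {b1, b2}"
  have I: "finite I" "b2 \<notin> I" "b1 \<notin> insert b2 I" "Basis = insert b1 (insert b2 I)" "b0 \<in> I"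
    using b12 b0 by (auto simp: I_def)
  define S where "S = {y::'a. \<bar>y \<bullet> b0 - t\<bar> \<le> a \<and> q \<le> (norm y)\<^sup>2 \<and> (norm y)\<^sup>2 \<le> q + \<delta> \<and> norm y \<le> 1}"
  define v where "v f = (\<Sum>b\<in>Basis. f b *\<^sub>R b :: 'a)" for f
  have [measurable]: "S \<in> sets borel" unfolding S_def by measurable
  have vm [measurable]: "v \<in> (\<Pi>\<^sub>M b\<in>Basis. lborel) \<rightarrow>\<^sub>M borel" unfolding v_def by measurable
  have "(\<lambda>x. indicator S (v x) :: ennreal) \<in> borel_measurable (Pi\<^sub>M Basis (\<lambda>_. lborel))" by measurable
  then have fm: "(\<lambda>x. indicator S (v x) :: ennreal) \<in> borel_measurable (Pi\<^sub>M (insert b1 (insert b2 I)) (\<lambda>_. lborel))"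
    by (simp only: I(4)[symmetric])
  have fm': "(\<lambda>x. \<integral>\<^sup>+y. indicator S (v (x(b1 := y))) \<partial>lborel) \<in> borel_measurable (Pi\<^sub>M (insert b2 I) (\<lambda>_. lborel :: real measure))"
  proof -
    have "(\<lambda>z. (fst z)(b1 := snd z)) \<in> (Pi\<^sub>M (insert b2 I) (\<lambda>_. lborel)) \<Otimes>\<^sub>M lborel \<rightarrow>\<^sub>M Pi\<^sub>M (insert b1 (insert b2 I)) (\<lambda>_. lborel :: real measure)"
      by measurable
    from measurable_compose[OF this fm]
    have "(\<lambda>(x, y). indicator S (v (x(b1 := y))) :: ennreal) \<in> borel_measurable ((Pi\<^sub>M (insert b2 I) (\<lambda>_. lborel)) \<Otimes>\<^sub>M (lborel :: real measure))"
      by (simp only: split_beta')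
    then show ?thesis
      by (rule lborel.borel_measurable_nn_integral)
  qed
  define g where "g b = (if b = b0 then {t - a..t + a} else {-1..1::real})" for b :: 'a
  have [measurable]: "g b \<in> sets borel" for b by (simp add: g_def)
  have "emeasure lborel S = (\<integral>\<^sup>+y. indicator S y \<partial>lborel)" by simp
  also have "\<dots> = (\<integral>\<^sup>+f. indicator S (v f) \<partial>Pi\<^sub>M Basis (\<lambda>_. lborel))"
  proof -
    have "lborel = distr (\<Pi>\<^sub>M b\<in>Basis. lborel) borel v"
      unfolding v_def by (rule lborel_eq)
    then show ?thesis using nn_integral_distr[OF vm, of "indicator S"] by simp
  qed
  also have "\<dots> = (\<integral>\<^sup>+x. \<integral>\<^sup>+y1. indicator S (v (x(b1 := y1))) \<partial>lborel \<partial>Pi\<^sub>M (insert b2 I) (\<lambda>_. lborel))"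
    using product_nn_integral_insert[OF _ I(3) fm] I(1) by (simp only: I(4)[symmetric] finite_insert)
  also have "\<dots> = (\<integral>\<^sup>+x. \<integral>\<^sup>+y2. \<integral>\<^sup>+y1. indicator S (v (x(b2 := y2, b1 := y1))) \<partial>lborel \<partial>lborel \<partial>Pi\<^sub>M I (\<lambda>_. lborel))"
    by (rule product_nn_integral_insert[OF I(1,2) fm'])
  also have "\<dots> \<le> (\<integral>\<^sup>+x. (\<Prod>b\<in>I. indicator (g b) (x b)) * ennreal (pi * \<delta>) \<partial>Pi\<^sub>M I (\<lambda>_. lborel))"
  proof (intro nn_integral_mono)
    fix x :: "'a \<Rightarrow> real"
    let ?s = "\<Sum>b\<in>I. (x b)\<^sup>2"
    have pt: "(indicator S (v (x(b2 := y2, b1 := y1))) :: ennreal) \<le> (\<Prod>b\<in>I. indicator (g b) (x b)) * indicator {q - ?s..q - ?s + \<delta>} (y1\<^sup>2 + y2\<^sup>2)" for y1 y2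
    proof (cases "v (x(b2 := y2, b1 := y1)) \<in> S")
      case True
      let ?x = "x(b2 := y2, b1 := y1)"
      have inn: "v ?x \<bullet> b = ?x b" if "b \<in> Basis" for b
        using that unfolding v_def by (rule inner_sum_left_Basis)
      have nn: "(norm (v ?x))\<^sup>2 = y1\<^sup>2 + y2\<^sup>2 + ?s"
      proof -
        have "(norm (v ?x))\<^sup>2 = (\<Sum>b\<in>Basis. (?x b)\<^sup>2)"
          by (subst power2_norm_eq_inner, subst euclidean_inner) (simp add: inn power2_eq_square)
        also have "\<dots> = y1\<^sup>2 + (y2\<^sup>2 + (\<Sum>b\<in>I. (?x b)\<^sup>2))"
        proof -
          have "(\<Sum>b\<in>Basis. (?x b)\<^sup>2) = (\<Sum>b\<in>insert b1 (insert b2 I). (?x b)\<^sup>2)"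
            by (simp only: I(4)[symmetric])
          then show ?thesis using I(1-3) b12 by simp
        qed
        also have "(\<Sum>b\<in>I. (?x b)\<^sup>2) = ?s"
          using I by (intro sum.cong) auto
        finally show ?thesis by (simp only: add.assoc)
      qed
      have "x b \<in> g b" if b: "b \<in> I" for b
      proof -
        have xb: "?x b = x b" "b \<in> Basis" using b I by auto
        have x1: "\<bar>x b\<bar> \<le> 1"
          using Basis_le_norm[of b "v ?x"] inn[of b] xb True by (simp add: S_def)
        have x2: "\<bar>x b0 - t\<bar> \<le> a"
        proof -
          have "v ?x \<bullet> b0 = x b0" using inn[OF b0] b12 by auto
          then show ?thesis using True by (simp add: S_def)
        qed
        show ?thesis
        proof (cases "b = b0")
          case bb: True
          have "t - a \<le> x b" "x b \<le> t + a" using x2 unfolding bb by linarith+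
          then show ?thesis unfolding g_def by (simp add: bb)
        next
          case bb: False
          have "-1 \<le> x b" "x b \<le> 1" using x1 by linarith+
          then show ?thesis unfolding g_def by (simp add: bb)
        qed
      qed
      then have "(\<Prod>b\<in>I. indicator (g b) (x b)) = (1::ennreal)"
        by (intro prod.neutral ballI) (simp only: indicator_simps)
      moreover have "y1\<^sup>2 + y2\<^sup>2 \<in> {q - ?s..q - ?s + \<delta>}"
        using True nn by (auto simp: S_def)
      ultimately show ?thesis using True by simp
    qed simp
    have "(\<integral>\<^sup>+y2. \<integral>\<^sup>+y1. indicator S (v (x(b2 := y2, b1 := y1))) \<partial>lborel \<partial>lborel)
       \<le> (\<integral>\<^sup>+y2. \<integral>\<^sup>+y1. (\<Prod>b\<in>I. indicator (g b) (x b)) * indicator {q - ?s..q - ?s + \<delta>} (y1\<^sup>2 + y2\<^sup>2) \<partial>lborel \<partial>lborel)"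
      by (intro nn_integral_mono) (rule pt)
    also have "\<dots> = (\<Prod>b\<in>I. indicator (g b) (x b)) * (\<integral>\<^sup>+y2. \<integral>\<^sup>+y1. indicator {q - ?s..q - ?s + \<delta>} (y1\<^sup>2 + y2\<^sup>2) \<partial>lborel \<partial>lborel)"
      by (simp add: nn_integral_cmult)
    also have "\<dots> \<le> (\<Prod>b\<in>I. indicator (g b) (x b)) * ennreal (pi * \<delta>)"
      by (intro mult_left_mono nn_integral_annulus_le \<delta>) auto
    finally show "(\<integral>\<^sup>+y2. \<integral>\<^sup>+y1. indicator S (v (x(b2 := y2, b1 := y1))) \<partial>lborel \<partial>lborel) \<le> \<dots>" .
  qed
  also have "\<dots> = (\<integral>\<^sup>+x. (\<Prod>b\<in>I. indicator (g b) (x b)) \<partial>Pi\<^sub>M I (\<lambda>_. lborel)) * ennreal (pi * \<delta>)"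
    by (rule nn_integral_multc) measurable
  also have "(\<integral>\<^sup>+x. (\<Prod>b\<in>I. indicator (g b) (x b)) \<partial>Pi\<^sub>M I (\<lambda>_. lborel)) = (\<Prod>b\<in>I. \<integral>\<^sup>+t. indicator (g b) t \<partial>lborel)"
    using I by (intro product_nn_integral_prod) (auto simp: g_def)
  also have "\<dots> = (\<Prod>b\<in>I. ennreal (if b = b0 then 2 * a else 2))"
    using a by (intro prod.cong refl) (auto simp: g_def)
  also have "\<dots> = ennreal (2 * a) * (\<Prod>b\<in>I - {b0}. ennreal 2)"
    using I by (subst prod.remove[of _ b0]) auto
  also have "\<dots> * ennreal (pi * \<delta>) = ennreal (2 * a * 2 ^ card (I - {b0}) * (pi * \<delta>))"
    using a \<delta> by (simp add: ennreal_mult ennreal_power[symmetric])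
  also have "\<dots> \<le> ennreal (2 ^ DIM('a) * pi * a * \<delta>)"
  proof (rule ennreal_leI)
    have "Suc (card (I - {b0})) = card I" using I card_Suc_Diff1[of I b0] by simp
    also have "card I \<le> DIM('a)" unfolding I_def by (intro card_mono) auto
    finally have "(2::real) ^ Suc (card (I - {b0})) \<le> 2 ^ DIM('a)" by (intro power_increasing) auto
    then have "2 ^ Suc (card (I - {b0})) * (pi * a * \<delta>) \<le> 2 ^ DIM('a) * (pi * a * \<delta>)"
      using a \<delta> by (intro mult_right_mono) auto
    then show "2 * a * 2 ^ card (I - {b0}) * (pi * \<delta>) \<le> 2 ^ DIM('a) * pi * a * \<delta>"
      by (simp add: mult_ac)
  qed
  finally show ?thesis unfolding S_def .
qed

text \<open>An isometry taking the direction e to a basis vector preserves both the volume and the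
  norm conditions.\<close>

lemma emeasure_slab_annulus_le:
  fixes e :: "'a::euclidean_space"
  assumes d: "DIM('a) \<ge> 3" and e: "norm e = 1" and a: "a \<ge> 0" and \<delta>: "\<delta> \<ge> 0"
  shows "emeasure lborel {y::'a. \<bar>y \<bullet> e - t\<bar> \<le> a \<and> q \<le> (norm y)\<^sup>2 \<and> (norm y)\<^sup>2 \<le> q + \<delta> \<and> norm y \<le> 1}
    \<le> ennreal (2 ^ DIM('a) * pi * a * \<delta>)"
proof -
  obtain b :: 'a where b: "b \<in> Basis" using nonempty_Basis by blast
  obtain T :: "'a \<Rightarrow> 'a" where T: "linear T" "\<And>x. norm (T x) = norm x" "\<And>x. T x \<bullet> b = x \<bullet> e"
    using exists_isometry_inner[OF e norm_Basis[OF b]] by blast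
  have [measurable]: "T \<in> borel_measurable borel"
    using T(1) by (intro borel_measurable_continuous_onI linear_continuous_on) (simp add: linear_conv_bounded_linear)
  let ?S = "\<lambda>e. {y::'a. \<bar>y \<bullet> e - t\<bar> \<le> a \<and> q \<le> (norm y)\<^sup>2 \<and> (norm y)\<^sup>2 \<le> q + \<delta> \<and> norm y \<le> 1}"
  have "emeasure lborel (?S e) = emeasure lborel (T -` ?S b)"
    by (rule arg_cong[where f="emeasure lborel"]) (auto simp: T)
  also have "\<dots> = emeasure (distr lborel borel T) (?S b)"
    by (subst emeasure_distr) auto
  also have "\<dots> = emeasure lborel (?S b)"
    by (simp only: lborel_distr_isometry[OF T(1,2)])
  also have "\<dots> \<le> ennreal (2 ^ DIM('a) * pi * a * \<delta>)"
    by (rule emeasure_slab_annulus_Basis_le[OF d b a \<delta>])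
  finally show ?thesis .
qed

lemma sgn_measurable [measurable (raw)]:
  fixes f :: "'b \<Rightarrow> 'a::euclidean_space"
  assumes [measurable]: "f \<in> borel_measurable M"
  shows "(\<lambda>x. sgn (f x)) \<in> borel_measurable M"
  unfolding sgn_div_norm by measurable

section \<open>Surface estimates through radial cones\<close>

text \<open>Its volume times d is the surface measure of the part of A on the sphere. Testing the
  direction by \<open>sgn\<close> allows any subset A of the space and gives Borel measurability at
  once.\<close>

definition radial_cone :: "'a::euclidean_space set \<Rightarrow> 'a set" where
  "radial_cone A = {y. y \<noteq> 0 \<and> norm y \<le> 1 \<and> sgn y \<in> A}"

lemma radial_cone_borel [measurable]:
  assumes [measurable]: "A \<in> sets borel"
  shows "radial_cone A \<in> sets borel"
  unfolding radial_cone_def by measurable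

lemma emeasure_radial_cone_le:
  assumes A: "A \<in> sets borel"
  shows "emeasure lborel (radial_cone A :: 'a::euclidean_space set) \<le> ennreal (unit_ball_vol (real DIM('a)))"
proof -
  have "emeasure lborel (radial_cone A) \<le> emeasure lborel (cball (0::'a) 1)"
    by (rule emeasure_mono) (auto simp: radial_cone_def)
  also have "\<dots> = ennreal (unit_ball_vol (real DIM('a)))"
    by (simp add: emeasure_cball)
  finally show ?thesis .
qed

lemma nn_integral_lborel_scale:
  fixes F :: "'a::euclidean_space \<Rightarrow> ennreal"
  assumes [measurable]: "F \<in> borel_measurable borel" and c: "c > 0"
  shows "(\<integral>\<^sup>+y. F y \<partial>lborel) = ennreal (c ^ DIM('a)) * (\<integral>\<^sup>+y. F (c *\<^sub>R y) \<partial>lborel)"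
  using c by (subst lborel_affine[of c 0]) (simp_all add: nn_integral_density nn_integral_distr nn_integral_cmult)

text \<open>Points of norm at most 1 - \<rho> lie in the cone scaled by 1 - \<rho>, which has the
  fraction (1 - \<rho>)^d \<le> 1 - \<rho> of the volume; the rest is in the outer shell. A bound
  for the thin shell thus becomes, on division by \<rho>, a bound for the surface.\<close>

lemma emeasure_radial_cone_shell:
  fixes A :: "'a::euclidean_space set"
  assumes [measurable]: "A \<in> sets borel" and \<rho>: "0 < \<rho>" "\<rho> \<le> 1"
  shows "ennreal \<rho> * emeasure lborel (radial_cone A) \<le> emeasure lborel {y \<in> radial_cone A. 1 - \<rho> < norm y}"
proof -
  let ?m = "emeasure lborel (radial_cone A)"
  let ?in = "{y \<in> radial_cone A. norm y \<le> 1 - \<rho>}" and ?out = "{y \<in> radial_cone A. 1 - \<rho> < norm y}"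
  have fin: "?m < \<top>"
    using emeasure_radial_cone_le[of A] by (auto intro: le_less_trans)
  have inn: "emeasure lborel ?in \<le> ennreal (1 - \<rho>) * ?m"
  \<comment> \<open>Scaling by 1 - \<rho> is invertible only for \<rho> < 1. For \<rho> = 1 the
    inner part is empty, since the cone omits 0.\<close>
  proof (cases "\<rho> = 1")
    case True
    then have "?in = {}" by (auto simp: radial_cone_def)
    then show ?thesis by (simp only: emeasure_empty) simp
  next
    case False
    then have c: "1 - \<rho> > 0" using \<rho> by simp
    have "emeasure lborel ?in = (\<integral>\<^sup>+y. indicator ?in y \<partial>lborel)" by simp
    also have "\<dots> = ennreal ((1 - \<rho>) ^ DIM('a)) * (\<integral>\<^sup>+y. indicator ?in ((1 - \<rho>) *\<^sub>R y) \<partial>lborel)"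
      by (rule nn_integral_lborel_scale[OF _ c]) measurable
    also have "\<dots> \<le> ennreal (1 - \<rho>) * (\<integral>\<^sup>+y. indicator (radial_cone A) y \<partial>lborel)"
    proof (intro mult_mono nn_integral_mono ennreal_leI)
      show "(1 - \<rho>) ^ DIM('a) \<le> 1 - \<rho>"
        using power_decreasing[of 1 "DIM('a)" "1 - \<rho>"] c \<rho> by simp
      fix y :: 'a
      show "indicator ?in ((1 - \<rho>) *\<^sub>R y) \<le> (indicator (radial_cone A) y :: ennreal)"
        using c by (auto simp: indicator_def radial_cone_def sgn_scaleR)
    qed auto
    finally show ?thesis by simp
  qed
  have "?m = emeasure lborel (?in \<union> ?out)"
    by (rule arg_cong[where f="emeasure lborel"]) auto
  also have "\<dots> \<le> emeasure lborel ?in + emeasure lborel ?out"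
    by (rule emeasure_subadditive) measurable
  also have "\<dots> \<le> ennreal (1 - \<rho>) * ?m + emeasure lborel ?out"
    by (intro add_mono inn) auto
  finally have "?m \<le> ennreal (1 - \<rho>) * ?m + emeasure lborel ?out" .
  moreover have "?m = ennreal (1 - \<rho>) * ?m + ennreal \<rho> * ?m"
    using \<rho> by (simp add: distrib_right[symmetric] flip: ennreal_plus)
  ultimately have "ennreal (1 - \<rho>) * ?m + ennreal \<rho> * ?m \<le> ennreal (1 - \<rho>) * ?m + emeasure lborel ?out"
    by simp
  moreover have "ennreal (1 - \<rho>) * ?m < \<top>" using fin by (simp add: ennreal_mult_less_top)
  ultimately show ?thesis
    using ennreal_add_left_cancel_le[of "ennreal (1 - \<rho>) * ?m"] by auto
qed

text \<open>A shell point y is within \<rho> of sgn y and hence within 2\<rho> of z, so the shell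
  fits into a ball of volume of order \<rho>^d. Dividing by \<rho> gives \<rho>^(d-1).\<close>

lemma radial_cone_ball_le:
  fixes z :: "'a::euclidean_space"
  assumes [measurable]: "A \<in> sets borel" and A: "A \<subseteq> ball z \<rho>" and \<rho>: "0 < \<rho>" "\<rho> \<le> 1"
  shows "emeasure lborel (radial_cone A) \<le> ennreal (unit_ball_vol (real DIM('a)) * 2 ^ DIM('a) * \<rho> ^ (DIM('a) - 1))"
proof -
  have "ennreal \<rho> * emeasure lborel (radial_cone A) \<le> emeasure lborel {y \<in> radial_cone A. 1 - \<rho> < norm y}"
    by (rule emeasure_radial_cone_shell) (use \<rho> in auto)
  also have "\<dots> \<le> emeasure lborel (ball z (2 * \<rho>))"
  proof (rule emeasure_mono)
    show "{y \<in> radial_cone A. 1 - \<rho> < norm y} \<subseteq> ball z (2 * \<rho>)"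
    proof
      fix y assume "y \<in> {y \<in> radial_cone A. 1 - \<rho> < norm y}"
      then have y: "y \<noteq> 0" "norm y \<le> 1" "sgn y \<in> ball z \<rho>" "1 - \<rho> < norm y"
        using A by (auto simp: radial_cone_def)
      have "norm (sgn y - y) = 1 - norm y"
      proof -
        have "sgn y - y = (1 - norm y) *\<^sub>R sgn y"
          using y by (simp add: sgn_div_norm algebra_simps)
        then show ?thesis using y by (simp add: norm_sgn)
      qed
      then have "dist z y < \<rho> + \<rho>"
        using y(3,4) dist_triangle[of z y "sgn y"] by (simp add: dist_norm norm_minus_commute)
      then show "y \<in> ball z (2 * \<rho>)" by simp
    qed
  qed simp
  also have "\<dots> = ennreal (unit_ball_vol (real DIM('a)) * (2 * \<rho>) ^ DIM('a))"
    using \<rho> by (simp add: emeasure_ball)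
  also have "(2 * \<rho>) ^ DIM('a) = \<rho> * (2 ^ DIM('a) * \<rho> ^ (DIM('a) - 1))"
    by (simp add: power_mult_distrib power_eq_if[of \<rho> "DIM('a)"])
  also have "ennreal (unit_ball_vol (real DIM('a)) * (\<rho> * (2 ^ DIM('a) * \<rho> ^ (DIM('a) - 1))))
    = ennreal \<rho> * ennreal (unit_ball_vol (real DIM('a)) * 2 ^ DIM('a) * \<rho> ^ (DIM('a) - 1))"
    using \<rho> by (subst ennreal_mult[symmetric]) (auto simp: mult_ac)
  finally show ?thesis
    using \<rho> by (subst (asm) ennreal_mult_le_mult_iff) auto
qed

text \<open>The shell over a slab of half-width \<rho> lies in a slab of half-width 2\<rho>, and its
  squared norms in a range of length 2\<rho>. Its volume is therefore of order \<rho>^2, and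
  division by \<rho> gives the linear bound, uniformly in t. On a circle this would fail where the
  slab is tangent. The summand \<open>unit_ball_vol\<close> covers \<rho> > 1.\<close>

lemma radial_cone_slab_le:
  fixes e :: "'a::euclidean_space"
  assumes d: "DIM('a) \<ge> 3" and e: "norm e = 1" and \<rho>: "0 < \<rho>"
  shows "emeasure lborel (radial_cone {x. \<bar>x \<bullet> e - t\<bar> \<le> \<rho>}) \<le> ennreal ((unit_ball_vol (real DIM('a)) + 2 ^ DIM('a) * pi * 4) * \<rho>)"
proof (cases "\<rho> \<le> 1")
  case False
  have "emeasure lborel (radial_cone {x. \<bar>x \<bullet> e - t\<bar> \<le> \<rho>}) \<le> ennreal (unit_ball_vol (real DIM('a)))"
    by (rule emeasure_radial_cone_le) measurable
  also have "\<dots> \<le> ennreal ((unit_ball_vol (real DIM('a)) + 2 ^ DIM('a) * pi * 4) * \<rho>)"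
  proof (rule ennreal_leI)
    have "unit_ball_vol (real DIM('a)) * 1 \<le> (unit_ball_vol (real DIM('a)) + 2 ^ DIM('a) * pi * 4) * \<rho>"
      using False by (intro mult_mono) auto
    then show "unit_ball_vol (real DIM('a)) \<le> (unit_ball_vol (real DIM('a)) + 2 ^ DIM('a) * pi * 4) * \<rho>" by simp
  qed
  finally show ?thesis .
next
  case True
  let ?A = "{x. \<bar>x \<bullet> e - t\<bar> \<le> \<rho>}"
  have [measurable]: "?A \<in> sets borel" by measurable
  let ?S = "{y::'a. \<bar>y \<bullet> e - t\<bar> \<le> 2 * \<rho> \<and> 1 - 2 * \<rho> \<le> (norm y)\<^sup>2 \<and> (norm y)\<^sup>2 \<le> 1 - 2 * \<rho> + 2 * \<rho> \<and> norm y \<le> 1}"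
  have "ennreal \<rho> * emeasure lborel (radial_cone ?A) \<le> emeasure lborel {y \<in> radial_cone ?A. 1 - \<rho> < norm y}"
    by (rule emeasure_radial_cone_shell) (use \<rho> True in auto)
  also have "\<dots> \<le> emeasure lborel ?S"
  proof (rule emeasure_mono)
    show "{y \<in> radial_cone ?A. 1 - \<rho> < norm y} \<subseteq> ?S"
    proof
      fix y assume "y \<in> {y \<in> radial_cone ?A. 1 - \<rho> < norm y}"
      then have y: "y \<noteq> 0" "norm y \<le> 1" "\<bar>sgn y \<bullet> e - t\<bar> \<le> \<rho>" "1 - \<rho> < norm y"
        by (auto simp: radial_cone_def)
      have "sgn y \<bullet> e - y \<bullet> e = (1 - norm y) * (sgn y \<bullet> e)"
        using y by (simp add: sgn_div_norm algebra_simps inner_simps)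
      moreover have "\<bar>sgn y \<bullet> e\<bar> \<le> 1"
        using Cauchy_Schwarz_ineq2[of "sgn y" e] y e by (simp add: norm_sgn)
      ultimately have "\<bar>sgn y \<bullet> e - y \<bullet> e\<bar> \<le> 1 - norm y"
        using y mult_left_mono[of "\<bar>sgn y \<bullet> e\<bar>" 1 "1 - norm y"] by (simp add: abs_mult)
      then have 1: "\<bar>y \<bullet> e - t\<bar> \<le> 2 * \<rho>" using y by linarith
      have "(1 - \<rho>)\<^sup>2 \<le> (norm y)\<^sup>2" using y True by (intro power_mono) auto
      moreover have "1 - 2 * \<rho> \<le> (1 - \<rho>)\<^sup>2" by (simp add: power2_eq_square algebra_simps)
      ultimately have 2: "1 - 2 * \<rho> \<le> (norm y)\<^sup>2" by linarith
      have 3: "(norm y)\<^sup>2 \<le> 1" using y by (simp add: power_le_one)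
      show "y \<in> ?S" using 1 2 3 y by simp
    qed
  qed measurable
  also have "\<dots> \<le> ennreal (2 ^ DIM('a) * pi * (2 * \<rho>) * (2 * \<rho>))"
    by (rule emeasure_slab_annulus_le[OF d e]) (use \<rho> in auto)
  also have "\<dots> = ennreal \<rho> * ennreal (2 ^ DIM('a) * pi * 4 * \<rho>)"
    using \<rho> by (subst ennreal_mult[symmetric]) (auto simp: mult_ac)
  finally have "emeasure lborel (radial_cone ?A) \<le> ennreal (2 ^ DIM('a) * pi * 4 * \<rho>)"
    using \<rho> by (subst (asm) ennreal_mult_le_mult_iff) auto
  also have "\<dots> \<le> ennreal ((unit_ball_vol (real DIM('a)) + 2 ^ DIM('a) * pi * 4) * \<rho>)"
    using \<rho> by (intro ennreal_leI mult_right_mono) auto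
  finally show ?thesis .
qed

text \<open>Surface measure on the part of the unit sphere inside \<open>\<Omega>\<close>, up to the factor \<open>d\<close>,
  as a Borel measure on the whole space.\<close>
definition cap_measure :: "'a::euclidean_space set \<Rightarrow> 'a measure" where
  "cap_measure \<Omega> = distr (density lborel (indicator (radial_cone \<Omega>))) borel sgn"

lemma sets_cap_measure [simp, measurable_cong]: "sets (cap_measure \<Omega>) = sets borel"
  by (simp add: cap_measure_def)

lemma space_cap_measure [simp]: "space (cap_measure \<Omega>) = UNIV"
  by (simp add: cap_measure_def)

lemma nn_integral_cap_measure:
  fixes F :: "'a::euclidean_space \<Rightarrow> ennreal"
  assumes [measurable]: "\<Omega> \<in> sets borel" "F \<in> borel_measurable borel"
  shows "(\<integral>\<^sup>+x. F x \<partial>cap_measure \<Omega>) = (\<integral>\<^sup>+y. indicator (radial_cone \<Omega>) y * F (sgn y) \<partial>lborel)"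
  unfolding cap_measure_def by (simp add: nn_integral_distr nn_integral_density)

lemma emeasure_cap_measure:
  fixes A :: "'a::euclidean_space set"
  assumes [measurable]: "\<Omega> \<in> sets borel" "A \<in> sets borel"
  shows "emeasure (cap_measure \<Omega>) A = emeasure lborel (radial_cone (\<Omega> \<inter> A))"
proof -
  have "emeasure (cap_measure \<Omega>) A = (\<integral>\<^sup>+x. indicator A x \<partial>cap_measure \<Omega>)" by simp
  also have "\<dots> = (\<integral>\<^sup>+y. indicator (radial_cone \<Omega>) y * indicator A (sgn y) \<partial>lborel)"
    by (rule nn_integral_cap_measure) auto
  also have "\<dots> = (\<integral>\<^sup>+y. indicator (radial_cone (\<Omega> \<inter> A)) y \<partial>lborel)"
    by (intro nn_integral_cong) (auto simp: indicator_def radial_cone_def)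
  finally show ?thesis by simp
qed

lemma finite_cap_measure:
  assumes [measurable]: "\<Omega> \<in> sets borel"
  shows "finite_measure (cap_measure \<Omega>)"
proof
  have "emeasure (cap_measure \<Omega>) (space (cap_measure \<Omega>)) = emeasure lborel (radial_cone \<Omega>)"
    by (simp add: emeasure_cap_measure)
  also have "\<dots> < \<top>"
    using emeasure_radial_cone_le[of \<Omega>] by (auto intro: le_less_trans)
  finally show "emeasure (cap_measure \<Omega>) (space (cap_measure \<Omega>)) \<noteq> \<infinity>" by simp
qed

text \<open>For fixed x the admissible x' lie in a ball of radius \<rho>, which meets the sphere in
  measure of order \<rho>^(d-1). There are any only if w - x is within \<rho> of the sphere.
  Expanding |w - x|^2 makes this a slab condition on x, of width of order \<rho> as long as w stays
  away from 0, which the small diameter of the cap ensures. The two factors give \<rho>^d.\<close>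

lemma cap_convolution_bound:
  fixes z0 :: "'a::euclidean_space"
  assumes d: "DIM('a) \<ge> 3"
  defines "\<mu> \<equiv> cap_measure (ball z0 (1/2))"
  obtains C where "C \<ge> 0" "\<And>w \<rho>. \<rho> > 0 \<Longrightarrow>
    (\<integral>\<^sup>+x. \<integral>\<^sup>+x'. indicator (ball w \<rho>) (x + x') \<partial>\<mu> \<partial>\<mu>) \<le> ennreal (C * \<rho> ^ DIM('a))"
proof -
  define V where "V = unit_ball_vol (real DIM('a))"
  have V: "V \<ge> 0" by (simp add: V_def)
  define C1 where "C1 = V * 2 ^ DIM('a)"
  define C2 where "C2 = (V + 2 ^ DIM('a) * pi * 4) * 3"
  have C: "C1 \<ge> 0" "C2 \<ge> 0" using V by (auto simp: C1_def C2_def)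
  define \<Omega> where "\<Omega> = ball z0 (1/2)"
  have [measurable]: "\<Omega> \<in> sets borel" by (simp add: \<Omega>_def)
  have \<mu>: "\<mu> = cap_measure \<Omega>" by (simp add: \<mu>_def \<Omega>_def)
  interpret finite_measure \<mu> unfolding \<mu> by (rule finite_cap_measure) simp
  have [measurable_cong]: "sets \<mu> = sets borel" by (simp add: \<mu>)
  have inner: "(\<integral>\<^sup>+x'. indicator (ball w \<rho>) (x + x') \<partial>\<mu>) = emeasure lborel (radial_cone (\<Omega> \<inter> ball (w - x) \<rho>))" for w x :: 'a and \<rho>
  proof -
    have "(\<integral>\<^sup>+x'. indicator (ball w \<rho>) (x + x') \<partial>\<mu>) = (\<integral>\<^sup>+x'. indicator (ball (w - x) \<rho>) x' \<partial>\<mu>)"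
      by (intro nn_integral_cong) (auto simp: indicator_def dist_norm algebra_simps)
    also have "\<dots> = emeasure \<mu> (ball (w - x) \<rho>)" by simp
    finally show ?thesis by (simp add: \<mu> emeasure_cap_measure)
  qed
  have eqi: "(indicator (ball w \<rho>) (x + x') :: ennreal) = indicator (ball 0 \<rho>) (x + x' - w)" for w x x' :: 'a and \<rho>
    by (simp add: indicator_def dist_norm norm_minus_commute)
  have total: "emeasure lborel (radial_cone A) \<le> ennreal V" if "A \<in> sets borel" for A :: "'a set"
    using emeasure_radial_cone_le[OF that] by (simp add: V_def)
  have main: "(\<integral>\<^sup>+x. \<integral>\<^sup>+x'. indicator (ball w \<rho>) (x + x') \<partial>\<mu> \<partial>\<mu>) \<le> ennreal ((V * V * 2 ^ DIM('a) + C1 * C2) * \<rho> ^ DIM('a))"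
    if \<rho>: "\<rho> > 0" for w \<rho>
  proof (cases "\<rho> \<ge> 1/2")
    \<comment> \<open>Radii of at least 1/2 are covered by the total mass.\<close>
    case True
    have "(\<integral>\<^sup>+x. \<integral>\<^sup>+x'. indicator (ball w \<rho>) (x + x') \<partial>\<mu> \<partial>\<mu>) \<le> (\<integral>\<^sup>+x. ennreal V \<partial>\<mu>)"
      unfolding inner by (intro nn_integral_mono total) simp
    also have "\<dots> = ennreal V * emeasure lborel (radial_cone \<Omega>)"
      unfolding \<mu> by (simp add: emeasure_cap_measure)
    also have "\<dots> \<le> ennreal V * ennreal V"
      by (intro mult_left_mono total) auto
    also have "\<dots> = ennreal (V * V)" using V by (simp add: ennreal_mult)
    also have "\<dots> \<le> ennreal ((V * V * 2 ^ DIM('a) + C1 * C2) * \<rho> ^ DIM('a))"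
    proof (rule ennreal_leI)
      have "(1/2) ^ DIM('a) \<le> \<rho> ^ DIM('a)" using True by (intro power_mono) auto
      then have "1 \<le> 2 ^ DIM('a) * \<rho> ^ DIM('a)" by (simp add: power_one_over field_simps)
      then have "V * V * 1 \<le> V * V * (2 ^ DIM('a) * \<rho> ^ DIM('a))" using V by (intro mult_left_mono) auto
      moreover have "0 \<le> C1 * C2 * \<rho> ^ DIM('a)" using C \<rho> by auto
      ultimately show "V * V \<le> (V * V * 2 ^ DIM('a) + C1 * C2) * \<rho> ^ DIM('a)"
        by (simp add: algebra_simps)
    qed
    finally show ?thesis .
  next
    case False
    \<comment> \<open>The axis of the slab. For w = 0 any unit vector serves, as no pair in the cap
      has a sum that close to 0.\<close>
    define e where "e = (if w = 0 then SOME b. b \<in> Basis else sgn w)"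
    have e: "norm e = 1"
      using some_in_eq[of "Basis :: 'a set"] by (auto simp: e_def norm_sgn)
    let ?A = "{x. \<bar>x \<bullet> e - norm w / 2\<bar> \<le> 3 * \<rho>}"
    have [measurable]: "?A \<in> sets borel" by measurable
    have "(\<integral>\<^sup>+x. \<integral>\<^sup>+x'. indicator (ball w \<rho>) (x + x') \<partial>\<mu> \<partial>\<mu>)
      = (\<integral>\<^sup>+y. indicator (radial_cone \<Omega>) y * (\<integral>\<^sup>+x'. indicator (ball w \<rho>) (sgn y + x') \<partial>\<mu>) \<partial>lborel)"
    proof -
      have "(\<lambda>x. \<integral>\<^sup>+x'. indicator (ball w \<rho>) (x + x') \<partial>\<mu>) \<in> borel_measurable borel"
        unfolding eqi by measurable
      then show ?thesis
        using nn_integral_cap_measure[of \<Omega> "\<lambda>x. \<integral>\<^sup>+x'. indicator (ball w \<rho>) (x + x') \<partial>\<mu>"]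
        unfolding \<mu>[symmetric] by simp
    qed
    also have "\<dots> \<le> (\<integral>\<^sup>+y. indicator (radial_cone ?A) y * ennreal (C1 * \<rho> ^ (DIM('a) - 1)) \<partial>lborel)"
    proof (intro nn_integral_mono)
      fix y
      show "indicator (radial_cone \<Omega>) y * (\<integral>\<^sup>+x'. indicator (ball w \<rho>) (sgn y + x') \<partial>\<mu>)
         \<le> indicator (radial_cone ?A) y * ennreal (C1 * \<rho> ^ (DIM('a) - 1))"
      proof (cases "y \<in> radial_cone \<Omega> \<and> radial_cone (\<Omega> \<inter> ball (w - sgn y) \<rho>) \<noteq> {}")
        case True
        then obtain y' where y': "y' \<in> radial_cone (\<Omega> \<inter> ball (w - sgn y) \<rho>)" by auto
        define x x' where "x = sgn y" and "x' = sgn y'"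
        have x: "norm x = 1" "x \<in> \<Omega>" "y \<noteq> 0" "norm y \<le> 1" using True by (auto simp: radial_cone_def x_def norm_sgn)
        have x': "norm x' = 1" "x' \<in> \<Omega>" "dist (w - x) x' < \<rho>" using y' by (auto simp: radial_cone_def x'_def x_def norm_sgn)
        \<comment> \<open>Two points of the cap are at distance less than 1, so by 2x = (x + x') +
          (x - x') their sum has norm at least 1. This excludes antipodal pairs and keeps w away
          from 0.\<close>
        have "dist x x' < 1/2 + 1/2"
          using x(2) x'(2) dist_triangle[of x x' z0] by (simp add: \<Omega>_def dist_commute)
        then have "norm (x + x') \<ge> 1"
        proof -
          have "2 = norm (2 *\<^sub>R x)" using x by simp
          also have "2 *\<^sub>R x = (x + x') + (x - x')" by (simp add: scaleR_2)
          also have "norm \<dots> \<le> norm (x + x') + norm (x - x')" by (rule norm_triangle_ineq)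
          finally show ?thesis using \<open>dist x x' < 1/2 + 1/2\<close> by (simp add: dist_norm)
        qed
        moreover have "norm (x + x') \<le> norm w + norm (w - x - x')"
          using norm_triangle_ineq4[of w "w - x - x'"] by (simp add: add.commute)
        moreover have lt: "norm (w - x - x') < \<rho>" using x' by (simp add: dist_norm)
        ultimately have w: "norm w \<ge> 1/2" using False by simp
        then have w0: "w \<noteq> 0" by auto
        have n1: "\<bar>norm (w - x) - 1\<bar> \<le> \<rho>"
          using lt norm_triangle_ineq3[of "w - x" x'] x' by simp
        \<comment> \<open>The factor 3 bounds |w - x| + 1, since |w - x| \<le> 1 + \<rho> and \<rho>
          < 1/2.\<close>
        have "\<bar>(norm (w - x))\<^sup>2 - 1\<bar> \<le> 3 * \<rho>"
        proof -
          have "\<bar>(norm (w - x))\<^sup>2 - 1\<bar> = \<bar>norm (w - x) - 1\<bar> * \<bar>norm (w - x) + 1\<bar>"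
            unfolding abs_mult[symmetric] by (simp add: power2_eq_square algebra_simps)
          also have "\<dots> \<le> \<rho> * 3"
            using n1 False \<rho> by (intro mult_mono) auto
          finally show ?thesis by simp
        qed
        moreover have "(norm (w - x))\<^sup>2 = (norm w)\<^sup>2 - 2 * (x \<bullet> w) + 1"
        proof -
          have "x \<bullet> x = 1" using x(1) by (simp add: norm_eq_sqrt_inner)
          then show ?thesis by (simp add: power2_norm_eq_inner inner_simps inner_commute)
        qed
        ultimately have "\<bar>(norm w)\<^sup>2 - 2 * (x \<bullet> w)\<bar> \<le> 3 * \<rho>" by simp
        moreover have "x \<bullet> w = norm w * (x \<bullet> e)"
          using w0 by (simp add: e_def sgn_div_norm)
        ultimately have "\<bar>2 * norm w * (norm w / 2 - x \<bullet> e)\<bar> \<le> 3 * \<rho>"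
          by (simp add: power2_eq_square algebra_simps)
        then have "2 * norm w * \<bar>x \<bullet> e - norm w / 2\<bar> \<le> 3 * \<rho>"
          by (simp add: abs_mult abs_minus_commute)
        \<comment> \<open>Here |w| \<ge> 1/2 is spent: dividing by 2|w| does not enlarge the
          slab.\<close>
        moreover have "1 * \<bar>x \<bullet> e - norm w / 2\<bar> \<le> 2 * norm w * \<bar>x \<bullet> e - norm w / 2\<bar>"
          using w by (intro mult_right_mono) auto
        ultimately have "x \<in> ?A" by simp
        then have "y \<in> radial_cone ?A" using x by (simp add: radial_cone_def x_def)
        moreover have "(\<integral>\<^sup>+x'. indicator (ball w \<rho>) (sgn y + x') \<partial>\<mu>) \<le> ennreal (C1 * \<rho> ^ (DIM('a) - 1))"
          unfolding inner C1_def V_def using \<rho> False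
          by (intro radial_cone_ball_le[where z="w - sgn y"]) auto
        ultimately show ?thesis using True by simp
      next
        case False
        then show ?thesis by (auto simp: inner)
      qed
    qed
    also have "\<dots> = emeasure lborel (radial_cone ?A) * ennreal (C1 * \<rho> ^ (DIM('a) - 1))"
      by (simp add: nn_integral_multc)
    also have "\<dots> \<le> ennreal (C2 * \<rho>) * ennreal (C1 * \<rho> ^ (DIM('a) - 1))"
      using radial_cone_slab_le[OF d e, of "3 * \<rho>" "norm w / 2"] \<rho>
      by (intro mult_right_mono) (auto simp: C2_def V_def mult_ac)
    also have "\<dots> = ennreal (C1 * C2 * \<rho> ^ DIM('a))"
      using C \<rho> by (subst ennreal_mult[symmetric]) (auto simp: mult_ac power_eq_if[of \<rho> "DIM('a)"])
    also have "\<dots> \<le> ennreal ((V * V * 2 ^ DIM('a) + C1 * C2) * \<rho> ^ DIM('a))"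
      using V \<rho> by (intro ennreal_leI mult_right_mono) auto
    finally show ?thesis .
  qed
  show thesis
    by (rule that[of "V * V * 2 ^ DIM('a) + C1 * C2"]) (use V C main in auto)
qed

section \<open>The maximal estimate\<close>

text \<open>If a > 1, then a \<le> a^p and b \<le> S. If a \<le> 1, then a^(4/3) \<le> a^p, and
  comparing b with t a^(1/3) decides between the two terms. This takes the place of Hoelder for
  every p up to 4/3 at once, and a large t shifts weight away from the fourth power.\<close>

lemma times_le_powr_plus_fourth_power:
  fixes a b p t S :: real
  assumes "0 \<le> a" "0 \<le> b" "b \<le> S" "1 \<le> t" "1 \<le> p" "p \<le> 4 / 3"
  shows "a * b \<le> (t + S) * a powr p + b ^ 4 / t ^ 3"
proof -
  have S: "0 \<le> S" using assms by simp
  have b4: "0 \<le> b ^ 4 / t ^ 3" using assms by simp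
  have Sap: "0 \<le> S * a powr p" and tap: "0 \<le> t * a powr p" using S assms by auto
  consider "a = 0" | "a > 1" | "0 < a" "a \<le> 1" "b \<le> t * a powr (1/3)" | "0 < a" "a \<le> 1" "t * a powr (1/3) < b"
    using assms by linarith
  then show ?thesis
  proof cases
    case 1 then show ?thesis using b4 by simp
  next
    case 2
    have "a * b \<le> a * S" using assms by (intro mult_left_mono) auto
    also have "\<dots> \<le> a powr p * S"
      using 2 assms S powr_mono[of 1 p a] by (intro mult_right_mono) auto
    finally show ?thesis using tap b4 by (simp add: algebra_simps)
  next
    case 3
    have "a * b \<le> a * (t * a powr (1/3))" using 3 by (intro mult_left_mono) auto
    also have "\<dots> = t * a powr (4/3)"
      using 3 powr_add[of a 1 "1/3"] by simp
    also have "\<dots> \<le> t * a powr p"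
      using 3 assms by (intro mult_left_mono powr_mono') auto
    finally show ?thesis using Sap b4 by (simp add: algebra_simps)
  next
    case 4
    have "(t * a powr (1/3)) ^ 3 \<le> b ^ 3"
      using 4 assms by (intro power_mono) auto
    moreover have "(a powr (1/3)) ^ 3 = a"
      using 4 by (simp add: powr_power)
    ultimately have "t ^ 3 * a \<le> b ^ 3" by (simp add: power_mult_distrib)
    then have "a \<le> b ^ 3 / t ^ 3" using assms by (simp add: field_simps)
    then have "a * b \<le> b ^ 3 / t ^ 3 * b" using assms by (intro mult_right_mono) auto
    also have "\<dots> = b ^ 4 / t ^ 3" by (simp add: power_Suc2[symmetric] numeral_eq_Suc)
    finally show ?thesis using Sap tap by (simp add: algebra_simps)
  qed
qed

lemma norm_fourier_L1_le:
  fixes \<psi> :: "'a::euclidean_space \<Rightarrow> complex"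
  assumes "integrable lborel \<psi>"
  shows "norm (fourier_L1 \<psi> \<xi>) \<le> (LINT y|lborel. norm (\<psi> y))"
proof -
  have [measurable]: "\<psi> \<in> borel_measurable borel"
    using assms by (simp add: borel_measurable_integrable)
  show ?thesis
    unfolding fourier_L1_lborel[OF \<open>\<psi> \<in> _\<close>]
    by (rule order_trans[OF integral_norm_bound]) (simp add: norm_mult)
qed

text \<open>Only countably many radii occur, which makes the set Borel and allows the radius to be
  chosen measurably. Intermediate radii cost a factor 2^d, see
  \<open>dyadic_average_le\<close>.\<close>

definition dyadic_maximal_set :: "('a::euclidean_space \<Rightarrow> complex) \<Rightarrow> real \<Rightarrow> 'a set" where
  "dyadic_maximal_set H \<alpha> = {x. \<exists>k. ennreal \<alpha> < ball_avg ((1/2) ^ k) (\<lambda>y. ennreal (norm (H y))) x}"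

text \<open>Duality on the exceptional set. The truncation at n bounds the radii below, so that the
  dual function \<psi> is an admissible test function; the bound itself is independent of n. The
  hypothesis \<open>t2\<close> makes t large enough for the quadratic term at the end to be
  absorbed.\<close>

lemma dyadic_maximal_estimate_finite:
  fixes \<mu> :: "'a::euclidean_space measure" and h H :: "'a \<Rightarrow> complex" and p t \<alpha> C :: real and n :: nat
  assumes fin: "finite_measure \<mu>" and sets_mu [measurable_cong]: "sets \<mu> = sets borel"
    and K: "\<And>w \<rho>. \<rho> > 0 \<Longrightarrow> (\<integral>\<^sup>+x. \<integral>\<^sup>+x'. indicator (ball w \<rho>) (x + x') \<partial>\<mu> \<partial>\<mu>) \<le> ennreal (C * \<rho> ^ DIM('a))"
    and C: "C \<ge> 0" and p: "1 \<le> p" "p \<le> 4 / 3" and \<alpha>: "\<alpha> > 0" and t: "1 \<le> t"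
    and t2: "2 ^ (3 * (DIM('a) + 1)) * (C / unit_ball_vol (real DIM('a))) * measure \<mu> UNIV / t ^ 3 \<le> \<alpha> / 2"
    and hm [measurable]: "h \<in> borel_measurable borel" and hp: "integrable lborel (\<lambda>x. norm (h x) powr p)"
    and Hm [measurable]: "H \<in> borel_measurable borel"
    and Hloc: "\<And>K. compact K \<Longrightarrow> set_integrable lborel K H"
    and FT: "\<And>\<phi>. \<phi> \<in> borel_measurable borel \<Longrightarrow> bounded (range \<phi>) \<Longrightarrow> bounded {x. \<phi> x \<noteq> 0} \<Longrightarrow>
       (LINT \<xi>|lborel. H \<xi> * \<phi> \<xi>) = (LINT x|lborel. h x * fourier_L1 \<phi> x)"
  defines "E \<equiv> {x \<in> cball 0 1. \<exists>k\<le>n. ennreal \<alpha> < ball_avg ((1/2) ^ k) (\<lambda>y. ennreal (norm (H y))) x}"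
  shows "measure \<mu> E \<le> 2 / \<alpha> * (t + measure \<mu> UNIV) * (LINT x|lborel. norm (h x) powr p)"
proof -
  interpret M: finite_measure \<mu> by (rule fin)
  define S where "S = measure \<mu> UNIV"
  define V where "V = unit_ball_vol (real DIM('a))"
  have V: "V > 0" by (simp add: V_def)
  define P where "P k x \<longleftrightarrow> ennreal \<alpha> < ball_avg ((1/2) ^ k) (\<lambda>y. ennreal (norm (H y))) x" for k x
  have Pm [measurable]: "Measurable.pred borel (P k)" for k unfolding P_def by measurable
  have E: "E = {x \<in> cball 0 1. \<exists>k\<le>n. P k x}" by (simp add: E_def P_def)
  have Em [measurable]: "E \<in> sets borel" unfolding E by measurable
  \<comment> \<open>Least k, hence the largest dyadic radius that works. Where no k qualifies the
    value is unspecified but still positive, and r is measurable everywhere.\<close>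
  define r :: "'a \<Rightarrow> real" where "r x = (1/2) ^ (LEAST k. P k x)" for x
  have rm [measurable]: "r \<in> borel_measurable borel"
    unfolding r_def by measurable
  have rpos: "r x > 0" for x by (simp add: r_def)
  have rE: "(1/2) ^ n \<le> r x" "r x \<le> 1" "ennreal \<alpha> < ball_avg (r x) (\<lambda>y. ennreal (norm (H y))) x" if x: "x \<in> E" for x
  proof -
    obtain k where k: "k \<le> n" "P k x" using x by (auto simp: E)
    have "(LEAST k. P k x) \<le> n" using Least_le[of "\<lambda>k. P k x", OF k(2)] k(1) by simp
    then show "(1/2) ^ n \<le> r x" unfolding r_def by (intro power_decreasing) auto
    show "r x \<le> 1" by (simp add: r_def power_le_one)
    show "ennreal \<alpha> < ball_avg (r x) (\<lambda>y. ennreal (norm (H y))) x"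
      using LeastI[of "\<lambda>k. P k x", OF k(2)] unfolding r_def P_def .
  qed
  \<comment> \<open>Restriction to E keeps the convolution bound \<open>K\<close> and reduces the
    total mass to that of E.\<close>
  define \<nu> where "\<nu> = density \<mu> (indicator E)"
  have nu_int: "(\<integral>\<^sup>+x. F x \<partial>\<nu>) = (\<integral>\<^sup>+x. indicator E x * F x \<partial>\<mu>)" if [measurable]: "F \<in> borel_measurable borel" for F
    unfolding \<nu>_def by (subst nn_integral_density) auto
  have nu_le: "(\<integral>\<^sup>+x. F x \<partial>\<nu>) \<le> (\<integral>\<^sup>+x. F x \<partial>\<mu>)" if [measurable]: "F \<in> borel_measurable borel" for F
    unfolding nu_int[OF that] by (intro nn_integral_mono) (auto simp: indicator_def)
  have space_mu: "space \<mu> = UNIV" using sets_eq_imp_space_eq[OF sets_mu] by simp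
  have nu_sets: "sets \<nu> = sets borel" by (simp add: \<nu>_def sets_mu)
  have nu_space: "emeasure \<nu> (space \<nu>) = ennreal (measure \<mu> E)"
    using nu_int[of "\<lambda>_. 1"] by (simp add: M.emeasure_eq_measure sets_mu)
  define m where "m = measure \<mu> E"
  have mS: "0 \<le> m" "m \<le> S" unfolding m_def S_def using space_mu by (auto intro!: M.finite_measure_mono simp: sets_mu)
  have "finite_measure \<nu>" by (rule finite_measureI) (simp add: nu_space)
  then interpret R: radius_field \<nu> r
    using nu_sets rm rpos by (simp add: radius_field_def radius_field_axioms_def)
  have nuK: "(\<integral>\<^sup>+x. \<integral>\<^sup>+x'. indicator (ball w \<rho>) (x + x') \<partial>\<nu> \<partial>\<nu>) \<le> ennreal (C * \<rho> ^ DIM('a))" if "\<rho> > 0" for w \<rho>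
  proof -
    have eqi: "(indicator (ball w \<rho>) (x + x') :: ennreal) = indicator (ball 0 \<rho>) (x + x' - w)" for x x' :: 'a
      by (simp add: indicator_def dist_norm norm_minus_commute)
    have "(\<integral>\<^sup>+x. \<integral>\<^sup>+x'. indicator (ball w \<rho>) (x + x') \<partial>\<nu> \<partial>\<nu>) \<le> (\<integral>\<^sup>+x. \<integral>\<^sup>+x'. indicator (ball w \<rho>) (x + x') \<partial>\<nu> \<partial>\<mu>)"
      unfolding eqi by (rule nu_le) measurable
    also have "\<dots> \<le> (\<integral>\<^sup>+x. \<integral>\<^sup>+x'. indicator (ball w \<rho>) (x + x') \<partial>\<mu> \<partial>\<mu>)"
      unfolding eqi by (intro nn_integral_mono nu_le) measurable
    finally show ?thesis using K[OF that, of w] by simp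
  qed
  let ?W = "R.smear_weight"
  \<comment> \<open>A crude bound for W that depends on n; it serves to make \<psi> bounded and its
    products integrable.\<close>
  define B where "B = 1 / (V * ((1/2) ^ n) ^ DIM('a)) * S"
  have W_bd: "?W y \<le> ennreal B" for y
  proof -
    have "?W y \<le> (\<integral>\<^sup>+x. ennreal (1 / (V * ((1/2) ^ n) ^ DIM('a))) \<partial>\<mu>)"
      unfolding R.smear_weight_def
    proof (subst nu_int, measurable, intro nn_integral_mono)
      fix x
      show "indicator E x * (ennreal (1 / (unit_ball_vol (real DIM('a)) * r x ^ DIM('a))) * indicator (ball 0 (r x)) (y - x)) \<le>
          ennreal (1 / (V * ((1/2) ^ n) ^ DIM('a)))"
      proof (cases "x \<in> E")
        case True
        have "1 / (V * r x ^ DIM('a)) \<le> 1 / (V * ((1/2) ^ n) ^ DIM('a))"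
          using V rE[OF True] rpos by (intro divide_left_mono mult_left_mono power_mono mult_pos_pos) auto
        then have "ennreal (1 / (unit_ball_vol (real DIM('a)) * r x ^ DIM('a))) * indicator (ball 0 (r x)) (y - x) \<le>
          ennreal (1 / (V * ((1/2) ^ n) ^ DIM('a))) * 1"
          by (intro mult_mono ennreal_leI) (auto simp: V_def indicator_def)
        then show ?thesis using True by simp
      qed simp
    qed
    also have "\<dots> = ennreal B"
      unfolding B_def using V by (subst ennreal_mult) (auto simp: S_def space_mu M.emeasure_eq_measure)
    finally show ?thesis .
  qed
  have W_fin: "?W y < \<top>" for y using W_bd[of y] by (auto intro: le_less_trans)
  \<comment> \<open>E lies in the unit ball and the radii on E are at most 1.\<close>
  have W_supp: "?W y = 0" if "norm y \<ge> 2" for y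
  proof -
    have "?W y = (\<integral>\<^sup>+x. 0 \<partial>\<mu>)"
      unfolding R.smear_weight_def
    proof (subst nu_int, measurable, intro nn_integral_cong)
      fix x
      show "indicator E x * (ennreal (1 / (unit_ball_vol (real DIM('a)) * r x ^ DIM('a))) * indicator (ball 0 (r x)) (y - x)) = 0"
      proof (cases "x \<in> E")
        case True
        then have "norm x \<le> 1" by (simp add: E)
        then have "norm (y - x) \<ge> 1" using that norm_triangle_ineq2[of y x] by simp
        then have "y - x \<notin> ball 0 (r x)" using rE(2)[OF True] by simp
        then show ?thesis by simp
      qed simp
    qed
    then show ?thesis by simp
  qed
  define w where "w y = enn2real (?W y)" for y
  have w: "ennreal (w y) = ?W y" "0 \<le> w y" for y using W_fin[of y] by (auto simp: w_def)
  have [measurable]: "w \<in> borel_measurable borel" unfolding w_def by measurable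
  have B0: "B \<ge> 0" using V mS by (auto simp: B_def)
  have wB: "w y \<le> B" for y using W_bd[of y] B0 by (simp add: w(1)[symmetric])
  have w0: "w y = 0" if "norm y \<ge> 2" for y using W_supp[OF that] by (simp add: w_def)
  \<comment> \<open>The conjugate phase of H makes H \<psi> = |H| w, while |\<psi>| \<le> w.\<close>
  define \<psi> where "\<psi> y = cnj (sgn (H y)) * of_real (w y)" for y
  have [measurable]: "(\<lambda>y. cnj (sgn (H y))) \<in> borel_measurable borel"
    by (rule borel_measurable_continuous_on[of cnj]) (auto intro!: continuous_intros)
  have [measurable]: "(\<lambda>y. complex_of_real (w y)) \<in> borel_measurable borel"
    by (rule borel_measurable_continuous_on[of of_real]) (auto intro!: continuous_intros)
  have [measurable]: "\<psi> \<in> borel_measurable borel" unfolding \<psi>_def by measurable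
  have n\<psi>: "norm (\<psi> y) \<le> w y" for y
    using w(2)[of y] by (simp add: \<psi>_def norm_mult norm_sgn)
  have H\<psi>: "H y * \<psi> y = of_real (norm (H y) * w y)" for y
  proof -
    have "H y * cnj (sgn (H y)) = of_real (norm (H y))"
      by (simp add: sgn_eq complex_norm_square[symmetric] power2_eq_square)
    then show ?thesis by (simp add: \<psi>_def mult.assoc[symmetric])
  qed
  have intW: "(\<integral>\<^sup>+y. ennreal (w y) \<partial>lborel) \<le> ennreal m"
  proof -
    have "(\<integral>\<^sup>+y. ennreal (w y) \<partial>lborel) = R.smear 1 (\<lambda>_. 1) 0"
      using R.nn_integral_smear_weight[of "\<lambda>_. 1" 1 0] by (simp add: w)
    also have "\<dots> \<le> (\<integral>\<^sup>+x. 1 \<partial>\<nu>)"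
      unfolding R.smear_def by (intro nn_integral_mono ball_avg_const_le rpos)
    finally show ?thesis by (simp add: nu_space m_def)
  qed
  have wint: "integrable lborel w"
    using intW w(2) by (intro integrableI_bounded) (auto intro: le_less_trans)
  have \<psi>int: "integrable lborel \<psi>"
    by (rule Bochner_Integration.integrable_bound[OF wint]) (use n\<psi> w in auto)
  \<comment> \<open>Provides the parameter S of the pointwise inequality: the transform is bounded
    by the integral of w, hence by m \<le> S.\<close>
  have hat_le: "norm (fourier_L1 \<psi> \<xi>) \<le> S" for \<xi>
  proof -
    have "norm (fourier_L1 \<psi> \<xi>) \<le> (LINT y|lborel. norm (\<psi> y))"
      by (rule norm_fourier_L1_le[OF \<psi>int])
    also have "\<dots> \<le> (LINT y|lborel. w y)"
      by (intro integral_mono integrable_norm \<psi>int wint n\<psi>)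
    also have "\<dots> \<le> m"
      using intW w(2) wint mS by (simp add: nn_integral_eq_integral)
    finally show ?thesis using mS by simp
  qed
  let ?D = "2 ^ (3 * (DIM('a) + 1)) * (C / V)"
  have D0: "?D \<ge> 0" using C V by auto
  have four: "(\<integral>\<^sup>+\<xi>. ennreal (norm (fourier_L1 \<psi> \<xi>) ^ 4) \<partial>lborel) \<le> ennreal (?D * m\<^sup>2)"
  proof (rule nn_integral_fourier_fourth_power_le[OF \<psi>int])
    show "ennreal (norm (\<psi> y)) \<le> ?W y" for y
      using n\<psi>[of y] by (simp add: w(1)[symmetric] ennreal_leI)
    fix u :: "'a \<Rightarrow> ennreal" assume u: "u \<in> borel_measurable borel" "(\<integral>\<^sup>+w. u w \<partial>lborel) = 1"
    have "(\<integral>\<^sup>+y1. ?W y1 * (\<integral>\<^sup>+y2. ?W y2 * (\<integral>\<^sup>+y3. ?W y3 *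
       (\<integral>\<^sup>+y4. ?W y4 * u (y1 + y2 - y3 - y4) \<partial>lborel) \<partial>lborel) \<partial>lborel) \<partial>lborel)
      \<le> 2 ^ (3 * (DIM('a) + 1)) * ennreal (C / unit_ball_vol (real DIM('a))) * emeasure \<nu> (space \<nu>) ^ 2 * (\<integral>\<^sup>+w. u w \<partial>lborel)"
      by (rule R.quadrilinear_smear_weight_le[OF nuK C u(1)])
    also have "\<dots> = ennreal (?D * m\<^sup>2)"
    proof -
      have "(2::ennreal) ^ (3 * (DIM('a) + 1)) = ennreal (2 ^ (3 * (DIM('a) + 1)))"
        by (simp add: ennreal_power[symmetric])
      moreover have "ennreal (?D * m\<^sup>2) = ennreal (2 ^ (3 * (DIM('a) + 1))) * ennreal (C / V) * ennreal (m\<^sup>2)"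
        using C V by (subst ennreal_mult, simp, simp, subst ennreal_mult) auto
      ultimately show ?thesis
        using mS by (simp only: u(2) nu_space m_def[symmetric] V_def[symmetric] ennreal_power mult_1_right)
    qed
    finally show "(\<integral>\<^sup>+y1. ?W y1 * (\<integral>\<^sup>+y2. ?W y2 * (\<integral>\<^sup>+y3. ?W y3 *
       (\<integral>\<^sup>+y4. ?W y4 * u (y1 + y2 - y3 - y4) \<partial>lborel) \<partial>lborel) \<partial>lborel) \<partial>lborel) \<le> ennreal (?D * m\<^sup>2)" .
  qed measurable
  have bH: "integrable lborel (\<lambda>y. norm (H y) * w y)"
  proof (rule Bochner_Integration.integrable_bound)
    have "integrable lborel (\<lambda>y. norm (indicator (cball 0 2) y *\<^sub>R H y))"
      using Hloc[of "cball 0 2"] by (intro integrable_norm) (simp add: set_integrable_def)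
    then show "integrable lborel (\<lambda>y. B * norm (indicator (cball 0 2) y *\<^sub>R H y))" by simp
    show "AE y in lborel. norm (norm (H y) * w y) \<le> norm (B * norm (indicator (cball 0 2) y *\<^sub>R H y))"
    proof (rule AE_I2)
      fix y
      show "norm (norm (H y) * w y) \<le> norm (B * norm (indicator (cball 0 2) y *\<^sub>R H y))"
        using wB[of y] w(2)[of y] w0[of y] B0
        by (cases "norm y \<ge> 2") (auto simp: abs_mult mult.commute indicator_def intro!: mult_right_mono)
    qed
  qed measurable
  let ?N = "LINT x|lborel. norm (h x) powr p"
  \<comment> \<open>On E the average exceeds \<alpha>. Integrating over \<nu> and unfolding W turns
    the averages into the pairing of |H| with w.\<close>
  have "ennreal (\<alpha> * m) = (\<integral>\<^sup>+x. ennreal \<alpha> \<partial>\<nu>)"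
    using \<alpha> mS by (simp add: nu_space m_def ennreal_mult)
  also have "\<dots> \<le> (\<integral>\<^sup>+x. ball_avg (r x) (\<lambda>y. ennreal (norm (H y))) x \<partial>\<nu>)"
  proof -
    have "(\<integral>\<^sup>+x. ennreal \<alpha> \<partial>\<nu>) = (\<integral>\<^sup>+x. indicator E x * ennreal \<alpha> \<partial>\<mu>)"
      by (rule nu_int) simp
    also have "\<dots> \<le> (\<integral>\<^sup>+x. indicator E x * ball_avg (r x) (\<lambda>y. ennreal (norm (H y))) x \<partial>\<mu>)"
      by (intro nn_integral_mono) (auto simp: indicator_def intro: less_imp_le[OF rE(3)])
    also have "\<dots> = (\<integral>\<^sup>+x. ball_avg (r x) (\<lambda>y. ennreal (norm (H y))) x \<partial>\<nu>)"
      by (rule nu_int[symmetric]) measurable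
    finally show ?thesis .
  qed
  also have "\<dots> = R.smear 1 (\<lambda>y. ennreal (norm (H y))) 0"
    by (simp add: R.smear_def)
  also have "\<dots> = (\<integral>\<^sup>+y. ?W y * ennreal (norm (H y)) \<partial>lborel)"
    using R.nn_integral_smear_weight[of "\<lambda>y. ennreal (norm (H y))" 1 0] by simp
  also have "\<dots> = (\<integral>\<^sup>+y. ennreal (norm (H y) * w y) \<partial>lborel)"
    by (simp add: w(1)[symmetric] w(2) ennreal_mult' mult.commute)
  also have "\<dots> = ennreal (LINT y|lborel. norm (H y) * w y)"
    by (rule nn_integral_eq_integral[OF bH]) (use w(2) in auto)
  also have "(LINT y|lborel. norm (H y) * w y) \<le> norm (LINT y|lborel. H y * \<psi> y)"
    by (simp only: H\<psi> integral_complex_of_real norm_of_real abs_ge_self)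
  also have "(LINT y|lborel. H y * \<psi> y) = (LINT x|lborel. h x * fourier_L1 \<psi> x)"
  proof (rule FT)
    show "bounded (range \<psi>)"
      using order_trans[OF n\<psi> wB] by (auto intro!: boundedI)
    have "{x. \<psi> x \<noteq> 0} \<subseteq> cball 0 2"
      using w0 by (auto simp: \<psi>_def) (meson linear)
    then show "bounded {x. \<psi> x \<noteq> 0}" using bounded_subset bounded_cball by blast
  qed measurable
  also have "ennreal (norm (LINT x|lborel. h x * fourier_L1 \<psi> x)) \<le> (\<integral>\<^sup>+x. ennreal (norm (h x * fourier_L1 \<psi> x)) \<partial>lborel)"
  proof (cases "integrable lborel (\<lambda>x. h x * fourier_L1 \<psi> x)")
    case True
    then show ?thesis by (rule integral_norm_bound_ennreal)
  qed (simp add: not_integrable_integral_eq)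
  also have "\<dots> \<le> (\<integral>\<^sup>+x. ennreal ((t + S) * norm (h x) powr p) + ennreal (1 / t ^ 3) * ennreal (norm (fourier_L1 \<psi> x) ^ 4) \<partial>lborel)"
  proof (intro nn_integral_mono)
    fix x
    have "norm (h x * fourier_L1 \<psi> x) \<le> (t + S) * norm (h x) powr p + 1 / t ^ 3 * norm (fourier_L1 \<psi> x) ^ 4"
      using times_le_powr_plus_fourth_power[of "norm (h x)" "norm (fourier_L1 \<psi> x)" S t p] hat_le t p
      by (simp add: norm_mult)
    then show "ennreal (norm (h x * fourier_L1 \<psi> x)) \<le> ennreal ((t + S) * norm (h x) powr p) + ennreal (1 / t ^ 3) * ennreal (norm (fourier_L1 \<psi> x) ^ 4)"
      using t mS by (subst ennreal_mult[symmetric]) (auto simp flip: ennreal_plus intro: ennreal_leI)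
  qed
  also have "\<dots> = (\<integral>\<^sup>+x. ennreal ((t + S) * norm (h x) powr p) \<partial>lborel) + ennreal (1 / t ^ 3) * (\<integral>\<^sup>+x. ennreal (norm (fourier_L1 \<psi> x) ^ 4) \<partial>lborel)"
    by (subst nn_integral_add) (auto simp: nn_integral_cmult)
  also have "\<dots> \<le> ennreal ((t + S) * ?N) + ennreal (1 / t ^ 3) * ennreal (?D * m\<^sup>2)"
  proof (intro add_mono mult_left_mono four)
    show "(\<integral>\<^sup>+x. ennreal ((t + S) * norm (h x) powr p) \<partial>lborel) \<le> ennreal ((t + S) * ?N)"
      using t mS hp by (subst nn_integral_eq_integral) auto
  qed simp
  also have "\<dots> = ennreal ((t + S) * ?N + ?D * m\<^sup>2 / t ^ 3)"
  proof -
    have "ennreal a + ennreal (1 / t ^ 3) * ennreal b = ennreal (a + b / t ^ 3)" if "0 \<le> a" "0 \<le> b" for a b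
      using that t by (simp add: ennreal_mult[symmetric] flip: ennreal_plus)
    moreover have "0 \<le> (t + S) * ?N" using t mS by (intro mult_nonneg_nonneg) auto
    moreover have "0 \<le> ?D * m\<^sup>2" using D0 by (rule mult_nonneg_nonneg) simp
    ultimately show ?thesis by blast
  qed
  finally have 1: "ennreal (\<alpha> * m) \<le> ennreal ((t + S) * ?N + ?D * m\<^sup>2 / t ^ 3)"
    by (simp add: ennreal_leI)
  have nn: "0 \<le> (t + S) * ?N" using t mS by (intro mult_nonneg_nonneg) auto
  have "\<alpha> * m \<le> (t + S) * ?N + ?D * m\<^sup>2 / t ^ 3"
  proof -
    have "0 \<le> ?D * m\<^sup>2 / t ^ 3" using C V t by (intro divide_nonneg_nonneg mult_nonneg_nonneg) auto
    then have "0 \<le> (t + S) * ?N + ?D * m\<^sup>2 / t ^ 3" using nn by (rule add_nonneg_nonneg[rotated])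
    then show ?thesis using 1 by (simp only: ennreal_le_iff)
  qed
  \<comment> \<open>One factor m is bounded by S, and \<open>t2\<close> makes the coefficient at
    most \<alpha>/2, so the quadratic term goes to the left side.\<close>
  also have "?D * m\<^sup>2 / t ^ 3 \<le> \<alpha> / 2 * m"
  proof -
    have "?D * m\<^sup>2 / t ^ 3 = (?D / t ^ 3 * m) * m" by (simp add: power2_eq_square)
    also have "\<dots> \<le> (?D / t ^ 3 * S) * m"
      using mS C V t by (intro mult_right_mono mult_left_mono) auto
    also have "?D / t ^ 3 * S = ?D * S / t ^ 3" by simp
    also have "\<dots> * m \<le> \<alpha> / 2 * m"
      using t2 mS unfolding S_def V_def by (intro mult_right_mono) auto
    finally show ?thesis .
  qed
  finally have "\<alpha> / 2 * m \<le> (t + S) * ?N" by (simp add: algebra_simps)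
  then have "m \<le> 2 / \<alpha> * ((t + S) * ?N)" using \<alpha> by (simp add: field_simps)
  then show ?thesis by (simp only: m_def S_def mult.assoc)
qed

lemma dyadic_maximal_set_borel [measurable]:
  assumes [measurable]: "H \<in> borel_measurable borel"
  shows "dyadic_maximal_set H \<alpha> \<in> sets borel"
  unfolding dyadic_maximal_set_def by measurable

text \<open>The truncated sets increase to the full set while their bound does not depend on n. What
  matters for the application is that B is chosen before h and H.\<close>

lemma dyadic_maximal_estimate:
  fixes \<mu> :: "'a::euclidean_space measure" and p \<alpha> C :: real
  assumes fin: "finite_measure \<mu>" and sets_mu [measurable_cong]: "sets \<mu> = sets borel"
    and K: "\<And>w \<rho>. \<rho> > 0 \<Longrightarrow> (\<integral>\<^sup>+x. \<integral>\<^sup>+x'. indicator (ball w \<rho>) (x + x') \<partial>\<mu> \<partial>\<mu>) \<le> ennreal (C * \<rho> ^ DIM('a))"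
    and C: "C \<ge> 0" and p: "1 \<le> p" "p \<le> 4 / 3" and \<alpha>: "\<alpha> > 0"
  obtains B where "B \<ge> 0"
    "\<And>h H :: 'a \<Rightarrow> complex. h \<in> borel_measurable borel \<Longrightarrow> integrable lborel (\<lambda>x. norm (h x) powr p) \<Longrightarrow>
      H \<in> borel_measurable borel \<Longrightarrow> (\<And>K. compact K \<Longrightarrow> set_integrable lborel K H) \<Longrightarrow>
      (\<And>\<phi>. \<phi> \<in> borel_measurable borel \<Longrightarrow> bounded (range \<phi>) \<Longrightarrow> bounded {x. \<phi> x \<noteq> 0} \<Longrightarrow>
         (LINT \<xi>|lborel. H \<xi> * \<phi> \<xi>) = (LINT x|lborel. h x * fourier_L1 \<phi> x)) \<Longrightarrow>
      emeasure \<mu> (cball 0 1 \<inter> dyadic_maximal_set H \<alpha>) \<le> ennreal (B * (LINT x|lborel. norm (h x) powr p))"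
proof -
  interpret M: finite_measure \<mu> by (rule fin)
  define D where "D = 2 ^ (3 * (DIM('a) + 1)) * (C / unit_ball_vol (real DIM('a))) * measure \<mu> UNIV"
  have D: "D \<ge> 0" using C by (auto simp: D_def)
  \<comment> \<open>Since t \<ge> 1 we have t \<le> t^3, so 2D/\<alpha> \<le> t already gives D/t^3
    \<le> \<alpha>/2.\<close>
  define t where "t = max 1 (2 * D / \<alpha>)"
  have t: "1 \<le> t" by (simp add: t_def)
  have t2: "D / t ^ 3 \<le> \<alpha> / 2"
  proof -
    have "2 * D / \<alpha> \<le> t" by (simp add: t_def)
    also have "\<dots> \<le> t ^ 3" using t self_le_power[of t 3] by simp
    finally have "2 * D \<le> t ^ 3 * \<alpha>" using \<alpha> by (simp add: field_simps)
    then show ?thesis using t by (simp add: field_simps)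
  qed
  show thesis
  proof (rule that[of "2 / \<alpha> * (t + measure \<mu> UNIV)"])
    show "0 \<le> 2 / \<alpha> * (t + measure \<mu> UNIV)" using \<alpha> t by auto
    fix h H :: "'a \<Rightarrow> complex"
    assume h: "h \<in> borel_measurable borel" "integrable lborel (\<lambda>x. norm (h x) powr p)"
      and Hm [measurable]: "H \<in> borel_measurable borel" and Hloc: "\<And>K. compact K \<Longrightarrow> set_integrable lborel K H"
      and FT: "\<And>\<phi>. \<phi> \<in> borel_measurable borel \<Longrightarrow> bounded (range \<phi>) \<Longrightarrow> bounded {x. \<phi> x \<noteq> 0} \<Longrightarrow>
         (LINT \<xi>|lborel. H \<xi> * \<phi> \<xi>) = (LINT x|lborel. h x * fourier_L1 \<phi> x)"
    define E where "E n = {x \<in> cball 0 1. \<exists>k\<le>n. ennreal \<alpha> < ball_avg ((1/2) ^ k) (\<lambda>y. ennreal (norm (H y))) x}" for n :: nat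
    let ?B = "2 / \<alpha> * (t + measure \<mu> UNIV) * (LINT x|lborel. norm (h x) powr p)"
    have Em: "E n \<in> sets \<mu>" for n unfolding E_def by measurable
    have "emeasure \<mu> (E n) \<le> ennreal ?B" for n
    proof -
      have "measure \<mu> (E n) \<le> ?B"
        unfolding E_def
        by (rule dyadic_maximal_estimate_finite[OF fin sets_mu K C p \<alpha> t _ h Hm Hloc FT])
           (use t2 in \<open>auto simp: D_def\<close>)
      then show ?thesis by (simp add: M.emeasure_eq_measure ennreal_leI)
    qed
    moreover have "incseq E" by (auto simp: incseq_def E_def intro: order_trans)
    moreover have "(\<Union>n. E n) = cball 0 1 \<inter> dyadic_maximal_set H \<alpha>"
      by (auto simp: E_def dyadic_maximal_set_def)
    ultimately show "emeasure \<mu> (cball 0 1 \<inter> dyadic_maximal_set H \<alpha>) \<le> ennreal ?B"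
      using SUP_emeasure_incseq[of E \<mu>] Em by (metis (no_types, lifting) SUP_least image_subsetI)
  qed
qed

section \<open>Density of Schwartz functions\<close>

text \<open>Directional derivatives that are again polynomial in the base point are what keeps the
  class of polynomials times exp(-P) stable under \<open>iter_deriv\<close>.\<close>

lemma real_polynomial_function_has_derivative:
  fixes p :: "'a::real_normed_vector \<Rightarrow> real"
  assumes "real_polynomial_function p"
  obtains p' where "\<And>x. (p has_derivative p' x) (at x)" "\<And>v. real_polynomial_function (\<lambda>x. p' x v)"
  using assms
proof (induction arbitrary: thesis rule: real_polynomial_function.induct)
  case (linear f)
  show ?case
    by (rule linear.prems[of "\<lambda>_. f"]) (auto intro: bounded_linear_imp_has_derivative linear.hyps)
next
  case (const c)
  show ?case by (rule const.prems[of "\<lambda>_ _. 0"]) auto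
next
  case (add f g)
  obtain f' where f': "\<And>x. (f has_derivative f' x) (at x)" "\<And>v. real_polynomial_function (\<lambda>x. f' x v)"
    using add.IH(1) by blast
  obtain g' where g': "\<And>x. (g has_derivative g' x) (at x)" "\<And>v. real_polynomial_function (\<lambda>x. g' x v)"
    using add.IH(2) by blast
  show ?case
  proof (rule add.prems[of "\<lambda>x v. f' x v + g' x v"])
    show "((\<lambda>x. f x + g x) has_derivative (\<lambda>v. f' x v + g' x v)) (at x)" for x
      by (rule has_derivative_add[OF f'(1) g'(1)])
    show "real_polynomial_function (\<lambda>x. f' x v + g' x v)" for v
      by (rule real_polynomial_function.intros(3)[OF f'(2) g'(2)])
  qed
next
  case (mult f g)
  obtain f' where f': "\<And>x. (f has_derivative f' x) (at x)" "\<And>v. real_polynomial_function (\<lambda>x. f' x v)"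
    using mult.IH(1) by blast
  obtain g' where g': "\<And>x. (g has_derivative g' x) (at x)" "\<And>v. real_polynomial_function (\<lambda>x. g' x v)"
    using mult.IH(2) by blast
  show ?case
  proof (rule mult.prems[of "\<lambda>x v. f x * g' x v + f' x v * g x"])
    show "((\<lambda>x. f x * g x) has_derivative (\<lambda>v. f x * g' x v + f' x v * g x)) (at x)" for x
      by (rule has_derivative_mult[OF f'(1) g'(1)])
    show "real_polynomial_function (\<lambda>x. f x * g' x v + f' x v * g x)" for v
      by (rule real_polynomial_function.intros(3)[OF real_polynomial_function.intros(4)[OF mult.hyps(1) g'(2)]
            real_polynomial_function.intros(4)[OF f'(2) mult.hyps(2)]])
  qed
qed

lemma real_polynomial_function_growth:
  fixes p :: "'a::real_normed_vector \<Rightarrow> real"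
  assumes "real_polynomial_function p"
  obtains C k where "C \<ge> 0" "\<And>x. \<bar>p x\<bar> \<le> C * (1 + norm x) ^ k"
  using assms
proof (induction arbitrary: thesis rule: real_polynomial_function.induct)
  case (linear f)
  obtain K where K: "K > 0" "\<And>x. norm (f x) \<le> norm x * K"
    using bounded_linear.pos_bounded[OF linear.hyps] by blast
  show ?case
  proof (rule linear.prems[of K 1])
    fix x
    have "\<bar>f x\<bar> \<le> norm x * K" using K(2)[of x] by simp
    also have "\<dots> \<le> K * (1 + norm x) ^ 1" using K(1) by (simp add: algebra_simps)
    finally show "\<bar>f x\<bar> \<le> K * (1 + norm x) ^ 1" .
  qed (use K in auto)
next
  case (const c)
  show ?case by (rule const.prems[of "\<bar>c\<bar>" 0]) auto
next
  case (add f g)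
  obtain C k where f: "C \<ge> 0" "\<And>x. \<bar>f x\<bar> \<le> C * (1 + norm x) ^ k" using add.IH(1) by blast
  obtain D l where g: "D \<ge> 0" "\<And>x. \<bar>g x\<bar> \<le> D * (1 + norm x) ^ l" using add.IH(2) by blast
  show ?case
  proof (rule add.prems[of "C + D" "k + l"])
    fix x
    have "\<bar>f x + g x\<bar> \<le> C * (1 + norm x) ^ k + D * (1 + norm x) ^ l"
      using f(2)[of x] g(2)[of x] by linarith
    also have "\<dots> \<le> C * (1 + norm x) ^ (k + l) + D * (1 + norm x) ^ (k + l)"
      using f(1) g(1) by (intro add_mono mult_left_mono power_increasing) auto
    finally show "\<bar>f x + g x\<bar> \<le> (C + D) * (1 + norm x) ^ (k + l)" by (simp add: algebra_simps)
  qed (use f g in auto)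
next
  case (mult f g)
  obtain C k where f: "C \<ge> 0" "\<And>x. \<bar>f x\<bar> \<le> C * (1 + norm x) ^ k" using mult.IH(1) by blast
  obtain D l where g: "D \<ge> 0" "\<And>x. \<bar>g x\<bar> \<le> D * (1 + norm x) ^ l" using mult.IH(2) by blast
  show ?case
  proof (rule mult.prems[of "C * D" "k + l"])
    fix x
    have "\<bar>f x * g x\<bar> \<le> (C * (1 + norm x) ^ k) * (D * (1 + norm x) ^ l)"
      unfolding abs_mult using f g by (intro mult_mono) auto
    then show "\<bar>f x * g x\<bar> \<le> (C * D) * (1 + norm x) ^ (k + l)" by (simp add: power_add mult_ac)
  qed (use f g in auto)
qed

text \<open>With n = m + 1 > 0, the inequality u \<le> exp u at u = \<epsilon>(1 + t)/n, raised to
  the power n, gives (1 + t)^n \<le> (n/\<epsilon>)^n exp(\<epsilon>(1 + t)). The surplus exp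
  \<epsilon> goes into the constant.\<close>

lemma power_times_exp_neg_bounded:
  fixes \<epsilon> :: real
  assumes \<epsilon>: "\<epsilon> > 0"
  obtains D where "\<And>t. t \<ge> 0 \<Longrightarrow> (1 + t) ^ m * exp (- \<epsilon> * t) \<le> D"
proof (rule that[of "(real (Suc m) / \<epsilon>) ^ Suc m * exp \<epsilon>"])
  fix t :: real assume t: "t \<ge> 0"
  let ?n = "Suc m"
  have "(1 + t) ^ m \<le> (1 + t) ^ ?n" using t by (intro power_increasing) auto
  also have "(1 + t) ^ ?n = ((real ?n / \<epsilon>) * (\<epsilon> * (1 + t) / real ?n)) ^ ?n" using \<epsilon> by simp
  also have "\<dots> = (real ?n / \<epsilon>) ^ ?n * (\<epsilon> * (1 + t) / real ?n) ^ ?n" by (rule power_mult_distrib)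
  also have "\<dots> \<le> (real ?n / \<epsilon>) ^ ?n * (exp (\<epsilon> * (1 + t) / real ?n)) ^ ?n"
  proof (intro mult_left_mono power_mono)
    show "\<epsilon> * (1 + t) / real ?n \<le> exp (\<epsilon> * (1 + t) / real ?n)"
      using exp_ge_add_one_self[of "\<epsilon> * (1 + t) / real ?n"] by linarith
  qed (use \<epsilon> t in auto)
  also have "(exp (\<epsilon> * (1 + t) / real ?n)) ^ ?n = exp (\<epsilon> * (1 + t))"
    by (subst exp_of_nat_mult[symmetric]) simp
  finally have "(1 + t) ^ m \<le> (real ?n / \<epsilon>) ^ ?n * exp (\<epsilon> * (1 + t))" .
  then have "(1 + t) ^ m * exp (- \<epsilon> * t) \<le> (real ?n / \<epsilon>) ^ ?n * exp (\<epsilon> * (1 + t)) * exp (- \<epsilon> * t)"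
    by (intro mult_right_mono) auto
  also have "\<dots> = (real ?n / \<epsilon>) ^ ?n * exp \<epsilon>"
    by (simp add: mult.assoc exp_add[symmetric] algebra_simps del: power_Suc)
  finally show "(1 + t) ^ m * exp (- \<epsilon> * t) \<le> (real ?n / \<epsilon>) ^ ?n * exp \<epsilon>" .
qed

lemma has_derivative_times_exp_neg:
  fixes q P :: "'a::real_normed_vector \<Rightarrow> real"
  assumes q: "(q has_derivative q') (at x)" and P: "(P has_derivative P') (at x)"
  shows "((\<lambda>x. complex_of_real (q x * exp (- P x))) has_derivative
    (\<lambda>w. complex_of_real ((q' w - q x * P' w) * exp (- P x)))) (at x)"
proof (rule has_derivative_of_real)
  show "((\<lambda>x. q x * exp (- P x)) has_derivative (\<lambda>w. (q' w - q x * P' w) * exp (- P x))) (at x)"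
    by (auto intro!: derivative_eq_intros q P simp: algebra_simps)
qed

text \<open>Differentiating q exp(-P) in a direction v gives (q_v - q P_v) exp(-P), with q_v and P_v
  the directional derivatives: the exponent stays and the new factor is a polynomial.\<close>

lemma iter_deriv_polynomial_exp:
  fixes q P :: "'a::euclidean_space \<Rightarrow> real"
  assumes "real_polynomial_function q" and P: "real_polynomial_function P"
  shows "\<exists>q'. real_polynomial_function q' \<and>
    iter_deriv (\<lambda>x. complex_of_real (q x * exp (- P x))) vs = (\<lambda>x. complex_of_real (q' x * exp (- P x)))"
  using assms(1)
proof (induction vs arbitrary: q)
  case Nil
  then show ?case by auto
next
  case (Cons v vs)
  obtain q' where q': "\<And>x. (q has_derivative q' x) (at x)" "\<And>v. real_polynomial_function (\<lambda>x. q' x v)"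
    using real_polynomial_function_has_derivative[OF Cons.prems] by blast
  obtain P' where P': "\<And>x. (P has_derivative P' x) (at x)" "\<And>v. real_polynomial_function (\<lambda>x. P' x v)"
    using real_polynomial_function_has_derivative[OF P] by blast
  let ?q = "\<lambda>x. q' x v - q x * P' x v"
  have "frechet_derivative (\<lambda>x. complex_of_real (q x * exp (- P x))) (at x) v = complex_of_real (?q x * exp (- P x))" for x
    using fun_cong[OF frechet_derivative_at[OF has_derivative_times_exp_neg[OF q'(1) P'(1)]], of x v] by (rule sym)
  then have "iter_deriv (\<lambda>x. complex_of_real (q x * exp (- P x))) (v # vs) = iter_deriv (\<lambda>x. complex_of_real (?q x * exp (- P x))) vs"
    by (simp only: iter_deriv.simps)
  moreover have "real_polynomial_function ?q"
    by (intro real_polynomial_function_diff real_polynomial_function.intros(4) q'(2) P'(2) Cons.prems)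
  ultimately show ?case using Cons.IH[of ?q] by (simp only:)
qed

text \<open>Derivatives of every order are polynomials times exp(-P), and linear growth of P from
  below already outweighs any polynomial.\<close>

lemma schwartz_exp_neg_polynomial:
  fixes P :: "'a::euclidean_space \<Rightarrow> real"
  assumes P: "real_polynomial_function P" and \<epsilon>: "\<epsilon> > 0" and lower: "\<And>x. P x \<ge> \<epsilon> * norm x - A"
  shows "schwartz (\<lambda>x. complex_of_real (exp (- P x)))"
proof -
  have ex: "\<exists>q. real_polynomial_function q \<and> iter_deriv (\<lambda>x. complex_of_real (exp (- P x))) vs = (\<lambda>x. complex_of_real (q x * exp (- P x)))" for vs
    using iter_deriv_polynomial_exp[OF real_polynomial_function.intros(2) P, of 1 vs] by (simp only: mult_1_left)
  show ?thesis
    unfolding schwartz_def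
  proof (intro conjI allI)
    fix vs and x :: 'a
    obtain q where q: "real_polynomial_function q"
      "iter_deriv (\<lambda>x. complex_of_real (exp (- P x))) vs = (\<lambda>x. complex_of_real (q x * exp (- P x)))" using ex by blast
    obtain q' where q': "\<And>x. (q has_derivative q' x) (at x)" "\<And>v. real_polynomial_function (\<lambda>x. q' x v)"
      using real_polynomial_function_has_derivative[OF q(1)] by blast
    obtain P' where P': "\<And>x. (P has_derivative P' x) (at x)" "\<And>v. real_polynomial_function (\<lambda>x. P' x v)"
      using real_polynomial_function_has_derivative[OF P] by blast
    show "iter_deriv (\<lambda>x. complex_of_real (exp (- P x))) vs differentiable at x"
      unfolding q(2) differentiable_def
      by (rule exI) (rule has_derivative_times_exp_neg[OF q'(1) P'(1)])
  next
    fix vs and k :: nat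
    obtain q where q: "real_polynomial_function q"
      "iter_deriv (\<lambda>x. complex_of_real (exp (- P x))) vs = (\<lambda>x. complex_of_real (q x * exp (- P x)))" using ex by blast
    obtain C l where C: "C \<ge> 0" "\<And>x. \<bar>q x\<bar> \<le> C * (1 + norm x) ^ l"
      using real_polynomial_function_growth[OF q(1)] by blast
    obtain D where D: "\<And>t. t \<ge> 0 \<Longrightarrow> (1 + t) ^ (k + l) * exp (- \<epsilon> * t) \<le> D"
      using power_times_exp_neg_bounded[OF \<epsilon>, of "k + l"] by blast
    have "(1 + norm x) ^ k * norm (iter_deriv (\<lambda>x. complex_of_real (exp (- P x))) vs x) \<le> C * exp A * D" for x
    proof -
      have "norm (iter_deriv (\<lambda>x. complex_of_real (exp (- P x))) vs x) = \<bar>q x\<bar> * exp (- P x)"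
        unfolding q(2) by (simp add: norm_mult)
      also have "\<dots> \<le> (C * (1 + norm x) ^ l) * exp (A - \<epsilon> * norm x)"
        using C lower[of x] by (intro mult_mono) auto
      finally have "(1 + norm x) ^ k * norm (iter_deriv (\<lambda>x. complex_of_real (exp (- P x))) vs x)
        \<le> (1 + norm x) ^ k * ((C * (1 + norm x) ^ l) * exp (A - \<epsilon> * norm x))"
        by (intro mult_left_mono) auto
      also have "\<dots> = C * exp A * ((1 + norm x) ^ (k + l) * exp (- \<epsilon> * norm x))"
        by (simp add: power_add mult_ac exp_diff exp_minus field_simps)
      also have "\<dots> \<le> C * exp A * D"
        using C D[of "norm x"] by (intro mult_left_mono) auto
      finally show ?thesis .
    qed
    then show "bounded (range (\<lambda>x. (1 + norm x) ^ k * norm (iter_deriv (\<lambda>x. complex_of_real (exp (- P x))) vs x)))"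
      by (auto intro!: boundedI[of _ "C * exp A * D"] simp: abs_mult)
  qed
qed

lemma schwartz_deriv:
  assumes f: "schwartz f"
  shows "schwartz (\<lambda>x. frechet_derivative f (at x) v)"
proof -
  have eq: "iter_deriv (\<lambda>x. frechet_derivative f (at x) v) vs = iter_deriv f (v # vs)" for vs
    by (simp only: iter_deriv.simps)
  show ?thesis using f unfolding schwartz_def eq by blast
qed

text \<open>Linearity of \<open>frechet_derivative\<close> rests on differentiability of both
  functions; the Schwartz property supplies it at each order and passes to derivatives.\<close>

lemma iter_deriv_linear:
  assumes "schwartz f" "schwartz g"
  shows "iter_deriv (\<lambda>x. a * f x + b * g x) vs = (\<lambda>x. a * iter_deriv f vs x + b * iter_deriv g vs x)"
  using assms
proof (induction vs arbitrary: f g)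
  case (Cons v vs)
  have df: "f differentiable (at x)" and dg: "g differentiable (at x)" for x
    using Cons.prems unfolding schwartz_def by (metis iter_deriv.simps(1))+
  have D: "((\<lambda>x. a * f x + b * g x) has_derivative
      (\<lambda>w. a * frechet_derivative f (at x) w + b * frechet_derivative g (at x) w)) (at x)" for x
    by (intro derivative_intros frechet_derivative_works[THEN iffD1] df dg)
  have "frechet_derivative (\<lambda>x. a * f x + b * g x) (at x) v = a * frechet_derivative f (at x) v + b * frechet_derivative g (at x) v" for x
    using fun_cong[OF frechet_derivative_at[OF D], of x v] by (rule sym)
  then show ?case using Cons.IH[OF schwartz_deriv[OF Cons.prems(1), of v] schwartz_deriv[OF Cons.prems(2), of v]] by simp
qed simp

lemma schwartz_linear:
  assumes f: "schwartz f" and g: "schwartz g"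
  shows "schwartz (\<lambda>x. a * f x + b * g x)"
  unfolding schwartz_def iter_deriv_linear[OF f g]
proof (intro conjI allI)
  fix vs x
  show "(\<lambda>x. a * iter_deriv f vs x + b * iter_deriv g vs x) differentiable at x"
    using f g unfolding schwartz_def by (intro derivative_intros) auto
next
  fix vs and k :: nat
  obtain A where A: "\<And>x. (1 + norm x) ^ k * norm (iter_deriv f vs x) \<le> A"
    using f unfolding schwartz_def bounded_iff by fastforce
  obtain B where B: "\<And>x. (1 + norm x) ^ k * norm (iter_deriv g vs x) \<le> B"
    using g unfolding schwartz_def bounded_iff by fastforce
  have "(1 + norm x) ^ k * norm (a * iter_deriv f vs x + b * iter_deriv g vs x) \<le> norm a * A + norm b * B" for x
  proof -
    have "norm (a * iter_deriv f vs x + b * iter_deriv g vs x) \<le> norm a * norm (iter_deriv f vs x) + norm b * norm (iter_deriv g vs x)"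
      by (metis norm_mult norm_triangle_ineq)
    then have "(1 + norm x) ^ k * norm (a * iter_deriv f vs x + b * iter_deriv g vs x)
       \<le> (1 + norm x) ^ k * (norm a * norm (iter_deriv f vs x) + norm b * norm (iter_deriv g vs x))"
      by (intro mult_left_mono) auto
    also have "\<dots> = norm a * ((1 + norm x) ^ k * norm (iter_deriv f vs x)) + norm b * ((1 + norm x) ^ k * norm (iter_deriv g vs x))"
      by (simp add: algebra_simps)
    also have "\<dots> \<le> norm a * A + norm b * B"
      using A[of x] B[of x] by (intro add_mono mult_left_mono) auto
    finally show ?thesis .
  qed
  then show "bounded (range (\<lambda>x. (1 + norm x) ^ k * norm (a * iter_deriv f vs x + b * iter_deriv g vs x)))"
    by (auto intro!: boundedI[of _ "norm a * A + norm b * B"] simp: abs_mult)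
qed

section \<open>Approximation in L^p\<close>

text \<open>The p-th power of the norm, with infinity as an allowed value. Quasi-additivity with
  factor 2^p, in \<open>lp_mass_linear\<close>, suffices for density arguments, so roots and
  Minkowski's inequality do not enter.\<close>

definition lp_mass :: "real \<Rightarrow> ('a::euclidean_space \<Rightarrow> complex) \<Rightarrow> ennreal" where
  "lp_mass p f = (\<integral>\<^sup>+x. ennreal (norm (f x) powr p) \<partial>lborel)"

lemma lp_mass_linear:
  fixes f g :: "'a::euclidean_space \<Rightarrow> complex"
  assumes [measurable]: "f \<in> borel_measurable borel" "g \<in> borel_measurable borel" and p: "p \<ge> 1"
  shows "lp_mass p (\<lambda>x. a * f x + b * g x) \<le>
    ennreal (2 powr p * norm a powr p) * lp_mass p f + ennreal (2 powr p * norm b powr p) * lp_mass p g"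
proof -
  have pt: "norm (a * u + b * v) powr p \<le> 2 powr p * norm a powr p * norm u powr p + 2 powr p * norm b powr p * norm v powr p" for u v
  proof -
    let ?m = "max (norm (a * u)) (norm (b * v))"
    have "norm (a * u + b * v) \<le> norm (a * u) + norm (b * v)" by (rule norm_triangle_ineq)
    also have "\<dots> \<le> 2 * ?m" by simp
    finally have "norm (a * u + b * v) powr p \<le> (2 * ?m) powr p" using p by (intro powr_mono2) auto
    also have "\<dots> = 2 powr p * ?m powr p" by (simp add: powr_mult)
    also have "\<dots> \<le> 2 powr p * (norm (a * u) powr p + norm (b * v) powr p)"
      by (intro mult_left_mono) (auto simp: max_def)
    finally show ?thesis by (simp add: norm_mult powr_mult algebra_simps)
  qed
  have "lp_mass p (\<lambda>x. a * f x + b * g x) \<le>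
     (\<integral>\<^sup>+x. ennreal (2 powr p * norm a powr p) * ennreal (norm (f x) powr p) + ennreal (2 powr p * norm b powr p) * ennreal (norm (g x) powr p) \<partial>lborel)"
    unfolding lp_mass_def
  proof (intro nn_integral_mono)
    fix x
    show "ennreal (norm (a * f x + b * g x) powr p) \<le> ennreal (2 powr p * norm a powr p) * ennreal (norm (f x) powr p) + ennreal (2 powr p * norm b powr p) * ennreal (norm (g x) powr p)"
      using pt[of "f x" "g x"] by (simp add: ennreal_mult[symmetric] ennreal_leI flip: ennreal_plus)
  qed
  then show ?thesis unfolding lp_mass_def by (simp add: nn_integral_add nn_integral_cmult)
qed

text \<open>Bundles what is used of an approximant: the Schwartz property for the restriction
  operator, integrability for \<open>fourier_L1\<close>, finite mass for membership in L^p.\<close>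

definition nice_schwartz :: "real \<Rightarrow> ('a::euclidean_space \<Rightarrow> complex) \<Rightarrow> bool" where
  "nice_schwartz p s \<longleftrightarrow> schwartz s \<and> s \<in> borel_measurable borel \<and> integrable lborel s \<and> lp_mass p s < \<top>"

lemma nice_schwartz_linear:
  assumes f: "nice_schwartz p f" and g: "nice_schwartz p g" and p: "p \<ge> 1"
  shows "nice_schwartz p (\<lambda>x. a * f x + b * g x)"
proof -
  have [measurable]: "f \<in> borel_measurable borel" "g \<in> borel_measurable borel"
    using f g by (auto simp: nice_schwartz_def)
  have "lp_mass p (\<lambda>x. a * f x + b * g x) < \<top>"
    by (rule le_less_trans[OF lp_mass_linear]) (use f g p in \<open>auto simp: nice_schwartz_def ennreal_mult_less_top\<close>)
  then show ?thesis
    using f g by (auto simp: nice_schwartz_def intro!: schwartz_linear)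
qed

text \<open>This class is shown to be closed under linear combinations and dominated limits and to
  contain indicators of boxes, which is what a monotone class argument asks for.\<close>

definition schwartz_approximable :: "real \<Rightarrow> ('a::euclidean_space \<Rightarrow> complex) \<Rightarrow> bool" where
  "schwartz_approximable p f \<longleftrightarrow> f \<in> borel_measurable borel \<and>
     (\<forall>\<epsilon>>0. \<exists>s. nice_schwartz p s \<and> lp_mass p (\<lambda>x. f x - s x) \<le> ennreal \<epsilon>)"

lemma ennreal_scaled_le:
  assumes "0 < \<epsilon>" "0 \<le> A"
  obtains \<delta> where "0 < \<delta>" "ennreal A * ennreal \<delta> \<le> ennreal \<epsilon>"
proof (rule that[of "\<epsilon> / (A + 1)"])
  have "A * (\<epsilon> / (A + 1)) \<le> \<epsilon>" using assms by (simp add: field_simps)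
  then show "ennreal A * ennreal (\<epsilon> / (A + 1)) \<le> ennreal \<epsilon>"
    using assms by (simp add: ennreal_mult[symmetric] ennreal_leI)
qed (use assms in auto)

lemma schwartz_approximable_linear:
  assumes f: "schwartz_approximable p f" and g: "schwartz_approximable p g" and p: "p \<ge> 1"
  shows "schwartz_approximable p (\<lambda>x. a * f x + b * g x)"
  unfolding schwartz_approximable_def
proof (intro conjI allI impI)
  have [measurable]: "f \<in> borel_measurable borel" "g \<in> borel_measurable borel"
    using f g by (auto simp: schwartz_approximable_def)
  show "(\<lambda>x. a * f x + b * g x) \<in> borel_measurable borel" by measurable
  fix \<epsilon> :: real assume \<epsilon>: "\<epsilon> > 0"
  obtain \<delta>1 where \<delta>1: "\<delta>1 > 0" "ennreal (2 powr p * norm a powr p) * ennreal \<delta>1 \<le> ennreal (\<epsilon> / 2)"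
    using ennreal_scaled_le[of "\<epsilon> / 2" "2 powr p * norm a powr p"] \<epsilon> by auto
  obtain \<delta>2 where \<delta>2: "\<delta>2 > 0" "ennreal (2 powr p * norm b powr p) * ennreal \<delta>2 \<le> ennreal (\<epsilon> / 2)"
    using ennreal_scaled_le[of "\<epsilon> / 2" "2 powr p * norm b powr p"] \<epsilon> by auto
  obtain s where s: "nice_schwartz p s" "lp_mass p (\<lambda>x. f x - s x) \<le> ennreal \<delta>1"
    using f \<delta>1 by (auto simp: schwartz_approximable_def)
  obtain t where t: "nice_schwartz p t" "lp_mass p (\<lambda>x. g x - t x) \<le> ennreal \<delta>2"
    using g \<delta>2 by (auto simp: schwartz_approximable_def)
  have [measurable]: "s \<in> borel_measurable borel" "t \<in> borel_measurable borel"
    using s t by (auto simp: nice_schwartz_def)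
  have "lp_mass p (\<lambda>x. (a * f x + b * g x) - (a * s x + b * t x)) = lp_mass p (\<lambda>x. a * (f x - s x) + b * (g x - t x))"
    by (simp add: algebra_simps)
  also have "\<dots> \<le> ennreal (2 powr p * norm a powr p) * lp_mass p (\<lambda>x. f x - s x) + ennreal (2 powr p * norm b powr p) * lp_mass p (\<lambda>x. g x - t x)"
    by (rule lp_mass_linear) (use p in auto)
  also have "\<dots> \<le> ennreal (2 powr p * norm a powr p) * ennreal \<delta>1 + ennreal (2 powr p * norm b powr p) * ennreal \<delta>2"
    by (intro add_mono mult_left_mono s t) auto
  also have "\<dots> \<le> ennreal (\<epsilon> / 2) + ennreal (\<epsilon> / 2)" by (intro add_mono \<delta>1 \<delta>2)
  also have "\<dots> = ennreal \<epsilon>" using \<epsilon> by (simp flip: ennreal_plus)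
  finally show "\<exists>u. nice_schwartz p u \<and> lp_mass p (\<lambda>x. a * f x + b * g x - u x) \<le> ennreal \<epsilon>"
    using nice_schwartz_linear[OF s(1) t(1) p, of a b] by (intro exI[of _ "\<lambda>x. a * s x + b * t x"] conjI)
qed

text \<open>Dominated convergence places some F n near f in p-mass, and F n has a Schwartz function
  near it. The two errors add with a factor 2^p each, which the choice of \<delta>
  anticipates.\<close>

lemma schwartz_approximable_limit:
  assumes F: "\<And>n::nat. schwartz_approximable p (F n)" and [measurable]: "f \<in> borel_measurable borel" and p: "p \<ge> 1"
    and lim: "AE x in lborel. (\<lambda>n. F n x) \<longlonglongrightarrow> f x"
    and dom: "\<And>n x. norm (F n x) \<le> w x" "\<And>x. norm (f x) \<le> w x"
    and [measurable]: "w \<in> borel_measurable borel" and w: "(\<integral>\<^sup>+x. ennreal (w x powr p) \<partial>lborel) < \<top>"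
  shows "schwartz_approximable p f"
  unfolding schwartz_approximable_def
proof (intro conjI allI impI)
  have [measurable]: "F n \<in> borel_measurable borel" for n
    using F by (auto simp: schwartz_approximable_def)
  show "f \<in> borel_measurable borel" by measurable
  fix \<epsilon> :: real assume \<epsilon>: "\<epsilon> > 0"
  have "(\<lambda>n. \<integral>\<^sup>+x. ennreal (norm (F n x - f x) powr p) \<partial>lborel) \<longlonglongrightarrow> (\<integral>\<^sup>+x. 0 \<partial>(lborel :: 'a measure))"
  proof (rule nn_integral_dominated_convergence)
    show "AE x in lborel. ennreal (norm (F n x - f x) powr p) \<le> ennreal (2 powr p) * ennreal (w x powr p)" for n
    proof (rule AE_I2)
      fix x
      have "norm (F n x - f x) \<le> 2 * w x" using dom(1)[of n x] dom(2)[of x] norm_triangle_ineq4[of "F n x" "f x"] by linarith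
      then have "norm (F n x - f x) powr p \<le> (2 * w x) powr p" using p by (intro powr_mono2) auto
      also have "\<dots> = 2 powr p * w x powr p"
        using order_trans[OF norm_ge_zero dom(2)[of x]] by (simp add: powr_mult)
      finally show "ennreal (norm (F n x - f x) powr p) \<le> ennreal (2 powr p) * ennreal (w x powr p)"
        by (simp add: ennreal_mult[symmetric] ennreal_leI)
    qed
    show "(\<integral>\<^sup>+x. ennreal (2 powr p) * ennreal (w x powr p) \<partial>lborel) < \<infinity>"
      using w by (simp add: nn_integral_cmult ennreal_mult_less_top)
    show "AE x in lborel. (\<lambda>n. ennreal (norm (F n x - f x) powr p)) \<longlonglongrightarrow> 0"
      using lim
    proof eventually_elim
      case (elim x)
      have "(\<lambda>n. norm (F n x - f x)) \<longlonglongrightarrow> 0" using elim by (simp add: LIM_zero tendsto_norm_zero)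
      then have "(\<lambda>n. norm (F n x - f x) powr p) \<longlonglongrightarrow> 0 powr p"
        using p by (intro tendsto_powr') auto
      then have "(\<lambda>n. ennreal (norm (F n x - f x) powr p)) \<longlonglongrightarrow> ennreal (0 powr p)"
        by (rule tendsto_ennrealI)
      then show ?case by simp
    qed
  qed measurable
  then have "(\<lambda>n. lp_mass p (\<lambda>x. F n x - f x)) \<longlonglongrightarrow> 0" by (simp add: lp_mass_def)
  obtain \<delta> where \<delta>: "\<delta> > 0" "ennreal (2 powr p) * ennreal \<delta> \<le> ennreal (\<epsilon> / 2)"
    using ennreal_scaled_le[of "\<epsilon> / 2" "2 powr p"] \<epsilon> by auto
  have "eventually (\<lambda>n. lp_mass p (\<lambda>x. F n x - f x) < ennreal \<delta>) sequentially"
    using order_tendstoD(2)[OF \<open>(\<lambda>n. lp_mass p (\<lambda>x. F n x - f x)) \<longlonglongrightarrow> 0\<close>, of "ennreal \<delta>"] \<delta> by simp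
  then obtain n where n: "lp_mass p (\<lambda>x. F n x - f x) < ennreal \<delta>"
    by (auto simp: eventually_sequentially)
  obtain s where s: "nice_schwartz p s" "lp_mass p (\<lambda>x. F n x - s x) \<le> ennreal \<delta>"
    using F[of n] \<delta> by (auto simp: schwartz_approximable_def)
  have [measurable]: "s \<in> borel_measurable borel" using s by (auto simp: nice_schwartz_def)
  have "lp_mass p (\<lambda>x. f x - s x) = lp_mass p (\<lambda>x. (-1) * (F n x - f x) + 1 * (F n x - s x))"
    by simp
  also have "\<dots> \<le> ennreal (2 powr p * norm (-1::complex) powr p) * lp_mass p (\<lambda>x. F n x - f x) + ennreal (2 powr p * norm (1::complex) powr p) * lp_mass p (\<lambda>x. F n x - s x)"
    by (rule lp_mass_linear) (use p in auto)
  also have "\<dots> \<le> ennreal (2 powr p) * ennreal \<delta> + ennreal (2 powr p) * ennreal \<delta>"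
    using n s(2) by (intro add_mono) (auto intro: mult_left_mono)
  also have "\<dots> \<le> ennreal (\<epsilon> / 2) + ennreal (\<epsilon> / 2)" by (intro add_mono \<delta>)
  also have "\<dots> = ennreal \<epsilon>" using \<epsilon> by (simp flip: ennreal_plus)
  finally show "\<exists>u. nice_schwartz p u \<and> lp_mass p (\<lambda>x. f x - u x) \<le> ennreal \<epsilon>"
    using s by blast
qed

lemma nice_imp_approximable:
  assumes "nice_schwartz p s" and p: "p \<ge> 1"
  shows "schwartz_approximable p s"
  using assms by (auto simp: schwartz_approximable_def nice_schwartz_def lp_mass_def intro!: exI[of _ s])

text \<open>The functions \<open>exp (- \<Sum>\<^sub>i y\<^sub>i\<^sup>2\<^sup>n)\<close>, where \<open>y\<close> are affine coordinates mapping the box to the unit cube,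
  are Schwartz functions that converge to the indicator function of the box.\<close>
lemma schwartz_approximable_box:
  fixes a b :: "'a::euclidean_space"
  assumes p: "p \<ge> 1"
  shows "schwartz_approximable p (\<lambda>x. indicator (box a b) x)"
proof -
  have main: "schwartz_approximable p (\<lambda>x. indicator (box a b) x)" if ne: "\<And>i. i \<in> Basis \<Longrightarrow> a \<bullet> i < b \<bullet> i" for a b :: 'a
  proof -
    define s where "s i = 2 / ((b - a) \<bullet> i)" for i :: 'a
    define c where "c i = ((a + b) \<bullet> i) / 2" for i :: 'a
    define y where "y i x = s i * (x \<bullet> i - c i)" for i x :: 'a
    have s: "s i > 0" if "i \<in> Basis" for i using ne[OF that] by (simp add: s_def inner_simps)
    have y1: "\<bar>y i x\<bar> < 1 \<longleftrightarrow> a \<bullet> i < x \<bullet> i \<and> x \<bullet> i < b \<bullet> i"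
      and y2: "\<bar>y i x\<bar> > 1 \<longleftrightarrow> x \<bullet> i < a \<bullet> i \<or> b \<bullet> i < x \<bullet> i" if "i \<in> Basis" for i x
    proof -
      have h: "b \<bullet> i - a \<bullet> i > 0" using ne[OF that] by simp
      have "y i x = (2 * (x \<bullet> i) - a \<bullet> i - b \<bullet> i) / (b \<bullet> i - a \<bullet> i)"
        by (simp add: y_def s_def c_def inner_simps diff_divide_distrib add_divide_distrib right_diff_distrib)
      then have "\<bar>y i x\<bar> = \<bar>2 * (x \<bullet> i) - a \<bullet> i - b \<bullet> i\<bar> / (b \<bullet> i - a \<bullet> i)" using h by (simp add: abs_divide)
      then show "\<bar>y i x\<bar> < 1 \<longleftrightarrow> a \<bullet> i < x \<bullet> i \<and> x \<bullet> i < b \<bullet> i"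
        "\<bar>y i x\<bar> > 1 \<longleftrightarrow> x \<bullet> i < a \<bullet> i \<or> b \<bullet> i < x \<bullet> i"
        using h by (auto simp: divide_less_eq less_divide_eq abs_if)
    qed
    define P where "P n x = (\<Sum>i\<in>Basis. y i x ^ (2 * Suc n))" for n x
    \<comment> \<open>A majorant independent of n: u^(2n+2) \<ge> u^2 - 1 for every real u, so each
      exp(-P n) is at most this Gaussian.\<close>
    define D where "D x = exp (\<Sum>i\<in>Basis. 1 - (y i x)\<^sup>2)" for x
    have [measurable]: "y i \<in> borel_measurable borel" for i unfolding y_def by measurable
    have [measurable]: "P n \<in> borel_measurable borel" for n unfolding P_def by measurable
    have [measurable]: "D \<in> borel_measurable borel" unfolding D_def by measurable
    have pw: "y i x ^ (2 * Suc n) \<ge> (y i x)\<^sup>2 - 1" for i x n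
    proof -
      have pe: "y i x ^ (2 * Suc n) = ((y i x)\<^sup>2) ^ Suc n" by (rule power_mult)
      show ?thesis
      proof (cases "(y i x)\<^sup>2 \<le> 1")
        case True
        moreover have "0 \<le> ((y i x)\<^sup>2) ^ Suc n" by (rule zero_le_power) simp
        ultimately show ?thesis unfolding pe by linarith
      next
        case False
        then have "((y i x)\<^sup>2) ^ 1 \<le> ((y i x)\<^sup>2) ^ Suc n" by (intro power_increasing) auto
        then show ?thesis unfolding pe power_one_right by linarith
      qed
    qed
    have PD: "exp (- P n x) \<le> D x" for n x
    proof -
      have "- P n x \<le> (\<Sum>i\<in>Basis. 1 - (y i x)\<^sup>2)"
        unfolding P_def sum_negf[symmetric]
      proof (rule sum_mono)
        fix i :: 'a
        show "- (y i x ^ (2 * Suc n)) \<le> 1 - (y i x)\<^sup>2" using pw[where i=i and x=x and n=n] by linarith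
      qed
      then show ?thesis by (simp add: D_def)
    qed
    have D1: "D x \<le> exp (real DIM('a))" for x
      unfolding D_def by (simp add: sum_subtractf sum_nonneg)
    have Dbox: "D x \<ge> 1" if "x \<in> box a b" for x
    proof -
      have "(y i x)\<^sup>2 \<le> 1" if "i \<in> Basis" for i
        using y1[OF that, of x] \<open>x \<in> box a b\<close> that by (auto simp: mem_box abs_square_le_1)
      then have "(\<Sum>i\<in>Basis. 1 - (y i x)\<^sup>2) \<ge> 0" by (intro sum_nonneg) auto
      then show ?thesis by (simp add: D_def)
    qed
    have Dint: "integrable lborel D"
    proof -
      let ?f = "\<lambda>(i::'a) (t::real). complex_of_real (exp (1 - (s i * (t - c i))\<^sup>2))"
      have g0: "integrable lborel (\<lambda>t::real. complex_of_real (exp (- (t\<^sup>2))))"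
        using integrable_gaussian_cis[of "sqrt 2" 0] by (simp add: power_mult_distrib)
      have fi: "integrable lborel (?f i)" if i: "i \<in> Basis" for i
      proof -
        have "integrable lborel (\<lambda>t. exp 1 * complex_of_real (exp (- ((- (s i * c i) + s i * t)\<^sup>2))))"
          using s[OF i] by (intro integrable_mult_right lborel_integrable_real_affine[OF g0]) auto
        moreover have "exp 1 * complex_of_real (exp (- ((- (s i * c i) + s i * t)\<^sup>2))) = ?f i t" for t
          by (simp add: algebra_simps exp_diff exp_minus field_simps flip: exp_of_real)
        ultimately show ?thesis by simp
      qed
      have "integrable lborel (\<lambda>x::'a. \<Prod>i\<in>Basis. ?f i (x \<bullet> i))"
        by (rule integrable_lborel_prod_Basis[OF fi])
      moreover have "(\<Prod>i\<in>Basis. ?f i (x \<bullet> i)) = complex_of_real (D x)" for x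
        by (simp add: D_def y_def exp_sum)
      ultimately have "integrable lborel (\<lambda>x::'a. complex_of_real (D x))" by simp
      then show ?thesis by (rule iffD1[OF complex_of_real_integrable_eq])
    qed
    have D0: "D x > 0" for x by (simp add: D_def)
    have Dp: "(\<integral>\<^sup>+x. ennreal (D x powr p) \<partial>lborel) < \<top>"
    proof -
      have "(\<integral>\<^sup>+x. ennreal (D x powr p) \<partial>lborel) \<le> (\<integral>\<^sup>+x. ennreal (exp (real DIM('a)) powr (p - 1)) * ennreal (D x) \<partial>lborel)"
      proof (intro nn_integral_mono)
        fix x
        have "D x powr p = D x powr (p - 1) * D x powr 1" by (subst powr_add[symmetric]) simp
        also have "\<dots> \<le> exp (real DIM('a)) powr (p - 1) * D x powr 1"
          using D0[of x] D1[of x] p by (intro mult_right_mono powr_mono2) auto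
        finally show "ennreal (D x powr p) \<le> ennreal (exp (real DIM('a)) powr (p - 1)) * ennreal (D x)"
          using D0[of x] by (simp add: ennreal_mult[symmetric] ennreal_leI)
      qed
      also have "\<dots> = ennreal (exp (real DIM('a)) powr (p - 1)) * ennreal (LINT x|lborel. D x)"
        using Dint D0 by (simp add: nn_integral_cmult nn_integral_eq_integral less_imp_le)
      also have "\<dots> < \<top>" by (simp add: ennreal_mult_less_top)
      finally show ?thesis .
    qed
    define F where "F n x = complex_of_real (exp (- P n x))" for n x
    have [measurable]: "F n \<in> borel_measurable borel" for n
      unfolding F_def by measurable
    have FD: "norm (F n x) \<le> D x" for n x using PD[of n x] by (simp add: F_def)
    have sch: "schwartz (F n)" for n
    proof -
      define \<epsilon> where "\<epsilon> = Min (s ` Basis)"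
      have \<epsilon>: "\<epsilon> > 0" "\<And>i. i \<in> Basis \<Longrightarrow> \<epsilon> \<le> s i"
        using s by (auto simp: \<epsilon>_def)
      \<comment> \<open>In each coordinate |y| \<le> y^2 + 1 \<le> y^(2n+2) + 2, and s |c| accounts
        for the shift of the centre.\<close>
      define A where "A = (\<Sum>i\<in>Basis. s i * \<bar>c i\<bar> + 2)"
      have "P n x \<ge> \<epsilon> * norm x - A" for x
      proof -
        have "\<epsilon> * norm x \<le> \<epsilon> * (\<Sum>i\<in>Basis. \<bar>x \<bullet> i\<bar>)"
          using \<epsilon> norm_le_l1[of x] by (intro mult_left_mono) auto
        also have "\<dots> = (\<Sum>i\<in>Basis. \<epsilon> * \<bar>x \<bullet> i\<bar>)" by (simp add: sum_distrib_left)
        also have "\<dots> \<le> (\<Sum>i\<in>Basis. y i x ^ (2 * Suc n) + (s i * \<bar>c i\<bar> + 2))"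
        proof (rule sum_mono)
          fix i :: 'a assume i: "i \<in> Basis"
          have "\<epsilon> * \<bar>x \<bullet> i\<bar> \<le> s i * \<bar>x \<bullet> i\<bar>" using \<epsilon>(2)[OF i] by (intro mult_right_mono) auto
          also have "\<dots> \<le> s i * (\<bar>x \<bullet> i - c i\<bar> + \<bar>c i\<bar>)" using s[OF i] by (intro mult_left_mono) auto
          also have "\<dots> = \<bar>y i x\<bar> + s i * \<bar>c i\<bar>" using s[OF i] by (simp add: y_def abs_mult distrib_left)
          also have "\<bar>y i x\<bar> \<le> (y i x)\<^sup>2 + 1"
          proof -
            have "0 \<le> (\<bar>y i x\<bar> - 1)\<^sup>2" by simp
            then have "2 * \<bar>y i x\<bar> \<le> (y i x)\<^sup>2 + 1" by (simp add: power2_eq_square algebra_simps)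
            then show ?thesis using abs_ge_zero[of "y i x"] by linarith
          qed
          also have "(y i x)\<^sup>2 \<le> y i x ^ (2 * Suc n) + 1" using pw[of i x n] by simp
          finally show "\<epsilon> * \<bar>x \<bullet> i\<bar> \<le> y i x ^ (2 * Suc n) + (s i * \<bar>c i\<bar> + 2)" by simp
        qed
        also have "\<dots> = P n x + A" by (simp only: P_def A_def sum.distrib)
        finally show ?thesis by simp
      qed
      moreover have "real_polynomial_function (P n)"
        unfolding P_def y_def
        by (intro real_polynomial_function_sum real_polynomial_function_power real_polynomial_function.intros(4)
              real_polynomial_function_diff real_polynomial_function.intros(2) real_polynomial_function.intros(1)[OF bounded_linear_inner_left]) auto
      ultimately show ?thesis unfolding F_def using schwartz_exp_neg_polynomial[OF _ \<epsilon>(1)] by blast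
    qed
    have nice: "nice_schwartz p (F n)" for n
      unfolding nice_schwartz_def
    proof (intro conjI sch)
      show "integrable lborel (F n)"
        by (rule Bochner_Integration.integrable_bound[OF Dint]) (use FD D0 in \<open>auto simp: less_imp_le\<close>)
      have "lp_mass p (F n) \<le> (\<integral>\<^sup>+x. ennreal (D x powr p) \<partial>lborel)"
        unfolding lp_mass_def using FD p by (intro nn_integral_mono ennreal_leI powr_mono2) auto
      then show "lp_mass p (F n) < \<top>" using Dp by simp
    qed measurable
    show ?thesis
    proof (rule schwartz_approximable_limit[where F=F and w=D])
      show "schwartz_approximable p (F n)" for n using nice_imp_approximable[OF nice p] .
      \<comment> \<open>On the boundary of the box the limit is not the indicator, but the boundary
        is a null set.\<close>
      have null: "cbox a b - box a b \<in> null_sets lborel"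
        by (rule null_setsI) (auto simp: emeasure_Diff box_subset_cbox emeasure_lborel_cbox_eq emeasure_lborel_box_eq)
      have "AE x in lborel. x \<notin> cbox a b - box a b" by (rule AE_not_in[OF null])
      then show "AE x in lborel. (\<lambda>n. F n x) \<longlonglongrightarrow> indicator (box a b) x"
      proof eventually_elim
        case (elim x)
        show ?case
        proof (cases "x \<in> box a b")
          case True
          have "(\<lambda>n. y i x ^ (2 * Suc n)) \<longlonglongrightarrow> 0" if i: "i \<in> Basis" for i
          proof -
            have "\<bar>y i x\<bar> < 1" using y1[OF i, of x] True i by (simp add: mem_box)
            then have "norm ((y i x)\<^sup>2) < 1" by (simp add: abs_square_less_1)
            then have "(\<lambda>n. ((y i x)\<^sup>2) ^ Suc n) \<longlonglongrightarrow> 0" by (rule LIMSEQ_Suc[OF LIMSEQ_power_zero])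
            then show ?thesis by (simp only: power_mult)
          qed
          then have "(\<lambda>n. P n x) \<longlonglongrightarrow> (\<Sum>i\<in>(Basis::'a set). 0)"
            unfolding P_def by (intro tendsto_sum)
          then have "(\<lambda>n. F n x) \<longlonglongrightarrow> complex_of_real (exp (- 0))"
            unfolding F_def by (intro tendsto_intros) simp
          then show ?thesis using True by simp
        next
          case False
          then have "x \<notin> cbox a b" using elim by auto
          then obtain j where j: "j \<in> Basis" "\<bar>y j x\<bar> > 1"
            using y2[of _ x] by (auto simp: mem_box not_le)
          have q: "(y j x)\<^sup>2 > 1" using j(2) by (simp add: abs_square_less_1 abs_square_le_1 not_le flip: not_le)
          have g1: "filterlim (\<lambda>n. ((y j x)\<^sup>2) ^ Suc n) at_top sequentially"
          proof (rule filterlim_at_infinity_imp_filterlim_at_top)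
            have "norm ((y j x)\<^sup>2) > 1" using q by simp
            from filterlim_compose[OF filterlim_realpow_sequentially_gt1[OF this] filterlim_Suc]
            show "filterlim (\<lambda>n. ((y j x)\<^sup>2) ^ Suc n) at_infinity sequentially" .
            have "((y j x)\<^sup>2) ^ Suc n > 0" for n by (rule zero_less_power) (use q in linarith)
            then show "\<forall>\<^sub>F n in sequentially. 0 < ((y j x)\<^sup>2) ^ Suc n" by simp
          qed
          have g2: "((y j x)\<^sup>2) ^ Suc n \<le> P n x" for n
          proof -
            have "y j x ^ (2 * Suc n) \<le> P n x"
              unfolding P_def
            proof (rule member_le_sum[OF j(1)])
              show "0 \<le> y i x ^ (2 * Suc n)" for i
                by (rule zero_le_even_power) simp
            qed simp
            then show ?thesis by (simp only: power_mult)
          qed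
          have "filterlim (\<lambda>n. P n x) at_top sequentially"
            by (rule filterlim_at_top_mono[OF g1]) (rule always_eventually, rule allI, rule g2)
          then have "(\<lambda>n. exp (- P n x)) \<longlonglongrightarrow> 0"
            by (intro filterlim_compose[OF exp_at_bot] filterlim_compose[OF filterlim_uminus_at_bot_at_top])
          then have "(\<lambda>n. F n x) \<longlonglongrightarrow> complex_of_real 0" unfolding F_def by (rule tendsto_of_real)
          then show ?thesis using False by simp
        qed
      qed
      show "norm (indicator (box a b) x :: complex) \<le> D x" for x
        using Dbox[of x] D0[of x] by (auto simp: indicator_def less_imp_le)
    qed (use FD Dp p in auto)
  qed
  show ?thesis
  proof (cases "box a b = {}")
    case False
    then show ?thesis by (intro main) (simp add: box_ne_empty)
  next
    case True
    \<comment> \<open>The indicator of an empty box is written as a combination with both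
      coefficients 0.\<close>
    have "schwartz_approximable p (\<lambda>x. indicator (box (0::'a) One) x)"
      by (rule main) simp
    from schwartz_approximable_linear[OF this this p, of 0 0] show ?thesis by (simp add: True)
  qed
qed

text \<open>Dynkin's argument, with the open boxes as a generator stable under intersection.
  Intersecting with a fixed box keeps the measures finite, so complements become differences and
  disjoint unions become dominated limits.\<close>

lemma schwartz_approximable_indicator:
  fixes A :: "'a::euclidean_space set"
  assumes p: "p \<ge> 1" and A: "A \<in> sets borel"
  shows "schwartz_approximable p (\<lambda>x. indicator (A \<inter> box u v) x)"
proof -
  let ?G = "range (\<lambda>(a, b). box a b :: 'a set)"
  have stable: "Int_stable ?G"
  proof (rule Int_stableI)
    fix A B assume "A \<in> ?G" "B \<in> ?G"
    then obtain a b c d where "A = box a b" "B = box c d" by auto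
    then show "A \<inter> B \<in> ?G" by (simp only: box_Int_box) (rule range_eqI, subst case_prod_conv, rule refl)
  qed
  have "A \<in> sigma_sets UNIV ?G"
    using A by (simp add: borel_eq_box)
  have sub: "?G \<subseteq> Pow UNIV" by simp
  have meas: "B \<in> sets borel" if "B \<in> sigma_sets UNIV ?G" for B
    using that by (simp add: borel_eq_box)
  show ?thesis
    using stable sub \<open>A \<in> sigma_sets UNIV ?G\<close>
  proof (induction rule: sigma_sets_induct_disjoint)
    case (basic A)
    then show ?case by (auto simp: box_Int_box intro!: schwartz_approximable_box p)
  next
    case empty
    have "schwartz_approximable p (\<lambda>x. 0 * indicator (box u v) x + 0 * indicator (box u v) x)"
      by (intro schwartz_approximable_linear schwartz_approximable_box p)
    then show ?case by simp
  next
    case (compl A)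
    have "schwartz_approximable p (\<lambda>x. 1 * indicator (box u v) x + (-1) * indicator (A \<inter> box u v) x)"
      by (intro schwartz_approximable_linear schwartz_approximable_box p compl)
    also have "(\<lambda>x. 1 * indicator (box u v) x + (-1) * indicator (A \<inter> box u v) x) =
        (\<lambda>x. indicator ((UNIV - A) \<inter> box u v) x :: complex)"
      by (auto simp: indicator_def)
    finally show ?case .
  next
    case (union A)
    have [measurable]: "A i \<in> sets borel" for i using union.hyps(2) by (intro meas) auto
    let ?F = "\<lambda>n x. \<Sum>i<n. indicator (A i \<inter> box u v) x :: complex"
    \<comment> \<open>Disjointness makes the partial sums indicators, hence bounded by the indicator
      of the box.\<close>
    have val: "(\<Sum>i<n. indicator (A i \<inter> box u v) x :: complex) = indicator ((\<Union>i<n. A i) \<inter> box u v) x" for n x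
    proof -
      have uniq: "i = j" if "x \<in> A i" "x \<in> A j" for i j
        using union.hyps(1) that by (auto simp: disjoint_family_on_def)
      show "(\<Sum>i<n. indicator (A i \<inter> box u v) x :: complex) = indicator ((\<Union>i<n. A i) \<inter> box u v) x"
      proof (induction n)
        case (Suc n)
        have disj: "x \<notin> (\<Union>i<n. A i)" if "x \<in> A n"
          using uniq[OF that] by blast
        have "(\<Sum>i<Suc n. indicator (A i \<inter> box u v) x :: complex) =
            indicator ((\<Union>i<n. A i) \<inter> box u v) x + indicator (A n \<inter> box u v) x"
          by (simp only: sum.lessThan_Suc Suc.IH)
        also have "\<dots> = indicator ((\<Union>i<Suc n. A i) \<inter> box u v) x"
          using disj by (auto simp: indicator_def lessThan_Suc)
        finally show ?case .
      qed simp
    qed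
    have F: "schwartz_approximable p (?F n)" for n
    proof (induction n)
      case 0
      have "schwartz_approximable p (\<lambda>x. 0 * indicator (box u v) x + 0 * indicator (box u v) x)"
        by (intro schwartz_approximable_linear schwartz_approximable_box p)
      then show ?case by simp
    next
      case (Suc n)
      from schwartz_approximable_linear[OF this union.IH[of n] p, of 1 1]
      show ?case by simp
    qed
    show ?case
    proof (rule schwartz_approximable_limit[where F="?F" and w="indicator (box u v)"])
      show "AE x in lborel. (\<lambda>n. ?F n x) \<longlonglongrightarrow> indicator ((\<Union>i. A i) \<inter> box u v) x"
      proof (rule AE_I2)
        fix x
        have "eventually (\<lambda>n. ?F n x = indicator ((\<Union>i. A i) \<inter> box u v) x) sequentially"
        proof (cases "\<exists>i. x \<in> A i")
          case True
          then obtain i where i: "x \<in> A i" by blast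
          show ?thesis unfolding val
            by (rule eventually_sequentiallyI[of "Suc i"]) (use i in \<open>auto simp: indicator_def\<close>)
        next
          case False
          then show ?thesis unfolding val by (auto simp: indicator_def)
        qed
        then show "(\<lambda>n. ?F n x) \<longlonglongrightarrow> indicator ((\<Union>i. A i) \<inter> box u v) x"
          by (rule tendsto_eventually)
      qed
      show "norm (?F n x) \<le> indicator (box u v) x" for n x
        unfolding val by (auto simp: indicator_def)
      show "norm (indicator ((\<Union>i. A i) \<inter> box u v) x :: complex) \<le> indicator (box u v) x" for x
        by (auto simp: indicator_def)
      have "(\<integral>\<^sup>+x. ennreal (indicator (box u v) x powr p) \<partial>lborel) = (\<integral>\<^sup>+x. indicator (box u v) x \<partial>lborel)"
        by (intro nn_integral_cong) (auto simp: indicator_def)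
      also have "\<dots> < \<top>" by (simp add: emeasure_lborel_box_eq)
      finally show "(\<integral>\<^sup>+x. ennreal (indicator (box u v) x powr p) \<partial>lborel) < \<top>" .
    qed (use F p in auto)
  qed
qed

text \<open>Simple functions converging to f with |F n| \<le> 2|f|, cut off to growing cubes, are
  combinations of indicators of bounded Borel sets; 2|f| is the majorant.\<close>

lemma schwartz_dense:
  fixes f :: "'a::euclidean_space \<Rightarrow> complex"
  assumes p: "p \<ge> 1" and fm [measurable]: "f \<in> borel_measurable borel" and fp: "lp_mass p f < \<top>"
  shows "schwartz_approximable p f"
proof -
  obtain F where F: "\<And>i. simple_function borel (F i)" "\<And>x. (\<lambda>i. F i x) \<longlonglongrightarrow> f x" "\<And>i x. dist (F i x) 0 \<le> 2 * dist (f x) 0"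
    using borel_measurable_implies_sequence_metric[OF fm, of 0] by (auto simp: space_borel)
  define Q where "Q n = box (- (real n *\<^sub>R One)) (real n *\<^sub>R One :: 'a)" for n
  have Q: "eventually (\<lambda>n. x \<in> Q n) sequentially" for x
  proof -
    obtain N where N: "norm x < real N" using reals_Archimedean2 by blast
    have "x \<in> Q n" if "n \<ge> N" for n
    proof -
      have "\<bar>x \<bullet> i\<bar> < real n" if "i \<in> Basis" for i
        using Basis_le_norm[OF that, of x] N \<open>n \<ge> N\<close> by simp
      then show ?thesis unfolding Q_def mem_box by (auto simp: abs_less_iff minus_less_iff)
    qed
    then show ?thesis by (auto simp: eventually_sequentially)
  qed
  define G where "G n x = F n x * indicator (Q n) x" for n x
  have G: "schwartz_approximable p (G n)" for n
  proof -
    have fin: "finite (range (F n))"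
      using F(1)[of n] by (auto simp: simple_function_def)
    have pre: "F n -` {y} \<in> sets borel" for y
      using measurable_sets[OF borel_measurable_simple_function[OF F(1)[of n]], of "{y}"] by simp
    have sum: "schwartz_approximable p (\<lambda>x. \<Sum>y\<in>Y. y * indicator (F n -` {y} \<inter> Q n) x)" if "finite Y" for Y
      using that
    proof induction
      case empty
      have "schwartz_approximable p (\<lambda>x::'a. 0 * indicator (Q n) x + 0 * indicator (Q n) x)"
        unfolding Q_def by (intro schwartz_approximable_linear schwartz_approximable_box p)
      then show ?case by simp
    next
      case (insert y Y)
      have "schwartz_approximable p (\<lambda>x. y * indicator (F n -` {y} \<inter> Q n) x + 1 * (\<Sum>y\<in>Y. y * indicator (F n -` {y} \<inter> Q n) x))"
        using schwartz_approximable_linear[OF schwartz_approximable_indicator[OF p pre] insert.IH p]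
        unfolding Q_def .
      then show ?case by (simp only: sum.insert[OF insert.hyps] mult_1_left)
    qed
    have "G n = (\<lambda>x. \<Sum>y\<in>range (F n). y * indicator (F n -` {y} \<inter> Q n) x)"
    proof
      fix x
      have "(\<Sum>y\<in>range (F n). y * indicator (F n -` {y} \<inter> Q n) x) = (\<Sum>y\<in>range (F n). if y = F n x then F n x * indicator (Q n) x else 0)"
        by (intro sum.cong) (auto simp: indicator_def)
      also have "\<dots> = G n x" using fin by (simp add: G_def)
      finally show "G n x = (\<Sum>y\<in>range (F n). y * indicator (F n -` {y} \<inter> Q n) x)" ..
    qed
    then show ?thesis using sum[OF fin] by simp
  qed
  show ?thesis
  proof (rule schwartz_approximable_limit[where F=G and w="\<lambda>x. 2 * norm (f x)"])
    show "AE x in lborel. (\<lambda>n. G n x) \<longlonglongrightarrow> f x"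
    proof (rule AE_I2)
      fix x
      have "eventually (\<lambda>n. G n x = F n x) sequentially"
        using Q[of x] by eventually_elim (simp add: G_def)
      then show "(\<lambda>n. G n x) \<longlonglongrightarrow> f x" using F(2)[of x] by (simp add: tendsto_cong)
    qed
    show "norm (G n x) \<le> 2 * norm (f x)" for n x
      using F(3)[of n x] by (auto simp: G_def indicator_def norm_mult)
    have "(\<integral>\<^sup>+x. ennreal ((2 * norm (f x)) powr p) \<partial>lborel) = ennreal (2 powr p) * lp_mass p f"
      unfolding lp_mass_def by (simp add: powr_mult ennreal_mult nn_integral_cmult)
    also have "\<dots> < \<top>" using fp by (simp add: ennreal_mult_less_top)
    finally show "(\<integral>\<^sup>+x. ennreal ((2 * norm (f x)) powr p) \<partial>lborel) < \<top>" .
  qed (use G p in auto)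
qed

section \<open>Lebesgue points on the sphere\<close>

lemma lebesgue_ex_borel_complex:
  fixes f :: "'a::euclidean_space \<Rightarrow> complex"
  assumes f: "f \<in> borel_measurable lebesgue"
  obtains f' where "f' \<in> borel_measurable borel" "AE x in lborel. f x = f' x"
proof -
  have "(\<lambda>x. Re (f x)) \<in> borel_measurable lebesgue" "(\<lambda>x. Im (f x)) \<in> borel_measurable lebesgue"
    using f by measurable
  then obtain u v where uv: "u \<in> borel_measurable lborel" "AE x in lborel. Re (f x) = u x"
      "v \<in> borel_measurable lborel" "AE x in lborel. Im (f x) = v x"
    using completion_ex_borel_measurable_real by metis
  have [measurable]: "u \<in> borel_measurable borel" "v \<in> borel_measurable borel" using uv by simp_all
  show thesis
  proof (rule that[of "\<lambda>x. complex_of_real (u x) + \<i> * complex_of_real (v x)"])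
    show "(\<lambda>x. complex_of_real (u x) + \<i> * complex_of_real (v x)) \<in> borel_measurable borel" by measurable
    show "AE x in lborel. f x = complex_of_real (u x) + \<i> * complex_of_real (v x)"
      using uv(2,4) by eventually_elim (simp add: complex_eq_iff)
  qed
qed

section \<open>The surface measure and its relation to cap measures\<close>

lemma sphere_cone_eq:
  fixes A :: "'a::euclidean_space set"
  assumes "A \<subseteq> sphere 0 1"
  shows "{r *\<^sub>R x | r x. x \<in> A \<and> 0 < r \<and> r \<le> 1} = radial_cone A"
proof (intro equalityI subsetI)
  fix y assume "y \<in> {r *\<^sub>R x | r x. x \<in> A \<and> 0 < r \<and> r \<le> 1}"
  then obtain r x where y: "y = r *\<^sub>R x" "x \<in> A" "0 < r" "r \<le> 1" by auto
  then have "norm x = 1" using assms by auto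
  then show "y \<in> radial_cone A" using y by (auto simp: radial_cone_def sgn_scaleR sgn_div_norm)
next
  fix y assume y: "y \<in> radial_cone A"
  then have "y = norm y *\<^sub>R sgn y" by (simp add: radial_cone_def sgn_div_norm)
  then show "y \<in> {r *\<^sub>R x | r x. x \<in> A \<and> 0 < r \<and> r \<le> 1}"
    using y unfolding radial_cone_def by fastforce
qed

lemma space_sphere_measure [simp]: "space sphere_measure = (sphere 0 1 :: 'a::euclidean_space set)"
  unfolding sphere_measure_def by (rule space_measure_of) (auto simp: sets_restrict_space)

lemma sets_sphere_measure: "sets sphere_measure = sets (restrict_space borel (sphere 0 1 :: 'a::euclidean_space set))"
proof -
  have "sets (sphere_measure :: 'a measure) = sigma_sets (sphere 0 1) (sets (restrict_space lborel (sphere 0 1)))"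
    unfolding sphere_measure_def by (rule sets_measure_of) (auto simp: sets_restrict_space)
  also have "\<dots> = sets (restrict_space lborel (sphere 0 1 :: 'a set))"
    using sets.sigma_sets_eq[of "restrict_space lborel (sphere 0 1 :: 'a set)"] by (simp add: space_restrict_space)
  finally show ?thesis by (simp add: sets_restrict_space)
qed

lemma sets_sphere_measureI: "A \<in> sets borel \<Longrightarrow> sphere 0 1 \<inter> A \<in> sets sphere_measure"
  by (auto simp: sets_sphere_measure sets_restrict_space)

text \<open>\<open>measure_of\<close> takes the prescribed values once they are known to form a
  measure. Countable additivity is inherited from Lebesgue measure, because disjoint sets of
  directions span disjoint cones.\<close>

lemma emeasure_sphere_measure:
  fixes A :: "'a::euclidean_space set"
  assumes A: "A \<in> sets sphere_measure"
  shows "emeasure sphere_measure A = of_nat DIM('a) * emeasure lborel (radial_cone A)"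
proof -
  have sub: "B \<subseteq> sphere 0 1" and borel: "B \<in> sets borel" if "B \<in> sets sphere_measure" for B :: "'a set"
    using that by (auto simp: sets_sphere_measure sets_restrict_space)
  let ?\<mu> = "\<lambda>A::'a set. of_nat DIM('a) * emeasure lborel {r *\<^sub>R x | r x. x \<in> A \<and> 0 < r \<and> r \<le> 1}"
  have "emeasure sphere_measure A = ?\<mu> A"
  proof (rule emeasure_measure_of[OF sphere_measure_def])
    show "sets (restrict_space lborel (sphere 0 1)) \<subseteq> Pow (sphere 0 1 :: 'a set)"
      by (auto simp: sets_restrict_space)
    show "positive (sets sphere_measure) ?\<mu>"
      by (auto simp: positive_def sphere_cone_eq radial_cone_def)
    show "countably_additive (sets sphere_measure) ?\<mu>"
    proof (rule countably_additiveI)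
      fix B :: "nat \<Rightarrow> 'a set"
      assume B: "range B \<subseteq> sets sphere_measure" "disjoint_family B" "(\<Union>i. B i) \<in> sets sphere_measure"
      have Bi: "B i \<in> sets sphere_measure" for i using B(1) by auto
      have "(\<Sum>i. ?\<mu> (B i)) = of_nat DIM('a) * (\<Sum>i. emeasure lborel (radial_cone (B i)))"
        by (simp add: sphere_cone_eq[OF sub[OF Bi]])
      also have "(\<Sum>i. emeasure lborel (radial_cone (B i))) = emeasure lborel (\<Union>i. radial_cone (B i))"
      proof (rule suminf_emeasure)
        show "range (\<lambda>i. radial_cone (B i)) \<subseteq> sets lborel" using borel[OF Bi] by auto
        show "disjoint_family (\<lambda>i. radial_cone (B i))"
          using B(2) by (auto simp: disjoint_family_on_def radial_cone_def)
      qed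
      also have "(\<Union>i. radial_cone (B i)) = radial_cone (\<Union>i. B i)" by (auto simp: radial_cone_def)
      finally show "(\<Sum>i. ?\<mu> (B i)) = ?\<mu> (\<Union>i. B i)" by (simp only: sphere_cone_eq[OF sub[OF B(3)]])
    qed
  qed (use A in auto)
  then show ?thesis by (simp add: sphere_cone_eq[OF sub[OF A]])
qed

text \<open>In a cone only directions count, so the sphere and the closed unit ball cut out the same
  set; the factor d is the one left out of \<open>cap_measure\<close>.\<close>

lemma emeasure_sphere_measure_cap:
  fixes A :: "'a::euclidean_space set"
  assumes [measurable]: "A \<in> sets borel" "\<Omega> \<in> sets borel"
  shows "emeasure sphere_measure (sphere 0 1 \<inter> (\<Omega> \<inter> A)) = of_nat DIM('a) * emeasure (cap_measure \<Omega>) (cball 0 1 \<inter> A)"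
proof -
  have "radial_cone (sphere 0 1 \<inter> (\<Omega> \<inter> A)) = radial_cone (\<Omega> \<inter> (cball 0 1 \<inter> A))"
    by (auto simp: radial_cone_def norm_sgn)
  then show ?thesis
    by (simp add: emeasure_sphere_measure sets_sphere_measureI emeasure_cap_measure)
qed

section \<open>The multiplication formula and its test functions\<close>

text \<open>Fubini for the absolutely integrable kernel s(x) \<phi>(\<xi>) exp(-2 pi i x \<bullet>
  \<xi>), integrated in either order.\<close>

lemma multiplication_formula_integrable:
  fixes s \<phi> :: "'a::euclidean_space \<Rightarrow> complex"
  assumes s: "integrable lborel s" and \<phi>: "integrable lborel \<phi>"
  shows "integrable lborel (\<lambda>\<xi>. fourier_L1 s \<xi> * \<phi> \<xi>)" "integrable lborel (\<lambda>x. s x * fourier_L1 \<phi> x)"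
    "(LINT \<xi>|lborel. fourier_L1 s \<xi> * \<phi> \<xi>) = (LINT x|lborel. s x * fourier_L1 \<phi> x)"
proof -
  have [measurable]: "s \<in> borel_measurable borel" "\<phi> \<in> borel_measurable borel"
    using s \<phi> by (simp_all add: borel_measurable_integrable)
  let ?G = "\<lambda>w. (s (fst w) * \<phi> (snd w)) * cis (- (2 * pi * (fst w \<bullet> snd w)))"
  have "integrable lborel ?G"
    by (intro integrable_times_cis integrable_lborel_tensor s \<phi>) measurable
  then have G: "integrable (lborel \<Otimes>\<^sub>M lborel) ?G" by (simp add: lborel_prod)
  have 1: "(LINT \<xi>|lborel. ?G (x, \<xi>)) = s x * fourier_L1 \<phi> x" for x
    by (simp add: fourier_L1_lborel mult.assoc inner_commute)
  have 2: "(LINT x|lborel. ?G (x, \<xi>)) = fourier_L1 s \<xi> * \<phi> \<xi>" for \<xi>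
  proof -
    have "(LINT x|lborel. ?G (x, \<xi>)) = (LINT x|lborel. (s x * cis (- (2 * pi * (x \<bullet> \<xi>)))) * \<phi> \<xi>)"
      by (intro Bochner_Integration.integral_cong) (auto simp: mult_ac)
    then show ?thesis by (simp add: fourier_L1_lborel)
  qed
  show "integrable lborel (\<lambda>x. s x * fourier_L1 \<phi> x)"
    using lborel_pair.integrable_fst'[OF G] unfolding 1 .
  show "integrable lborel (\<lambda>\<xi>. fourier_L1 s \<xi> * \<phi> \<xi>)"
    using lborel_pair.integrable_snd[of "\<lambda>x \<xi>. ?G (x, \<xi>)"] G unfolding 2 by (simp add: split_beta')
  show "(LINT \<xi>|lborel. fourier_L1 s \<xi> * \<phi> \<xi>) = (LINT x|lborel. s x * fourier_L1 \<phi> x)"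
    using lborel_pair.Fubini_integral[of "\<lambda>x \<xi>. ?G (x, \<xi>)"] G unfolding 1 2 by (simp add: split_beta')
qed

lemma isCont_fourier_L1:
  fixes s :: "'a::euclidean_space \<Rightarrow> complex"
  assumes s: "integrable lborel s"
  shows "isCont (fourier_L1 s) \<xi>"
  unfolding continuous_at_sequentially o_def
proof (intro allI impI)
  fix X assume X: "X \<longlonglongrightarrow> \<xi>"
  have [measurable]: "s \<in> borel_measurable borel"
    using s by (simp add: borel_measurable_integrable)
  have c: "continuous_on UNIV cis" by (intro continuous_intros)
  have "(\<lambda>n. LINT x|lborel. s x * cis (- (2 * pi * (x \<bullet> X n)))) \<longlonglongrightarrow> (LINT x|lborel. s x * cis (- (2 * pi * (x \<bullet> \<xi>))))"
  proof (rule integral_dominated_convergence[where w="\<lambda>x. norm (s x)"])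
    show "AE x in lborel. (\<lambda>n. s x * cis (- (2 * pi * (x \<bullet> X n)))) \<longlonglongrightarrow> s x * cis (- (2 * pi * (x \<bullet> \<xi>)))"
    proof (rule AE_I2)
      fix x
      have "(\<lambda>n. - (2 * pi * (x \<bullet> X n))) \<longlonglongrightarrow> - (2 * pi * (x \<bullet> \<xi>))" by (intro tendsto_intros X)
      then have "(\<lambda>n. cis (- (2 * pi * (x \<bullet> X n)))) \<longlonglongrightarrow> cis (- (2 * pi * (x \<bullet> \<xi>)))"
        using c by (intro isCont_tendsto_compose[of _ cis]) (auto simp: continuous_on_eq_continuous_at)
      then show "(\<lambda>n. s x * cis (- (2 * pi * (x \<bullet> X n)))) \<longlonglongrightarrow> s x * cis (- (2 * pi * (x \<bullet> \<xi>)))"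
        by (rule tendsto_mult[OF tendsto_const])
    qed
  qed (use s in \<open>auto simp: norm_mult\<close>)
  then show "(\<lambda>n. fourier_L1 s (X n)) \<longlonglongrightarrow> fourier_L1 s \<xi>"
    by (simp add: fourier_L1_lborel)
qed

lemma integrable_bounded_support:
  fixes \<phi> :: "'a::euclidean_space \<Rightarrow> complex"
  assumes [measurable]: "\<phi> \<in> borel_measurable borel" and "bounded (range \<phi>)" "bounded {x. \<phi> x \<noteq> 0}"
  obtains M \<rho> where "\<And>x. norm (\<phi> x) \<le> M * indicator (cball 0 \<rho>) x" "M \<ge> 0" "integrable lborel \<phi>"
proof -
  obtain M where M: "\<And>x. norm (\<phi> x) \<le> M" using assms(2) by (auto simp: bounded_iff)
  obtain \<rho> where \<rho>: "\<And>x. \<phi> x \<noteq> 0 \<Longrightarrow> norm x \<le> \<rho>" using assms(3) by (auto simp: bounded_iff)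
  have M0: "M \<ge> 0" using M[of 0] norm_ge_zero order_trans by blast
  have le: "norm (\<phi> x) \<le> M * indicator (cball 0 \<rho>) x" for x
    using M[of x] \<rho> by (cases "\<phi> x = 0") (auto simp: indicator_def M0)
  have "emeasure lborel (cball (0::'a) \<rho>) < \<infinity>"
    by (rule emeasure_bounded_finite) simp
  then have "integrable lborel (\<lambda>x::'a. M * indicator (cball 0 \<rho>) x :: real)"
    by (intro integrable_mult_right integrable_real_indicator) simp_all
  then have "integrable lborel \<phi>"
    by (rule Bochner_Integration.integrable_bound) (use le M0 in \<open>auto simp: indicator_def\<close>)
  then show thesis using that le M0 by blast
qed

text \<open>The quadrilinear bound with W = |\<phi>|: the innermost integral is at most M times the
  integral of u, and the other three give one L^1 norm each.\<close>

lemma fourier_fourth_power_finite: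
  fixes \<phi> :: "'a::euclidean_space \<Rightarrow> complex"
  assumes [measurable]: "\<phi> \<in> borel_measurable borel" and bd: "bounded (range \<phi>)" "bounded {x. \<phi> x \<noteq> 0}"
  shows "(\<integral>\<^sup>+\<xi>. ennreal (norm (fourier_L1 \<phi> \<xi>) ^ 4) \<partial>lborel) < \<top>"
proof -
  obtain M \<rho> where M: "\<And>x. norm (\<phi> x) \<le> M * indicator (cball 0 \<rho>) x" "M \<ge> 0" "integrable lborel \<phi>"
    using integrable_bounded_support[OF assms] by blast
  define W :: "'a \<Rightarrow> ennreal" where "W x = ennreal (norm (\<phi> x))" for x
  have [measurable]: "W \<in> borel_measurable borel" unfolding W_def by measurable
  define I where "I = (\<integral>\<^sup>+x. W x \<partial>lborel)"
  have I: "I < \<top>" using M(3) unfolding I_def W_def by (simp add: integrable_iff_bounded)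
  have WM: "W x \<le> ennreal M" for x
  proof -
    have "norm (\<phi> x) \<le> M"
      using M(1)[of x] M(2) by (cases "x \<in> cball 0 \<rho>") (simp_all del: mem_cball)
    then show ?thesis unfolding W_def by (rule ennreal_leI)
  qed
  have "(\<integral>\<^sup>+\<xi>. ennreal (norm (fourier_L1 \<phi> \<xi>) ^ 4) \<partial>lborel) \<le> I * (I * (I * ennreal M))"
  proof (rule nn_integral_fourier_fourth_power_le[OF M(3), of W])
    fix u :: "'a \<Rightarrow> ennreal" assume u [measurable]: "u \<in> borel_measurable borel" and u1: "(\<integral>\<^sup>+w. u w \<partial>lborel) = 1"
    have 4: "(\<integral>\<^sup>+y4. W y4 * u (c - y4) \<partial>lborel) \<le> ennreal M" for c
    proof -
      have "(\<integral>\<^sup>+y4. W y4 * u (c - y4) \<partial>lborel) \<le> (\<integral>\<^sup>+y4. ennreal M * u (c + - y4) \<partial>lborel)"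
        by (intro nn_integral_mono) (auto intro!: mult_right_mono WM)
      also have "\<dots> = ennreal M * (\<integral>\<^sup>+y4. u (c + - y4) \<partial>lborel)" by (simp add: nn_integral_cmult)
      also have "(\<integral>\<^sup>+y4. u (c + - y4) \<partial>lborel) = (\<integral>\<^sup>+y4. u (c + y4) \<partial>lborel)"
        by (rule nn_integral_lborel_reflect[where F="\<lambda>y. u (c + y)"]) measurable
      also have "\<dots> = 1" using nn_integral_lborel_translate[of u c] u1 by simp
      finally show ?thesis by simp
    qed
    have "(\<integral>\<^sup>+y1. W y1 * (\<integral>\<^sup>+y2. W y2 * (\<integral>\<^sup>+y3. W y3 *
       (\<integral>\<^sup>+y4. W y4 * u (y1 + y2 - y3 - y4) \<partial>lborel) \<partial>lborel) \<partial>lborel) \<partial>lborel)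
     \<le> (\<integral>\<^sup>+y1. W y1 * (\<integral>\<^sup>+y2. W y2 * (\<integral>\<^sup>+y3. W y3 * ennreal M \<partial>lborel) \<partial>lborel) \<partial>lborel)"
      by (intro nn_integral_mono mult_left_mono 4) auto
    also have "\<dots> = I * (I * (I * ennreal M))"
      by (simp add: nn_integral_multc I_def)
    finally show "(\<integral>\<^sup>+y1. W y1 * (\<integral>\<^sup>+y2. W y2 * (\<integral>\<^sup>+y3. W y3 *
       (\<integral>\<^sup>+y4. W y4 * u (y1 + y2 - y3 - y4) \<partial>lborel) \<partial>lborel) \<partial>lborel) \<partial>lborel) \<le> I * (I * (I * ennreal M))" .
  qed (auto simp: W_def)
  also have "\<dots> < \<top>" using I by (simp add: ennreal_mult_less_top)
  finally show ?thesis .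
qed

text \<open>The multiplication formula is an equation between Bochner integrals, which are 0 for
  non-integrable functions. Subtracting two such formulas therefore requires genuine integrability,
  obtained here from the pointwise inequality with t = 1.\<close>

lemma integrable_times_fourier:
  fixes f \<phi> :: "'a::euclidean_space \<Rightarrow> complex"
  assumes [measurable]: "f \<in> borel_measurable borel" and fp: "integrable lborel (\<lambda>x. norm (f x) powr p)"
    and p: "1 \<le> p" "p \<le> 4 / 3"
    and [measurable]: "\<phi> \<in> borel_measurable borel" and bd: "bounded (range \<phi>)" "bounded {x. \<phi> x \<noteq> 0}"
  shows "integrable lborel (\<lambda>x. f x * fourier_L1 \<phi> x)"
proof -
  obtain M \<rho> where "integrable lborel \<phi>"
    using integrable_bounded_support[OF \<open>\<phi> \<in> _\<close> bd] by blast
  define S where "S = (LINT y|lborel. norm (\<phi> y))"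
  have S: "norm (fourier_L1 \<phi> x) \<le> S" "0 \<le> S" for x
    unfolding S_def by (rule norm_fourier_L1_le) (auto simp: \<open>integrable lborel \<phi>\<close>)
  have i4: "integrable lborel (\<lambda>x. norm (fourier_L1 \<phi> x) ^ 4)"
    using fourier_fourth_power_finite[OF \<open>\<phi> \<in> _\<close> bd] by (intro integrableI_bounded) auto
  show ?thesis
  proof (rule Bochner_Integration.integrable_bound)
    show "integrable lborel (\<lambda>x. (1 + S) * norm (f x) powr p + norm (fourier_L1 \<phi> x) ^ 4)"
      by (intro Bochner_Integration.integrable_add integrable_mult_right fp i4)
    show "AE x in lborel. norm (f x * fourier_L1 \<phi> x) \<le> norm ((1 + S) * norm (f x) powr p + norm (fourier_L1 \<phi> x) ^ 4)"
    proof (rule AE_I2)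
      fix x
      have "norm (f x * fourier_L1 \<phi> x) \<le> (1 + S) * norm (f x) powr p + norm (fourier_L1 \<phi> x) ^ 4"
        using times_le_powr_plus_fourth_power[of "norm (f x)" "norm (fourier_L1 \<phi> x)" S 1 p] S p by (simp add: norm_mult)
      then show "norm (f x * fourier_L1 \<phi> x) \<le> norm ((1 + S) * norm (f x) powr p + norm (fourier_L1 \<phi> x) ^ 4)"
        by simp
    qed
  qed measurable
qed

section \<open>Averages and Lebesgue points\<close>

text \<open>A radius r \<le> 1 has a dyadic \<rho> with r \<le> \<rho> \<le> 2r, and the larger ball
  has at most 2^d times the volume.\<close>

lemma dyadic_average_le:
  fixes H :: "'a::euclidean_space \<Rightarrow> complex"
  assumes [measurable]: "H \<in> borel_measurable borel" and Hloc: "\<And>K. compact K \<Longrightarrow> set_integrable lborel K H"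
    and x: "x \<notin> dyadic_maximal_set H \<alpha>" and \<alpha>: "\<alpha> \<ge> 0" and r: "0 < r" "r \<le> 1"
  shows "(LINT y:ball x r|lborel. norm (H y)) \<le> 2 ^ DIM('a) * \<alpha> * (unit_ball_vol (real DIM('a)) * r ^ DIM('a))"
proof -
  define V where "V = unit_ball_vol (real DIM('a))"
  have V: "V > 0" by (simp add: V_def)
  obtain k :: nat where k: "r \<le> (1/2) ^ k" "(1/2) ^ k \<le> 2 * r"
  proof -
    \<comment> \<open>Minimality of k gives r \<le> (1/2)^k for k > 0, and r \<le> 1 gives it for k
      = 0.\<close>
    define k where "k = (LEAST k. (1/2 :: real) ^ Suc k < r)"
    have ex: "\<exists>k. (1/2 :: real) ^ Suc k < r"
    proof -
      obtain n where "(1/2 :: real) ^ n < r" using r real_arch_pow_inv[of r "1/2"] by auto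
      moreover have "(1/2 :: real) ^ Suc n \<le> (1/2) ^ n" by (intro power_decreasing) auto
      ultimately show ?thesis by (intro exI[of _ n]) linarith
    qed
    have 1: "(1/2 :: real) ^ Suc k < r" unfolding k_def using LeastI_ex[OF ex] .
    have 2: "r \<le> (1/2) ^ k"
    proof (cases k)
      case 0
      then show ?thesis using r by simp
    next
      case (Suc j)
      have "\<not> (1/2 :: real) ^ Suc j < r"
      proof (rule not_less_Least[of j "\<lambda>k. (1/2 :: real) ^ Suc k < r"])
        show "j < (LEAST k. (1/2 :: real) ^ Suc k < r)" unfolding k_def[symmetric] Suc by (rule lessI)
      qed
      then show ?thesis using Suc by simp
    qed
    show thesis by (rule that[OF 2]) (use 1 in simp)
  qed
  define \<rho> :: real where "\<rho> = (1/2) ^ k"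
  have \<rho>: "0 < \<rho>" "r \<le> \<rho>" "\<rho> \<le> 2 * r" using k by (auto simp: \<rho>_def)
  let ?I = "\<integral>\<^sup>+v. ennreal (norm (H (x + v))) * indicator (ball 0 \<rho>) v \<partial>lborel"
  have "ennreal (1 / (V * \<rho> ^ DIM('a))) * ?I \<le> ennreal \<alpha>"
    using x unfolding dyadic_maximal_set_def ball_avg_def V_def \<rho>_def by (auto simp: not_less)
  then have "ennreal (V * \<rho> ^ DIM('a)) * (ennreal (1 / (V * \<rho> ^ DIM('a))) * ?I) \<le> ennreal (V * \<rho> ^ DIM('a)) * ennreal \<alpha>"
    by (rule mult_left_mono) simp
  moreover have "ennreal (V * \<rho> ^ DIM('a)) * ennreal (1 / (V * \<rho> ^ DIM('a))) = 1"
    using V \<rho> by (subst ennreal_mult[symmetric]) auto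
  ultimately have I: "?I \<le> ennreal (V * \<rho> ^ DIM('a)) * ennreal \<alpha>"
    by (simp add: mult.assoc[symmetric])
  have "integrable lborel (\<lambda>y. norm (indicator (cball x r) y *\<^sub>R H y))"
    using Hloc[of "cball x r"] by (intro integrable_norm) (simp add: set_integrable_def)
  then have int: "integrable lborel (\<lambda>y. indicator (ball x r) y *\<^sub>R norm (H y))"
    by (rule Bochner_Integration.integrable_bound) (auto simp: indicator_def)
  have "ennreal (LINT y:ball x r|lborel. norm (H y)) = (\<integral>\<^sup>+y. ennreal (indicator (ball x r) y *\<^sub>R norm (H y)) \<partial>lborel)"
    unfolding set_lebesgue_integral_def using int by (intro nn_integral_eq_integral[symmetric]) auto
  also have "\<dots> \<le> (\<integral>\<^sup>+y. ennreal (norm (H y)) * indicator (ball 0 \<rho>) (y - x) \<partial>lborel)"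
    using \<rho> by (intro nn_integral_mono) (auto simp: indicator_def dist_norm norm_minus_commute)
  also have "\<dots> = (\<integral>\<^sup>+v. ennreal (norm (H (x + v))) * indicator (ball 0 \<rho>) ((x + v) - x) \<partial>lborel)"
    by (rule nn_integral_lborel_translate[symmetric]) measurable
  also have "\<dots> = ?I" by simp
  also have "\<dots> \<le> ennreal (V * \<rho> ^ DIM('a)) * ennreal \<alpha>" by (rule I)
  also have "\<dots> = ennreal (V * \<rho> ^ DIM('a) * \<alpha>)" using V \<rho> \<alpha> by (simp add: ennreal_mult)
  also have "\<dots> \<le> ennreal (V * (2 * r) ^ DIM('a) * \<alpha>)"
    using V \<rho> \<alpha> by (intro ennreal_leI mult_right_mono mult_left_mono power_mono) auto
  finally have "(LINT y:ball x r|lborel. norm (H y)) \<le> V * (2 * r) ^ DIM('a) * \<alpha>"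
    using V r \<alpha> by (subst (asm) ennreal_le_iff) auto
  then show ?thesis by (simp add: V_def power_mult_distrib mult_ac)
qed

lemma average_triangle_le:
  fixes g s :: "'a::euclidean_space \<Rightarrow> complex"
  assumes [measurable]: "g \<in> borel_measurable borel" "s \<in> borel_measurable borel"
    and gloc: "\<And>K. compact K \<Longrightarrow> set_integrable lborel K g"
    and Hloc: "\<And>K. compact K \<Longrightarrow> set_integrable lborel K (\<lambda>y. g y - s y)"
    and r: "r > 0" and near: "\<And>y. y \<in> ball x r \<Longrightarrow> norm (s y - c) \<le> \<beta>"
  shows "(LINT y:ball x r|lborel. norm (g y - c)) \<le> (LINT y:ball x r|lborel. norm (g y - s y)) + \<beta> * (unit_ball_vol (real DIM('a)) * r ^ DIM('a))"
proof -
  have fin: "emeasure lborel (ball x r) < \<infinity>" using r by (simp add: emeasure_ball)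
  have ib: "integrable lborel (\<lambda>y. indicator (ball x r) y *\<^sub>R \<beta>)"
    using fin by (simp add: integrable_mult_left)
  have ic: "integrable lborel (\<lambda>y. indicator (cball x r) y *\<^sub>R c)"
    using r by (simp add: integrable_mult_left emeasure_cball)
  have loc: "integrable lborel (\<lambda>y. indicator (ball x r) y *\<^sub>R norm (u y))"
    if [measurable]: "u \<in> borel_measurable borel" and "integrable lborel (\<lambda>y. indicator (cball x r) y *\<^sub>R u y)" for u :: "'a \<Rightarrow> complex"
    using integrable_norm[OF that(2)] by (rule Bochner_Integration.integrable_bound) (auto simp: indicator_def)
  have i1: "integrable lborel (\<lambda>y. indicator (ball x r) y *\<^sub>R norm (g y - c))"
  proof (rule loc)
    have "integrable lborel (\<lambda>y. indicator (cball x r) y *\<^sub>R g y - indicator (cball x r) y *\<^sub>R c)"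
      using gloc[of "cball x r"] ic by (intro Bochner_Integration.integrable_diff) (auto simp: set_integrable_def)
    then show "integrable lborel (\<lambda>y. indicator (cball x r) y *\<^sub>R (g y - c))" by (simp add: scaleR_diff_right)
  qed measurable
  have i2: "integrable lborel (\<lambda>y. indicator (ball x r) y *\<^sub>R norm (g y - s y))"
    by (rule loc) (use Hloc[of "cball x r"] in \<open>auto simp: set_integrable_def\<close>)
  have "(LINT y:ball x r|lborel. norm (g y - c)) \<le> (LINT y|lborel. indicator (ball x r) y *\<^sub>R norm (g y - s y) + indicator (ball x r) y *\<^sub>R \<beta>)"
    unfolding set_lebesgue_integral_def
  proof (rule integral_mono[OF i1 Bochner_Integration.integrable_add[OF i2 ib]])
    fix y
    have "norm (g y - c) \<le> norm (g y - s y) + norm (s y - c)"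
      using norm_triangle_ineq[of "g y - s y" "s y - c"] by simp
    then show "indicator (ball x r) y *\<^sub>R norm (g y - c) \<le> indicator (ball x r) y *\<^sub>R norm (g y - s y) + indicator (ball x r) y *\<^sub>R \<beta>"
      using near[of y] by (cases "y \<in> ball x r") (auto simp del: mem_ball)
  qed
  also have "\<dots> = (LINT y:ball x r|lborel. norm (g y - s y)) + (LINT y|lborel. indicator (ball x r) y *\<^sub>R \<beta>)"
    unfolding set_lebesgue_integral_def by (rule Bochner_Integration.integral_add[OF i2 ib])
  also have "(LINT y|lborel. indicator (ball x r) y *\<^sub>R \<beta>) = \<beta> * (unit_ball_vol (real DIM('a)) * r ^ DIM('a))"
    using r by (simp add: content_ball mult.commute)
  finally show ?thesis .
qed

text \<open>Averages ignore null sets, so the argument can work with a Borel representative and with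
  \<open>lborel\<close>.\<close>

lemma lebesgue_point_val_borel:
  fixes g g' :: "'a::euclidean_space \<Rightarrow> complex"
  assumes g: "g \<in> borel_measurable lebesgue" and [measurable]: "g' \<in> borel_measurable borel" and ae: "AE x in lborel. g x = g' x"
  shows "lebesgue_point_val g x c \<longleftrightarrow>
    ((\<lambda>r. (LINT y:ball x r|lborel. norm (g' y - c)) / (unit_ball_vol (real DIM('a)) * r ^ DIM('a))) \<longlongrightarrow> 0) (at_right 0)"
proof -
  have "(LINT y:ball x r|lebesgue. norm (g y - c)) = (LINT y:ball x r|lborel. norm (g' y - c))" for r
  proof -
    have [measurable]: "ball x r \<in> sets borel" by simp
    have m: "(\<lambda>y. indicat_real (ball x r) y *\<^sub>R norm (g' y - c)) \<in> borel_measurable lborel"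
      by measurable
    have "(LINT y:ball x r|lebesgue. norm (g y - c)) = (LINT y:ball x r|lebesgue. norm (g' y - c))"
      unfolding set_lebesgue_integral_def
    proof (rule integral_cong_AE)
      show "AE y in lebesgue. indicat_real (ball x r) y *\<^sub>R norm (g y - c) = indicat_real (ball x r) y *\<^sub>R norm (g' y - c)"
        using AE_completion[OF ae] by eventually_elim simp
      show "(\<lambda>y. indicat_real (ball x r) y *\<^sub>R norm (g y - c)) \<in> borel_measurable lebesgue"
      proof -
        note g[measurable]
        have [measurable]: "ball x r \<in> sets lebesgue" by (rule fmeasurableD[OF lmeasurable_ball])
        show ?thesis by measurable
      qed
      show "(\<lambda>y. indicat_real (ball x r) y *\<^sub>R norm (g' y - c)) \<in> borel_measurable lebesgue"
        by (rule measurable_completion[OF m])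
    qed
    also have "\<dots> = (LINT y:ball x r|lborel. norm (g' y - c))"
      unfolding set_lebesgue_integral_def by (rule integral_completion[OF m])
    finally show ?thesis .
  qed
  moreover have "measure lebesgue (ball x r) = unit_ball_vol (real DIM('a)) * r ^ DIM('a)" if "r > 0" for r
    using that by (simp add: content_ball)
  ultimately show ?thesis
    unfolding lebesgue_point_val_def
    by (intro tendsto_cong eventually_at_rightI[of 0 1]) auto
qed

text \<open>Averaging |c - c'| \<le> |g' - c| + |g' - c'| over small balls forces the constant to be
  0. The second half of the theorem quantifies over every regularised value and so asks for
  uniqueness.\<close>

lemma lebesgue_point_val_unique:
  fixes g :: "'a::euclidean_space \<Rightarrow> complex"
  assumes g: "g \<in> borel_measurable lebesgue" and g'm [measurable]: "g' \<in> borel_measurable borel" and ae: "AE x in lborel. g x = g' x"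
    and gloc: "\<And>K. compact K \<Longrightarrow> set_integrable lborel K g'"
    and c: "lebesgue_point_val g x c" and c': "lebesgue_point_val g x c'"
  shows "c = c'"
proof -
  let ?v = "\<lambda>r. unit_ball_vol (real DIM('a)) * r ^ DIM('a)"
  let ?a = "\<lambda>c r. (LINT y:ball x r|lborel. norm (g' y - c)) / ?v r"
  have "((\<lambda>r. ?a c r + ?a c' r) \<longlongrightarrow> 0 + 0) (at_right 0)"
    using c c' unfolding lebesgue_point_val_borel[OF g g'm ae] by (rule tendsto_add)
  moreover have "eventually (\<lambda>r. norm (c - c') \<le> ?a c r + ?a c' r) (at_right 0)"
  proof (rule eventually_at_rightI[of 0 1])
    fix r :: real assume "r \<in> {0<..<1}"
    then have r: "r > 0" by simp
    have v: "?v r > 0" using r by simp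
    have i: "integrable lborel (\<lambda>y. indicator (ball x r) y *\<^sub>R norm (g' y - c))" for c
    proof -
      have "integrable lborel (\<lambda>y. norm (indicator (cball x r) y *\<^sub>R g' y - indicator (cball x r) y *\<^sub>R c))"
        using gloc[of "cball x r"] r
        by (intro integrable_norm Bochner_Integration.integrable_diff)
           (auto simp: set_integrable_def integrable_mult_left emeasure_cball)
      then show ?thesis
        by (rule Bochner_Integration.integrable_bound) (auto simp: indicator_def)
    qed
    have ib: "integrable lborel (\<lambda>y. indicator (ball x r) y *\<^sub>R norm (c - c'))"
      using r by (simp add: integrable_mult_left emeasure_ball)
    have "norm (c - c') * ?v r = (LINT y|lborel. indicator (ball x r) y *\<^sub>R norm (c - c'))"
      using r by (simp add: content_ball mult.commute)
    also have "\<dots> \<le> (LINT y|lborel. indicator (ball x r) y *\<^sub>R norm (g' y - c) + indicator (ball x r) y *\<^sub>R norm (g' y - c'))"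
    proof (rule integral_mono[OF ib Bochner_Integration.integrable_add[OF i i]])
      fix y
      have "norm (c - c') \<le> norm (g' y - c) + norm (g' y - c')"
        using norm_triangle_ineq4[of "g' y - c'" "g' y - c"] by (simp add: add.commute)
      then show "indicator (ball x r) y *\<^sub>R norm (c - c') \<le> indicator (ball x r) y *\<^sub>R norm (g' y - c) + indicator (ball x r) y *\<^sub>R norm (g' y - c')"
        by (auto simp: indicator_def)
    qed
    also have "\<dots> = (LINT y:ball x r|lborel. norm (g' y - c)) + (LINT y:ball x r|lborel. norm (g' y - c'))"
      unfolding set_lebesgue_integral_def by (rule Bochner_Integration.integral_add[OF i i])
    finally have "norm (c - c') \<le> ((LINT y:ball x r|lborel. norm (g' y - c)) + (LINT y:ball x r|lborel. norm (g' y - c'))) / ?v r"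
      using v by (subst pos_le_divide_eq)
    then show "norm (c - c') \<le> ?a c r + ?a c' r" by (simp only: add_divide_distrib)
  qed auto
  ultimately have "norm (c - c') \<le> 0"
    using tendsto_lowerbound[of "\<lambda>r. ?a c r + ?a c' r" 0 "at_right 0" "norm (c - c')"] by simp
  then show ?thesis by simp
qed

text \<open>Let s be a Schwartz function close to f, with transform S. Near x the average of |g - R
  f x| is at most the average of |g - S|, plus that of |S - S(x)|, plus |S(x) - R f x|. The first is
  controlled by the maximal estimate, the second by continuity, the third by boundedness of R into
  L^1 and Markov's inequality. As s approaches f the exceptional sets shrink to measure 0.\<close>

lemma restriction_AE_lebesgue_point:
  fixes f g :: "'a::euclidean_space \<Rightarrow> complex"
    and R :: "('a \<Rightarrow> complex) \<Rightarrow> ('a \<Rightarrow> complex)" and p :: real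
  assumes d: "DIM('a) \<ge> 3" and p: "1 \<le> p" "p \<le> 4 / 3" and fLp: "Lp_fun p f"
    and FT: "is_fourier_transform f g" and Rop: "is_restriction_operator p R"
    and gm: "g \<in> borel_measurable lebesgue"
    and g'm [measurable]: "g' \<in> borel_measurable borel" and gae: "AE x in lborel. g x = g' x"
    and gloc: "\<And>K. compact K \<Longrightarrow> set_integrable lborel K g'"
  shows "AE x in sphere_measure. lebesgue_point_val g x (R f x)"
proof -
  have fm: "f \<in> borel_measurable lebesgue" and fi: "integrable lebesgue (\<lambda>x. norm (f x) powr p)"
    using fLp by (auto simp: Lp_fun_def)
  obtain f' where f'm [measurable]: "f' \<in> borel_measurable borel" and fae: "AE x in lborel. f x = f' x"
    using lebesgue_ex_borel_complex[OF fm] by blast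
  define V where "V = unit_ball_vol (real DIM('a))"
  have V: "V > 0" by (simp add: V_def)
  have powr_leb: "(\<lambda>x. norm (u x) powr p) \<in> borel_measurable lebesgue" if "u \<in> borel_measurable lebesgue" for u :: "'a \<Rightarrow> complex"
    using that by measurable
  have f'p: "integrable lborel (\<lambda>x. norm (f' x) powr p)"
  proof -
    have m: "(\<lambda>x. norm (f' x) powr p) \<in> borel_measurable lborel" by measurable
    have "integrable lebesgue (\<lambda>x. norm (f' x) powr p)"
      by (rule integrable_cong_AE_imp[OF fi measurable_completion[OF m]])
         (use AE_completion[OF fae] in eventually_elim, simp)
    then show ?thesis using integrable_completion[OF m] by simp
  qed
  have FT': "(LINT \<xi>|lborel. g' \<xi> * \<phi> \<xi>) = (LINT x|lborel. f' x * fourier_L1 \<phi> x)"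
    if [measurable]: "\<phi> \<in> borel_measurable borel" and bd: "bounded (range \<phi>)" "bounded {x. \<phi> x \<noteq> 0}" for \<phi>
  proof -
    have \<phi>m: "\<phi> \<in> borel_measurable lebesgue" by (rule measurable_completion) simp
    have hm: "fourier_L1 \<phi> \<in> borel_measurable lebesgue" by (rule measurable_completion) simp
    have m1: "(\<lambda>x. g' x * \<phi> x) \<in> borel_measurable lborel" and m2: "(\<lambda>x. f' x * fourier_L1 \<phi> x) \<in> borel_measurable lborel"
      by measurable
    have "(LINT \<xi>|lborel. g' \<xi> * \<phi> \<xi>) = (LINT \<xi>|lebesgue. g' \<xi> * \<phi> \<xi>)"
      by (rule integral_completion[OF m1, symmetric])
    also have "\<dots> = (LINT \<xi>|lebesgue. g \<xi> * \<phi> \<xi>)"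
      by (rule integral_cong_AE[OF measurable_completion[OF m1] borel_measurable_times[OF gm \<phi>m]])
         (use AE_completion[OF gae] in eventually_elim, simp)
    also have "\<dots> = (LINT x|lebesgue. f x * fourier_L1 \<phi> x)"
      using FT \<phi>m bd unfolding is_fourier_transform_def by blast
    also have "\<dots> = (LINT x|lebesgue. f' x * fourier_L1 \<phi> x)"
      by (rule integral_cong_AE[OF borel_measurable_times[OF fm hm] measurable_completion[OF m2]])
         (use AE_completion[OF fae] in eventually_elim, simp)
    also have "\<dots> = (LINT x|lborel. f' x * fourier_L1 \<phi> x)"
      by (rule integral_completion[OF m2])
    finally show ?thesis .
  qed
  have "schwartz_approximable p f'"
    by (rule schwartz_dense[OF p(1) f'm]) (use f'p in \<open>auto simp: lp_mass_def integrable_iff_bounded\<close>)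
  then have "\<forall>n. \<exists>s. nice_schwartz p s \<and> lp_mass p (\<lambda>x. f' x - s x) \<le> ennreal (1 / real (Suc n))"
    unfolding schwartz_approximable_def by simp
  then obtain s where s: "\<And>n. nice_schwartz p (s n)" "\<And>n. lp_mass p (\<lambda>x. f' x - s n x) \<le> ennreal (1 / real (Suc n))"
    by metis
  have ssch: "schwartz (s n)" and sm [measurable]: "s n \<in> borel_measurable borel" and sint: "integrable lborel (s n)"
    and smass: "lp_mass p (s n) < \<top>" for n using s(1)[of n] by (auto simp: nice_schwartz_def)
  define h where "h n x = f' x - s n x" for n x
  define H where "H n x = g' x - fourier_L1 (s n) x" for n x
  define N where "N n = (LINT x|lborel. norm (h n x) powr p)" for n
  have hm [measurable]: "h n \<in> borel_measurable borel" and Hm [measurable]: "H n \<in> borel_measurable borel" for n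
    unfolding h_def H_def by measurable
  have hp: "integrable lborel (\<lambda>x. norm (h n x) powr p)" for n
    using s(2)[of n] unfolding lp_mass_def h_def[symmetric]
    by (intro integrableI_bounded) (auto intro: le_less_trans)
  have N: "0 \<le> N n" "N n \<le> 1 / real (Suc n)" for n
  proof -
    show "0 \<le> N n" unfolding N_def by (rule integral_nonneg_AE) simp
    have "ennreal (N n) = (\<integral>\<^sup>+x. ennreal (norm (h n x) powr p) \<partial>lborel)"
      unfolding N_def by (rule nn_integral_eq_integral[OF hp, symmetric]) simp
    also have "\<dots> \<le> ennreal (1 / real (Suc n))"
      using s(2)[of n] unfolding lp_mass_def h_def .
    finally show "N n \<le> 1 / real (Suc n)" by (subst (asm) ennreal_le_iff) auto
  qed
  have N0: "N \<longlonglongrightarrow> 0"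
    by (rule tendsto_sandwich[OF _ _ tendsto_const LIMSEQ_Suc[OF lim_1_over_n]]) (use N in auto)
  have cont: "isCont (fourier_L1 (s n)) x" for n x by (rule isCont_fourier_L1[OF sint])
  have hatloc: "set_integrable lborel K (fourier_L1 (s n))" if "compact K" for n K
    using that by (intro borel_integrable_compact[unfolded set_integrable_def[symmetric]] continuous_at_imp_continuous_on ballI cont)
  have Hloc: "set_integrable lborel K (H n)" if "compact K" for n K
    unfolding H_def by (intro set_integral_diff(1) gloc hatloc that)
  have FTH: "(LINT \<xi>|lborel. H n \<xi> * \<phi> \<xi>) = (LINT x|lborel. h n x * fourier_L1 \<phi> x)"
    if [measurable]: "\<phi> \<in> borel_measurable borel" and bd: "bounded (range \<phi>)" "bounded {x. \<phi> x \<noteq> 0}" for \<phi> n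
  proof -
    note asm = that
    obtain M \<rho> where M: "\<And>x. norm (\<phi> x) \<le> M * indicator (cball 0 \<rho>) x" "M \<ge> 0" "integrable lborel \<phi>"
      using integrable_bounded_support[OF asm] by blast
    note mf = multiplication_formula_integrable[OF sint[of n] M(3)]
    have ig: "integrable lborel (\<lambda>x. g' x * \<phi> x)"
    proof (rule Bochner_Integration.integrable_bound)
      show "integrable lborel (\<lambda>x. M * norm (indicator (cball 0 \<rho>) x *\<^sub>R g' x))"
        using gloc[of "cball 0 \<rho>"] by (intro integrable_mult_right integrable_norm) (simp add: set_integrable_def)
      show "AE x in lborel. norm (g' x * \<phi> x) \<le> norm (M * norm (indicator (cball 0 \<rho>) x *\<^sub>R g' x))"
      proof (rule AE_I2)
        fix x
        have "norm (g' x) * norm (\<phi> x) \<le> norm (g' x) * (M * indicator (cball 0 \<rho>) x)"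
          by (intro mult_left_mono M(1)) simp
        then show "norm (g' x * \<phi> x) \<le> norm (M * norm (indicator (cball 0 \<rho>) x *\<^sub>R g' x))"
          using M(2) by (simp add: norm_mult abs_mult mult_ac)
      qed
    qed measurable
    have iF: "integrable lborel (\<lambda>x. f' x * fourier_L1 \<phi> x)"
      by (rule integrable_times_fourier[OF f'm f'p p that])
    have "(LINT \<xi>|lborel. H n \<xi> * \<phi> \<xi>) = (LINT \<xi>|lborel. g' \<xi> * \<phi> \<xi>) - (LINT \<xi>|lborel. fourier_L1 (s n) \<xi> * \<phi> \<xi>)"
      unfolding H_def left_diff_distrib by (rule Bochner_Integration.integral_diff[OF ig mf(1)])
    also have "\<dots> = (LINT x|lborel. f' x * fourier_L1 \<phi> x) - (LINT x|lborel. s n x * fourier_L1 \<phi> x)"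
      by (simp only: FT'[OF that] mf(3))
    also have "\<dots> = (LINT x|lborel. h n x * fourier_L1 \<phi> x)"
      unfolding h_def left_diff_distrib by (rule Bochner_Integration.integral_diff[OF iF mf(2), symmetric])
    finally show ?thesis .
  qed
  \<comment> \<open>The difference of f and s n in the shape of the linearity clause for R. It
    involves f rather than the Borel version f', since R is applied to f; it agrees with
    \<open>h n\<close> almost everywhere.\<close>
  let ?k = "\<lambda>n y. 1 * f y + (-1) * s n y"
  have sLp: "Lp_fun p (s n)" for n
  proof -
    have m: "(\<lambda>x. norm (s n x) powr p) \<in> borel_measurable lborel" by measurable
    have "integrable lborel (\<lambda>x. norm (s n x) powr p)"
      using smass[of n] unfolding lp_mass_def by (intro integrableI_bounded) auto
    then show ?thesis
      unfolding Lp_fun_def using integrable_completion[OF m] by (auto intro: measurable_completion)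
  qed
  have kmm: "?k n \<in> borel_measurable lebesgue" for n
  proof -
    have "s n \<in> borel_measurable lebesgue" by (rule measurable_completion) simp
    then show ?thesis using fm by measurable
  qed
  have kint: "(LINT x|lebesgue. norm (?k n x) powr p) = N n" and kLp: "Lp_fun p (?k n)" for n
  proof -
    have m: "(\<lambda>x. norm (h n x) powr p) \<in> borel_measurable lborel" by measurable
    have ae: "AE x in lebesgue. norm (?k n x) powr p = norm (h n x) powr p"
      using AE_completion[OF fae] by eventually_elim (simp add: h_def)
    have "(LINT x|lebesgue. norm (?k n x) powr p) = (LINT x|lebesgue. norm (h n x) powr p)"
      by (rule integral_cong_AE[OF powr_leb[OF kmm] measurable_completion[OF m] ae])
    then show "(LINT x|lebesgue. norm (?k n x) powr p) = N n"
      unfolding N_def integral_completion[OF m] .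
    have "integrable lebesgue (\<lambda>x. norm (h n x) powr p)" using integrable_completion[OF m] hp by simp
    then have "integrable lebesgue (\<lambda>x. norm (?k n x) powr p)"
      by (rule integrable_cong_AE_imp[OF _ powr_leb[OF kmm]]) (use ae in eventually_elim, simp)
    then show "Lp_fun p (?k n)" using kmm by (simp add: Lp_fun_def)
  qed
  obtain CR where CR: "\<And>u. Lp_fun p u \<Longrightarrow> (LINT x|sphere_measure. norm (R u x)) \<le> CR * Lp_norm p u"
    using Rop unfolding is_restriction_operator_def by blast
  have Rint: "integrable sphere_measure (R (?k n))" for n
    using Rop kLp[of n] unfolding is_restriction_operator_def by blast
  \<comment> \<open>The constant of the restriction operator carries no sign condition, hence
    |CR|.\<close>
  have Rbound: "(LINT x|sphere_measure. norm (R (?k n) x)) \<le> \<bar>CR\<bar> * N n powr (1 / p)" for n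
  proof -
    have "(LINT x|sphere_measure. norm (R (?k n) x)) \<le> CR * Lp_norm p (?k n)" by (rule CR[OF kLp])
    also have "\<dots> = CR * N n powr (1 / p)" by (simp only: Lp_norm_def kint)
    also have "\<dots> \<le> \<bar>CR\<bar> * N n powr (1 / p)" by (intro mult_right_mono) auto
    finally show ?thesis .
  qed
  have Rval: "AE x in sphere_measure. \<forall>n. R (?k n) x = R f x - fourier_L1 (s n) x"
  proof (subst AE_all_countable, rule allI)
    fix n
    have 1: "AE x in sphere_measure. R (?k n) x = 1 * R f x + (-1) * R (s n) x"
      using Rop fLp sLp[of n] unfolding is_restriction_operator_def by blast
    have 2: "AE x in sphere_measure. R (s n) x = fourier_L1 (s n) x"
      using Rop ssch[of n] unfolding is_restriction_operator_def by blast
    show "AE x in sphere_measure. R (?k n) x = R f x - fourier_L1 (s n) x"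
      using 1 2 by eventually_elim simp
  qed
  let ?avg = "\<lambda>x r. (LINT y:ball x r|lborel. norm (g' y - R f x)) / (V * r ^ DIM('a))"
  \<comment> \<open>One cap and one level \<alpha> at a time; finitely many caps and the levels
    1/(m+1) are combined afterwards.\<close>
  have cap: "AE x in sphere_measure. x \<in> ball z0 (1/2) \<longrightarrow> (\<forall>\<^sub>F r in at_right 0. ?avg x r \<le> (2 ^ DIM('a) + 2) * \<alpha>)"
    if \<alpha>: "\<alpha> > 0" for z0 :: 'a and \<alpha>
  proof -
    define \<Omega> where "\<Omega> = ball z0 (1/2)"
    have [measurable]: "\<Omega> \<in> sets borel" by (simp add: \<Omega>_def)
    obtain C where C: "C \<ge> 0" "\<And>w \<rho>. \<rho> > 0 \<Longrightarrow>
      (\<integral>\<^sup>+x. \<integral>\<^sup>+x'. indicator (ball w \<rho>) (x + x') \<partial>cap_measure \<Omega> \<partial>cap_measure \<Omega>) \<le> ennreal (C * \<rho> ^ DIM('a))"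
      unfolding \<Omega>_def using cap_convolution_bound[OF d, of z0] by blast
    have fin: "finite_measure (cap_measure \<Omega>)" by (rule finite_cap_measure) simp
    obtain B where B: "B \<ge> 0"
      "\<And>h H :: 'a \<Rightarrow> complex. h \<in> borel_measurable borel \<Longrightarrow> integrable lborel (\<lambda>x. norm (h x) powr p) \<Longrightarrow>
      H \<in> borel_measurable borel \<Longrightarrow> (\<And>K. compact K \<Longrightarrow> set_integrable lborel K H) \<Longrightarrow>
      (\<And>\<phi>. \<phi> \<in> borel_measurable borel \<Longrightarrow> bounded (range \<phi>) \<Longrightarrow> bounded {x. \<phi> x \<noteq> 0} \<Longrightarrow>
         (LINT \<xi>|lborel. H \<xi> * \<phi> \<xi>) = (LINT x|lborel. h x * fourier_L1 \<phi> x)) \<Longrightarrow>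
      emeasure (cap_measure \<Omega>) (cball 0 1 \<inter> dyadic_maximal_set H \<alpha>) \<le> ennreal (B * (LINT x|lborel. norm (h x) powr p))"
      by (rule dyadic_maximal_estimate[OF fin sets_cap_measure C(2) C(1) p \<alpha>]) blast+
    \<comment> \<open>Bad points at stage n: in T1 the maximal function of \<open>H n\<close>
      exceeds \<alpha>, in T2 the restriction of f - s n has size at least \<alpha>.\<close>
    define T1 where "T1 n = sphere 0 1 \<inter> (\<Omega> \<inter> dyadic_maximal_set (H n) \<alpha>)" for n
    define T2 where "T2 n = {x \<in> space sphere_measure. \<alpha> \<le> norm (R (?k n) x)}" for n
    have T1m: "T1 n \<in> sets sphere_measure" for n
      unfolding T1_def by (rule sets_sphere_measureI) measurable
    have T2m: "T2 n \<in> sets sphere_measure" for n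
      unfolding T2_def using borel_measurable_integrable[OF Rint[of n]] by measurable
    have e1: "emeasure sphere_measure (T1 n) \<le> ennreal (real DIM('a) * (B * N n))" for n
    proof -
      have "emeasure sphere_measure (T1 n) = of_nat DIM('a) * emeasure (cap_measure \<Omega>) (cball 0 1 \<inter> dyadic_maximal_set (H n) \<alpha>)"
        unfolding T1_def by (rule emeasure_sphere_measure_cap) measurable
      also have "\<dots> \<le> of_nat DIM('a) * ennreal (B * N n)"
        unfolding N_def by (intro mult_left_mono B(2) hm hp Hm Hloc FTH) auto
      also have "\<dots> = ennreal (real DIM('a) * (B * N n))"
        using B(1) N(1)[of n] by (simp add: ennreal_mult ennreal_of_nat_eq_real_of_nat)
      finally show ?thesis .
    qed
    have e2: "emeasure sphere_measure (T2 n) \<le> ennreal (1 / \<alpha> * (\<bar>CR\<bar> * N n powr (1 / p)))" for n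
    proof -
      have "emeasure sphere_measure (T2 n) \<le> ennreal (1 / \<alpha> * (LINT x|sphere_measure. norm (R (?k n) x)))"
        unfolding T2_def by (rule integral_Markov_inequality[OF integrable_norm[OF Rint]]) (use \<alpha> in auto)
      also have "\<dots> \<le> ennreal (1 / \<alpha> * (\<bar>CR\<bar> * N n powr (1 / p)))"
        using \<alpha> by (intro ennreal_leI mult_left_mono Rbound) auto
      finally show ?thesis .
    qed
    \<comment> \<open>A point outside this intersection is good for some n, which is enough. For
      every n the intersection has measure below a bound that tends to 0 with
      \<open>N n\<close>.\<close>
    let ?T = "\<Inter>n. T1 n \<union> T2 n"
    have Tm: "?T \<in> sets sphere_measure" using T1m T2m by auto
    have "emeasure sphere_measure ?T \<le> ennreal (real DIM('a) * (B * N n) + 1 / \<alpha> * (\<bar>CR\<bar> * N n powr (1 / p)))" for n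
    proof -
      have "emeasure sphere_measure ?T \<le> emeasure sphere_measure (T1 n \<union> T2 n)"
        by (rule emeasure_mono) (use T1m T2m in auto)
      also have "\<dots> \<le> emeasure sphere_measure (T1 n) + emeasure sphere_measure (T2 n)"
        by (rule emeasure_subadditive[OF T1m T2m])
      also have "\<dots> \<le> ennreal (real DIM('a) * (B * N n)) + ennreal (1 / \<alpha> * (\<bar>CR\<bar> * N n powr (1 / p)))"
        by (intro add_mono e1 e2)
      also have "\<dots> = ennreal (real DIM('a) * (B * N n) + 1 / \<alpha> * (\<bar>CR\<bar> * N n powr (1 / p)))"
        using B(1) N(1)[of n] \<alpha> by (intro ennreal_plus[symmetric]) auto
      finally show ?thesis .
    qed
    moreover have "(\<lambda>n. ennreal (real DIM('a) * (B * N n) + 1 / \<alpha> * (\<bar>CR\<bar> * N n powr (1 / p)))) \<longlonglongrightarrow> ennreal (real DIM('a) * (B * 0) + 1 / \<alpha> * (\<bar>CR\<bar> * 0 powr (1 / p)))"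
      using p N by (intro tendsto_ennrealI tendsto_intros N0 tendsto_powr') auto
    ultimately have "emeasure sphere_measure ?T \<le> ennreal (real DIM('a) * (B * 0) + 1 / \<alpha> * (\<bar>CR\<bar> * 0 powr (1 / p)))"
      by (intro LIMSEQ_le_const) auto
    then have "?T \<in> null_sets sphere_measure" using Tm by (intro null_setsI) auto
    then have "AE x in sphere_measure. x \<notin> ?T" by (rule AE_not_in)
    then show ?thesis
      using Rval AE_space[of sphere_measure]
    proof eventually_elim
      case (elim x)
      show ?case
      proof
        assume "x \<in> ball z0 (1/2)"
        then have x: "x \<in> \<Omega>" "x \<in> sphere 0 1" using elim(3) by (auto simp: \<Omega>_def)
        obtain n where n: "x \<notin> T1 n" "x \<notin> T2 n" using elim(1) by auto
        have x1: "x \<notin> dyadic_maximal_set (H n) \<alpha>" using n(1) x by (auto simp: T1_def)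
        have x2: "norm (R f x - fourier_L1 (s n) x) < \<alpha>"
          using n(2) elim(2,3) by (auto simp: T2_def not_le)
        obtain \<delta> where \<delta>: "\<delta> > 0" "\<And>y. dist y x < \<delta> \<Longrightarrow> dist (fourier_L1 (s n) y) (fourier_L1 (s n) x) < \<alpha>"
          using cont[where n=n and x=x] \<alpha> unfolding continuous_at_eps_delta by blast
        show "\<forall>\<^sub>F r in at_right 0. ?avg x r \<le> (2 ^ DIM('a) + 2) * \<alpha>"
        proof (rule eventually_at_rightI[of 0 "min 1 \<delta>"])
          fix r assume "r \<in> {0<..<min 1 \<delta>}"
          then have r: "0 < r" "r \<le> 1" "r < \<delta>" by auto
          \<comment> \<open>One \<alpha> comes from continuity of the transform of s n at x, the
            other from its distance to R f x there. The dyadic estimate adds 2^d \<alpha>, which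
            explains the constant 2^d + 2.\<close>
          have near: "norm (fourier_L1 (s n) y - R f x) \<le> 2 * \<alpha>" if "y \<in> ball x r" for y
          proof -
            have "norm (fourier_L1 (s n) y - fourier_L1 (s n) x) < \<alpha>"
              using \<delta>(2)[of y] that r by (simp add: dist_norm norm_minus_commute)
            moreover have "norm (fourier_L1 (s n) x - R f x) < \<alpha>" using x2 by (simp add: norm_minus_commute)
            ultimately show ?thesis
              using norm_triangle_ineq[of "fourier_L1 (s n) y - fourier_L1 (s n) x" "fourier_L1 (s n) x - R f x"] by simp
          qed
          have "(LINT y:ball x r|lborel. norm (g' y - R f x)) \<le> (LINT y:ball x r|lborel. norm (H n y)) + 2 * \<alpha> * (V * r ^ DIM('a))"
            unfolding H_def V_def
            by (rule average_triangle_le[OF g'm _ gloc _ r(1) near])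
               (use Hloc[unfolded H_def] in auto)
          also have "(LINT y:ball x r|lborel. norm (H n y)) \<le> 2 ^ DIM('a) * \<alpha> * (V * r ^ DIM('a))"
            unfolding V_def using \<alpha> by (intro dyadic_average_le Hm Hloc x1 r) auto
          finally have "(LINT y:ball x r|lborel. norm (g' y - R f x)) \<le> (2 ^ DIM('a) + 2) * \<alpha> * (V * r ^ DIM('a))"
            by (simp add: distrib_right)
          then show "?avg x r \<le> (2 ^ DIM('a) + 2) * \<alpha>"
            using V r by (subst pos_divide_le_eq) auto
        qed (use \<delta> in auto)
      qed
    qed
  qed
  \<comment> \<open>Compactness reduces the sphere to finitely many caps, so their exceptional null
    sets can be united.\<close>
  obtain Z where Z: "finite Z" "sphere (0::'a) 1 \<subseteq> (\<Union>z\<in>Z. ball z (1/2))"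
    using compact_eq_totally_bounded[THEN iffD1, OF compact_sphere[of "0::'a" 1]]
    by (metis half_gt_zero_iff zero_less_one)
  have "AE x in sphere_measure. \<forall>m. \<forall>z\<in>Z. x \<in> ball z (1/2) \<longrightarrow>
     (\<forall>\<^sub>F r in at_right 0. ?avg x r \<le> (2 ^ DIM('a) + 2) * (1 / real (Suc m)))"
    unfolding AE_all_countable using Z(1) by (intro allI AE_finite_allI cap) auto
  then show ?thesis
    using AE_space[of sphere_measure]
  proof eventually_elim
    case (elim x)
    obtain z where z: "z \<in> Z" "x \<in> ball z (1/2)" using elim(2) Z(2) by auto
    have ev: "\<forall>\<^sub>F r in at_right 0. ?avg x r \<le> (2 ^ DIM('a) + 2) * (1 / real (Suc m))" for m
      using elim(1) z by blast
    have "(?avg x \<longlongrightarrow> 0) (at_right 0)"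
    proof (rule tendstoI)
      fix e :: real assume e: "e > 0"
      have "(\<lambda>m. (2 ^ DIM('a) + 2) * (1 / real (Suc m))) \<longlonglongrightarrow> (2 ^ DIM('a) + 2) * 0"
        by (intro tendsto_intros LIMSEQ_Suc[OF lim_1_over_n])
      then have "\<forall>\<^sub>F m in sequentially. (2 ^ DIM('a) + 2) * (1 / real (Suc m)) < e"
        using e by (intro order_tendstoD(2)) auto
      then obtain m where m: "(2 ^ DIM('a) + 2) * (1 / real (Suc m)) < e"
        by (auto simp: eventually_sequentially)
      have pos: "\<forall>\<^sub>F r in at_right 0. (0::real) < r" by (rule eventually_at_right_less)
      show "\<forall>\<^sub>F r in at_right 0. dist (?avg x r) 0 < e"
        using ev[of m] pos
      proof eventually_elim
        case (elim r)
        have "0 \<le> (LINT y:ball x r|lborel. norm (g' y - R f x))"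
          unfolding set_lebesgue_integral_def by (intro integral_nonneg_AE AE_I2) (simp add: indicator_def)
        then have "0 \<le> ?avg x r" using V elim(2) by simp
        then show ?case using elim(1) m by (simp only: dist_real_def)
      qed
    qed
    then show ?case unfolding lebesgue_point_val_borel[OF gm g'm gae] V_def .
  qed
qed

theorem theorem1p3:
  fixes f g :: "'a::euclidean_space \<Rightarrow> complex"
    and R :: "('a \<Rightarrow> complex) \<Rightarrow> ('a \<Rightarrow> complex)"
    and p :: real
  assumes "DIM('a) \<ge> 3"
    and "1 \<le> p" and "p \<le> 4 / 3"
    and "Lp_fun p f"
    and "is_fourier_transform f g"
    and "is_restriction_operator p R"
  shows "(AE x in sphere_measure. \<exists>c. lebesgue_point_val g x c)
    \<and> (AE x in sphere_measure. \<forall>c. lebesgue_point_val g x c \<longrightarrow> c = R f x)"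
proof -
  have loc: "set_integrable lebesgue K g" if "compact K" for K
    using assms(5) that unfolding is_fourier_transform_def by blast
  \<comment> \<open>Local integrability includes measurability of the truncations of g to balls, and
    g is their pointwise limit.\<close>
  have gm: "g \<in> borel_measurable lebesgue"
  proof (rule borel_measurable_LIMSEQ_metric)
    fix n :: nat
    show "(\<lambda>x. indicat_real (cball 0 (real n)) x *\<^sub>R g x) \<in> borel_measurable lebesgue"
      using borel_measurable_integrable[OF loc[of "cball 0 (real n)", unfolded set_integrable_def]] by simp
  next
    fix x :: 'a
    obtain n0 where n0: "norm x \<le> real n0" using real_arch_simple by blast
    have "\<forall>\<^sub>F n in sequentially. indicat_real (cball 0 (real n)) x *\<^sub>R g x = g x"
      by (rule eventually_sequentiallyI[of n0]) (use n0 in \<open>auto simp: indicator_def\<close>)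
    then show "(\<lambda>n. indicat_real (cball 0 (real n)) x *\<^sub>R g x) \<longlonglongrightarrow> g x" by (rule tendsto_eventually)
  qed
  obtain g' where g'm [measurable]: "g' \<in> borel_measurable borel" and gae: "AE x in lborel. g x = g' x"
    using lebesgue_ex_borel_complex[OF gm] by blast
  have gloc: "set_integrable lborel K g'" if K: "compact K" for K
  proof -
    have [measurable]: "K \<in> sets borel" using K by (simp add: borel_compact)
    have m: "(\<lambda>x. indicat_real K x *\<^sub>R g' x) \<in> borel_measurable lborel" by measurable
    have "integrable lebesgue (\<lambda>x. indicat_real K x *\<^sub>R g' x)"
      by (rule integrable_cong_AE_imp[OF loc[OF K, unfolded set_integrable_def] measurable_completion[OF m]])
         (use AE_completion[OF gae] in eventually_elim, simp)
    then show ?thesis unfolding set_integrable_def using integrable_completion[OF m] by simp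
  qed
  have "AE x in sphere_measure. lebesgue_point_val g x (R f x)"
    by (rule restriction_AE_lebesgue_point[OF assms gm g'm gae gloc])
  then show ?thesis
  proof (intro conjI)
    assume *: "AE x in sphere_measure. lebesgue_point_val g x (R f x)"
    show "AE x in sphere_measure. \<exists>c. lebesgue_point_val g x c"
      using * by eventually_elim blast
    show "AE x in sphere_measure. \<forall>c. lebesgue_point_val g x c \<longrightarrow> c = R f x"
      using * by eventually_elim (metis lebesgue_point_val_unique[OF gm g'm gae gloc])
  qed
qed

end
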